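(* Assume that the weights $\mathbf W$ satisfy Conditions 1 (given in the context), and let $0<\epsilon'\le 1$. There exist a constant $F>0$ (independent of $n$) and a constant $A>0$ depending only on the distribution of $W$ such that, for every sequence $f_n=o(n^{1/3})$ with $f_n\ge F$, for all $n$ large enough, the following holds. Consider the event that the largest connected component of $G(\mathbf W,p_{f_n})$ has its size in the interval $$\left[\frac{2(1-\epsilon'/2)f_n\ell_n^{2/3}}{C}-\frac{\ell_n^{2/3}}{C},\ \frac{2(1+\epsilon'/2)f_n\ell_n^{2/3}}{C}\right]$$ and its weight in the interval $$\left[\frac{2(1-\epsilon')f_n\ell_n^{2/3}}{C},\ \frac{2(1+\epsilon')f_n\ell_n^{2/3}}{C}\right].$$ The probability that this event does not happen is at most $A\exp\left(-f_n/A\right)$.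
   Context: Model. For each $n\ge1$, $\mathbf W=(w_1,\dots,w_n)$ is a deterministic vector of weights (depending implicitly on $n$) with $0<w_n\le w_{n-1}\le\dots\le w_1$, and $\ell_n=\sum_{i=1}^n w_i$. For $p\in[0,+\infty]$, $G(\mathbf W,p)$ is the random graph on $\{1,\dots,n\}$ in which each edge $\{i,j\}$ is present with probability $1-e^{-w_iw_jp}$, independently of everything else. Conditions 1. There is a positive random variable $W$ such that: (i) the distribution of a uniformly chosen weight (uniform among $w_1,\dots,w_n$) converges weakly to $W$ as $n\to\infty$; (ii) $\mathbb E[W^3]<\infty$; (iii) $\mathbb E[W^2]=\mathbb E[W]$; (iv) $\ell_n=\mathbb E[W]n+o(n^{2/3})$; (v) $\sum_{k=1}^n w_k^2=\mathbb E[W^2]n+o(n^{2/3})$; (vi) $\sum_{k=1}^n w_k^3=\mathbb E[W^3]n+o(1)$; (vii) $\max_{i\le n}w_i=o(n^{1/3})$. Notation. $C=\mathbb E[W^3]/\mathbb E[W]$ and $p_{f_n}=\dfrac{\ell_n^{1/3}+f_n}{\ell_n^{4/3}}$. The size of a connected component is its number of vertices; its weight is the sum of $w_i$ over its vertices $i$. *)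

theory Defs
  imports "HOL-Probability.Probability" "HOL-Library.Landau_Symbols"
begin

section \<open>Weights\<close>

text \<open>A weight array \<open>w\<close> gives, for each \<open>n \<ge> 1\<close>, the weights \<open>w n 1, \<dots>, w n n\<close>;
  values \<open>w n i\<close> with \<open>i\<close> outside \<open>{1..n}\<close> play no role.\<close>

definition weight_array :: "(nat \<Rightarrow> nat \<Rightarrow> real) \<Rightarrow> bool" where
  "weight_array w \<longleftrightarrow>
     (\<forall>n\<ge>1. 0 < w n n \<and> (\<forall>i j. 1 \<le> i \<and> i \<le> j \<and> j \<le> n \<longrightarrow> w n j \<le> w n i))"

definition total_weight :: "(nat \<Rightarrow> nat \<Rightarrow> real) \<Rightarrow> nat \<Rightarrow> real" where
  "total_weight w n = (\<Sum>i=1..n. w n i)"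

text \<open>The \<open>k\<close>-th moment of a random variable whose law is \<open>\<mu>\<close>.\<close>

definition law_moment :: "real measure \<Rightarrow> nat \<Rightarrow> real" where
  "law_moment \<mu> k = (\<integral>x. x ^ k \<partial>\<mu>)"

text \<open>The limiting positive random variable \<open>W\<close> is represented by its law \<open>\<mu>\<close> on the reals.\<close>

definition weight_conditions :: "real measure \<Rightarrow> (nat \<Rightarrow> nat \<Rightarrow> real) \<Rightarrow> bool" where
  "weight_conditions \<mu> w \<longleftrightarrow>
     real_distribution \<mu> \<and> (AE x in \<mu>. 0 < x) \<and>
     weak_conv_m (\<lambda>n. distr (uniform_count_measure {1..n}) borel (w n)) \<mu> \<and>
     integrable \<mu> (\<lambda>x. x ^ 3) \<and>
     law_moment \<mu> 2 = law_moment \<mu> 1 \<and>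
     (\<lambda>n. total_weight w n - law_moment \<mu> 1 * real n) \<in> o(\<lambda>n. real n powr (2/3)) \<and>
     (\<lambda>n. (\<Sum>k=1..n. (w n k) ^ 2) - law_moment \<mu> 2 * real n) \<in> o(\<lambda>n. real n powr (2/3)) \<and>
     (\<lambda>n. (\<Sum>k=1..n. (w n k) ^ 3) - law_moment \<mu> 3 * real n) \<in> o(\<lambda>n. 1) \<and>
     (\<lambda>n. Max (w n ` {1..n})) \<in> o(\<lambda>n. real n powr (1/3))"

definition size_const :: "real measure \<Rightarrow> real" where
  "size_const \<mu> = law_moment \<mu> 3 / law_moment \<mu> 1"

definition crit_param :: "real \<Rightarrow> real \<Rightarrow> real" where
  "crit_param l f = (l powr (1/3) + f) / l powr (4/3)"

section \<open>The random graph\<close>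

text \<open>A simple graph on \<open>{1..n}\<close> is identified with its set of edges, an edge being a
  two-element set of vertices; isolated vertices are thus components as well.\<close>

definition all_edges :: "nat \<Rightarrow> nat set set" where
  "all_edges n = {{i, j} | i j. i \<in> {1..n} \<and> j \<in> {1..n} \<and> i \<noteq> j}"

text \<open>In the following, \<open>v\<close> is the weight vector; for an edge \<open>e = {i, j}\<close> the product over \<open>e\<close>
  is \<open>v i * v j\<close>.\<close>

definition edge_prob :: "(nat \<Rightarrow> real) \<Rightarrow> real \<Rightarrow> nat set \<Rightarrow> real" where
  "edge_prob v p e = 1 - exp (- ((\<Prod>i\<in>e. v i) * p))"

definition random_graph :: "nat \<Rightarrow> (nat \<Rightarrow> real) \<Rightarrow> real \<Rightarrow> nat set set pmf" where
  "random_graph n v p =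
     map_pmf (\<lambda>present. {e \<in> all_edges n. present e})
       (Pi_pmf (all_edges n) False (\<lambda>e. bernoulli_pmf (edge_prob v p e)))"

definition components :: "nat \<Rightarrow> nat set set \<Rightarrow> nat set set" where
  "components n E = {1..n} // {(x, y) \<in> {1..n} \<times> {1..n}. (x, y) \<in> {(a, b). {a, b} \<in> E}\<^sup>*}"

definition largest_component :: "nat \<Rightarrow> nat set set \<Rightarrow> nat set \<Rightarrow> bool" where
  "largest_component n E K \<longleftrightarrow>
     K \<in> components n E \<and> (\<forall>K'\<in>components n E. card K' \<le> card K)"

text \<open>In case of ties, every component of maximal size has to satisfy the size and weight bounds.\<close>

definition giant_event ::
    "nat \<Rightarrow> (nat \<Rightarrow> real) \<Rightarrow> real \<Rightarrow> real \<Rightarrow> real \<Rightarrow> real \<Rightarrow> nat set set set" where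
  "giant_event n v l C f \<epsilon> =
     {E. \<forall>K. largest_component n E K \<longrightarrow>
        real (card K) \<in> {2 * (1 - \<epsilon>/2) * f * l powr (2/3) / C - l powr (2/3) / C ..
                         2 * (1 + \<epsilon>/2) * f * l powr (2/3) / C} \<and>
        (\<Sum>i\<in>K. v i) \<in> {2 * (1 - \<epsilon>) * f * l powr (2/3) / C ..
                         2 * (1 + \<epsilon>) * f * l powr (2/3) / C}}"

end

theory Submission
  imports Defs
begin

text \<open>Colour every vertex \<open>i\<close> independently with probability \<open>1 - exp (- p x (1 + w\<^sub>i))\<close> and let \<open>A\<close> be the
  union of the components that contain a coloured vertex. The law of the set \<open>A\<close> has the same recursive
  structure as the final set of an epidemic in which \<open>i\<close> is infected as soon as the infected weight
  exceeds an exponential threshold (Sellke's construction), so the two laws agree. In the latter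
  picture the set of vertices infected under a fixed pressure \<open>t\<close> is a product measure, whence
  one-time Chernoff bounds for the weight and the size of \<open>A\<close>; that the weight of \<open>A\<close> does not end
  in the gap between \<open>o(M)\<close> and \<open>2 M\<close>, where \<open>M = f l\<^bsup>2/3\<^esup> / C\<close>, follows from a product martingale stopped at
  the end of the epidemic. Hence for every \<open>x\<close> up to a multiple of \<open>f\<^sup>2 l\<^bsup>1/3\<^esup>\<close>, up to probability
  \<open>O(exp (- 2 f))\<close>, the set \<open>A\<close> is either tiny or has size and weight close to \<open>2 M\<close>, and it is not tiny
  for the largest \<open>x\<close>. If this holds, conditionally on the graph, for all \<open>x\<close> in a geometric grid, then
  the graph has a single component of size and weight close to \<open>2 M\<close>, and all others are small.\<close>

section \<open>Outbreaks and their final sets\<close>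

text \<open>A Chernoff bound at a fixed pressure \<open>t\<close> shows that the weight of A is
  unlikely to exceed \<open>t\<close>, but it cannot exclude that the outbreak stops early: weight
  at most \<open>t\<close> only gives \<open>A \<subseteq> D\<close>, which is compatible with a
  heavy \<open>D\<close>. Excluding the gap needs control over the whole course of the outbreak,
  hence the stopped martingale. Its price is that the vertices of A drop out of the sum, so that the
  squared weights of A have to be controlled too. A colouring rate proportional to
  \<open>1 + w i\<close> gives a component a rate proportional to size plus weight, so that small
  mass means small in both respects. The largest x has to be small against the giant, hence a factor
  \<kappa>, and yet make it almost surely coloured: there the total rate of the giant is of order
  \<open>f ^ 3\<close>, against the error \<open>exp (- 2 * f)\<close>. The smallest rate colours
  the giant with a small but fixed probability. The number of rates between the two is logarithmic
  in \<open>f\<close>, so the union bound costs less than a factor \<open>exp f\<close>.\<close>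

definition outbreak :: "'a set \<Rightarrow> ('a set \<Rightarrow> 'a \<Rightarrow> bool) \<Rightarrow> 'a set \<Rightarrow> bool" where
  "outbreak V hit A \<longleftrightarrow> A \<subseteq> V \<and> (\<forall>i\<in>V - A. \<not> hit A i) \<and> (\<forall>B. B \<subset> A \<longrightarrow> (\<exists>i\<in>A - B. hit B i))"

text \<open>By monotonicity the intersection of all closed subsets of V is closed, and this least
  closed set is the final set. For uniqueness, if \<open>A1\<close> were not inside
  \<open>A2\<close>, some vertex of \<open>A1\<close> outside \<open>A2\<close> would be hit by
  \<open>A1 \<inter> A2\<close>, hence by \<open>A2\<close>, which is closed.\<close>

lemma outbreak_ex1:
  assumes mono: "\<And>A B i. A \<subseteq> B \<Longrightarrow> hit A i \<Longrightarrow> hit B i"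
  shows "\<exists>!A. outbreak V hit A"
proof -
  define cl where "cl B \<longleftrightarrow> B \<subseteq> V \<and> (\<forall>i\<in>V - B. \<not> hit B i)" for B
  define A where "A = V \<inter> \<Inter>{B. cl B}"
  have AB: "A \<subseteq> B" if "cl B" for B
    using that by (auto simp: A_def)
  have "cl A"
    unfolding cl_def
  proof (intro conjI ballI)
    show "A \<subseteq> V" by (auto simp: A_def)
    fix i assume "i \<in> V - A"
    then obtain B where B: "cl B" "i \<notin> B" "i \<in> V"
      by (auto simp: A_def)
    then show "\<not> hit A i"
      using mono[OF AB[OF B(1)], of i] by (auto simp: cl_def)
  qed
  have out: "outbreak V hit A"
    unfolding outbreak_def
  proof (intro conjI allI impI)
    show "A \<subseteq> V" "\<forall>i\<in>V - A. \<not> hit A i"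
      using \<open>cl A\<close> by (auto simp: cl_def)
    fix B assume B: "B \<subset> A"
    show "\<exists>i\<in>A - B. hit B i"
    proof (rule ccontr)
      assume "\<not> (\<exists>i\<in>A - B. hit B i)"
      then have "cl B"
        using B \<open>cl A\<close> mono[of B A] unfolding cl_def by blast
      then show False using AB[of B] B by auto
    qed
  qed
  have sub: "A1 \<subseteq> A2" if "outbreak V hit A1" "outbreak V hit A2" for A1 A2
  proof (rule ccontr)
    assume "\<not> A1 \<subseteq> A2"
    then have "A1 \<inter> A2 \<subset> A1" by auto
    moreover have "\<forall>B. B \<subset> A1 \<longrightarrow> (\<exists>i\<in>A1 - B. hit B i)"
      using that(1) by (simp add: outbreak_def)
    ultimately obtain i where i: "i \<in> A1 - A1 \<inter> A2" "hit (A1 \<inter> A2) i"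
      by blast
    then have "hit A2 i" using mono[of "A1 \<inter> A2" A2 i] by auto
    then show False using i(1) that unfolding outbreak_def by blast
  qed
  show ?thesis
    using out sub by (intro ex1I[of _ A]) (auto intro!: equalityI)
qed

text \<open>\<open>\<kappa> A\<close> is the probability that all of \<open>A\<close> gets infected inside \<open>A\<close>, and \<open>r i A\<close> the probability that
  \<open>i\<close> escapes infection by \<open>A\<close>. The equations, one for every \<open>U\<close>, determine \<open>\<kappa>\<close> recursively.\<close>

definition consistent :: "'a set \<Rightarrow> ('a \<Rightarrow> 'a set \<Rightarrow> real) \<Rightarrow> ('a set \<Rightarrow> real) \<Rightarrow> bool" where
  "consistent V r \<kappa> \<longleftrightarrow> (\<forall>U. U \<subseteq> V \<longrightarrow> (\<Sum>A\<in>Pow U. \<kappa> A * (\<Prod>i\<in>U - A. r i A)) = 1)"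

text \<open>The system is triangular: the equation for \<open>U = A\<close> contains
  \<open>\<kappa> A\<close> with coefficient 1, the product being empty, and otherwise only values
  at proper subsets of A.\<close>

lemma consistent_unique:
  assumes fin: "finite V" and c1: "consistent V r \<kappa>" and c2: "consistent V r \<kappa>'"
  shows "A \<subseteq> V \<Longrightarrow> \<kappa> A = \<kappa>' A"
proof (induction "card A" arbitrary: A rule: less_induct)
  case less
  have finA: "finite A" using fin less.prems finite_subset by blast
  have split: "(\<Sum>B\<in>Pow A. k B * (\<Prod>i\<in>A - B. r i B)) =
      k A + (\<Sum>B\<in>Pow A - {A}. k B * (\<Prod>i\<in>A - B. r i B))" for k
    using finA by (subst sum.remove[of _ A]) auto
  have "(\<Sum>B\<in>Pow A - {A}. \<kappa> B * (\<Prod>i\<in>A - B. r i B)) = (\<Sum>B\<in>Pow A - {A}. \<kappa>' B * (\<Prod>i\<in>A - B. r i B))"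
  proof (rule sum.cong)
    fix B assume "B \<in> Pow A - {A}"
    then have "B \<subset> A" by auto
    then have "\<kappa> B = \<kappa>' B"
      using less.prems by (intro less.hyps psubset_card_mono[OF finA]) auto
    then show "\<kappa> B * (\<Prod>i\<in>A - B. r i B) = \<kappa>' B * (\<Prod>i\<in>A - B. r i B)" by simp
  qed simp
  moreover have "(\<Sum>B\<in>Pow A. \<kappa> B * (\<Prod>i\<in>A - B. r i B)) = 1"
    "(\<Sum>B\<in>Pow A. \<kappa>' B * (\<Prod>i\<in>A - B. r i B)) = 1"
    using c1 c2 less.prems by (simp_all add: consistent_def)
  ultimately show ?case unfolding split by linarith
qed

lemma prod_add_Pow:
  fixes f g :: "'a \<Rightarrow> real"
  assumes "finite V"
  shows "(\<Prod>i\<in>V. f i + g i) = (\<Sum>S\<in>Pow V. (\<Prod>i\<in>S. f i) * (\<Prod>i\<in>V - S. g i))"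
  using assms
proof (induction V rule: finite_induct)
  case (insert x V)
  have inj: "inj_on (insert x) (Pow V)" using insert.hyps by (auto simp: inj_on_def)
  have disj: "Pow V \<inter> insert x ` Pow V = {}" using insert.hyps by auto
  have 1: "(\<Sum>S\<in>Pow V. prod f S * prod g (insert x V - S)) =
      g x * (\<Sum>S\<in>Pow V. prod f S * prod g (V - S))"
    unfolding sum_distrib_left
  proof (rule sum.cong)
    fix S assume S: "S \<in> Pow V"
    then have "insert x V - S = insert x (V - S)" using insert.hyps by auto
    then show "prod f S * prod g (insert x V - S) = g x * (prod f S * prod g (V - S))"
      using insert.hyps by (simp add: prod.insert_if)
  qed simp
  have 2: "(\<Sum>S\<in>Pow V. prod f (insert x S) * prod g (insert x V - insert x S)) =
      f x * (\<Sum>S\<in>Pow V. prod f S * prod g (V - S))"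
    unfolding sum_distrib_left
  proof (rule sum.cong)
    fix S assume S: "S \<in> Pow V"
    then have "insert x V - insert x S = V - S" "x \<notin> S" "finite S"
      using insert.hyps by (auto intro: finite_subset)
    then show "prod f (insert x S) * prod g (insert x V - insert x S) = f x * (prod f S * prod g (V - S))"
      by simp
  qed simp
  have "(\<Sum>S\<in>Pow (insert x V). prod f S * prod g (insert x V - S)) =
     (\<Sum>S\<in>Pow V. prod f S * prod g (insert x V - S)) +
     (\<Sum>S\<in>Pow V. prod f (insert x S) * prod g (insert x V - insert x S))"
    unfolding Pow_insert using insert.hyps
    by (subst sum.union_disjoint[OF _ _ disj]) (simp_all add: sum.reindex[OF inj])
  also have "\<dots> = (f x + g x) * (\<Sum>S\<in>Pow V. prod f S * prod g (V - S))"
    unfolding 1 2 by (simp add: algebra_simps)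
  finally show ?case using insert by simp
qed simp

text \<open>Expanding the product over subsets \<open>S\<close> of \<open>V - A\<close> and
  regrouping by \<open>U = S \<union> A\<close> produces the defining equation of every
  \<open>U\<close>, weighted with the product of \<open>b\<close> over \<open>V - U\<close>. Read
  probabilistically, the product of \<open>1 + b i / r i A\<close> over \<open>V - A\<close> has as
  expectation its starting value, the product of \<open>1 + b i\<close> over V: optional stopping
  without a filtration.\<close>

lemma consistent_identity:
  assumes fin: "finite V" and c: "consistent V r \<kappa>"
  shows "(\<Sum>A\<in>Pow V. \<kappa> A * (\<Prod>i\<in>V - A. r i A + b i)) = (\<Prod>i\<in>V. 1 + b i)"
proof -
  let ?g = "\<lambda>U A. \<kappa> A * ((\<Prod>i\<in>U - A. r i A) * (\<Prod>i\<in>V - U. b i))"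
  have "(\<Sum>A\<in>Pow V. \<kappa> A * (\<Prod>i\<in>V - A. r i A + b i)) =
      (\<Sum>A\<in>Pow V. \<Sum>S\<in>Pow (V - A). \<kappa> A * ((\<Prod>i\<in>S. r i A) * (\<Prod>i\<in>V - A - S. b i)))"
    using fin by (simp add: prod_add_Pow sum_distrib_left)
  also have "\<dots> = (\<Sum>A\<in>Pow V. \<Sum>U\<in>{U. A \<subseteq> U \<and> U \<subseteq> V}. ?g U A)"
  proof (rule sum.cong[OF refl])
    fix A assume A: "A \<in> Pow V"
    show "(\<Sum>S\<in>Pow (V - A). \<kappa> A * ((\<Prod>i\<in>S. r i A) * (\<Prod>i\<in>V - A - S. b i))) =
        (\<Sum>U\<in>{U. A \<subseteq> U \<and> U \<subseteq> V}. ?g U A)"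
    proof (rule sum.reindex_bij_witness[of _ "\<lambda>U. U - A" "\<lambda>S. S \<union> A"])
      fix S assume S: "S \<in> Pow (V - A)"
      then have "S \<union> A - A = S" "V - (S \<union> A) = V - A - S" by auto
      then show "?g (S \<union> A) A = \<kappa> A * ((\<Prod>i\<in>S. r i A) * (\<Prod>i\<in>V - A - S. b i))" by simp
    qed (use A in auto)
  qed
  also have "\<dots> = (\<Sum>A\<in>Pow V. \<Sum>U\<in>{U\<in>Pow V. A \<subseteq> U}. ?g U A)"
    by (intro sum.cong) auto
  also have "\<dots> = (\<Sum>U\<in>Pow V. \<Sum>A\<in>{A\<in>Pow V. A \<subseteq> U}. ?g U A)"
    by (rule sum.swap_restrict) (use fin in auto)
  also have "\<dots> = (\<Sum>U\<in>Pow V. (\<Prod>i\<in>U. 1) * (\<Prod>i\<in>V - U. b i))"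
  proof (rule sum.cong[OF refl])
    fix U assume U: "U \<in> Pow V"
    have "(\<Sum>A\<in>{A\<in>Pow V. A \<subseteq> U}. ?g U A) = (\<Sum>A\<in>Pow U. \<kappa> A * (\<Prod>i\<in>U - A. r i A)) * (\<Prod>i\<in>V - U. b i)"
      unfolding sum_distrib_right using U by (intro sum.cong) (auto simp: mult.assoc)
    also have "(\<Sum>A\<in>Pow U. \<kappa> A * (\<Prod>i\<in>U - A. r i A)) = 1"
      using c U by (auto simp: consistent_def)
    finally show "(\<Sum>A\<in>{A\<in>Pow V. A \<subseteq> U}. ?g U A) = (\<Prod>i\<in>U. 1) * (\<Prod>i\<in>V - U. b i)" by simp
  qed
  also have "\<dots> = (\<Prod>i\<in>V. 1 + b i)"
    by (rule prod_add_Pow[OF fin, symmetric])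
  finally show ?thesis .
qed

text \<open>A maximal inequality: the sum below is the expectation of a product martingale stopped at the
  end of the outbreak, so no control over the path of the exploration is needed.\<close>

lemma consistent_markov:
  assumes fin: "finite V" and c: "consistent V r \<kappa>"
    and \<kappa>: "\<And>A. A \<subseteq> V \<Longrightarrow> 0 \<le> \<kappa> A" and r: "\<And>i A. i \<in> V \<Longrightarrow> A \<subseteq> V \<Longrightarrow> 0 < r i A"
    and b: "\<And>i. i \<in> V \<Longrightarrow> 0 \<le> b i"
    and S: "S \<subseteq> Pow V"
    and big: "\<And>A. A \<in> S \<Longrightarrow> ln_bound \<le> (\<Sum>i\<in>V - A. ln (1 + b i / r i A)) - (\<Sum>i\<in>V. ln (1 + b i))"
  shows "(\<Sum>A\<in>S. \<kappa> A * (\<Prod>i\<in>V - A. r i A)) \<le> exp (- ln_bound)"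
proof -
  let ?P = "\<Prod>i\<in>V. 1 + b i"
  have P: "0 < ?P" using b by (intro prod_pos) (auto simp: add_pos_nonneg)
  have Pln: "exp (\<Sum>i\<in>V. ln (1 + b i)) = ?P"
    using fin b by (simp add: exp_sum add_pos_nonneg cong: prod.cong)
  have "(\<Sum>A\<in>S. \<kappa> A * (\<Prod>i\<in>V - A. r i A)) * (exp ln_bound * ?P) \<le>
      (\<Sum>A\<in>S. \<kappa> A * (\<Prod>i\<in>V - A. r i A + b i))"
    unfolding sum_distrib_right
  proof (rule sum_mono)
    fix A assume A: "A \<in> S"
    then have AV: "A \<subseteq> V" using S by auto
    have ge1: "0 < 1 + b i / r i A" if "i \<in> V" for i
      using b[OF that] r[OF that AV] by (auto intro!: add_pos_nonneg divide_nonneg_pos)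
    have "exp ln_bound * ?P = exp (ln_bound + (\<Sum>i\<in>V. ln (1 + b i)))"
      by (simp add: exp_add Pln)
    also have "\<dots> \<le> exp (\<Sum>i\<in>V - A. ln (1 + b i / r i A))"
      using big[OF A] by simp
    also have "\<dots> = (\<Prod>i\<in>V - A. 1 + b i / r i A)"
      using fin by (subst exp_sum) (auto intro!: prod.cong exp_ln ge1)
    finally have *: "exp ln_bound * ?P \<le> (\<Prod>i\<in>V - A. 1 + b i / r i A)" .
    have "\<kappa> A * (\<Prod>i\<in>V - A. r i A) * (exp ln_bound * ?P) \<le>
        \<kappa> A * (\<Prod>i\<in>V - A. r i A) * (\<Prod>i\<in>V - A. 1 + b i / r i A)"
      using \<kappa>[OF AV] r[OF _ AV] by (intro mult_left_mono * mult_nonneg_nonneg prod_nonneg) (auto simp: less_imp_le)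
    also have "\<dots> = \<kappa> A * (\<Prod>i\<in>V - A. r i A * (1 + b i / r i A))"
      by (simp add: prod.distrib mult.assoc)
    also have "(\<Prod>i\<in>V - A. r i A * (1 + b i / r i A)) = (\<Prod>i\<in>V - A. r i A + b i)"
    proof (rule prod.cong[OF refl])
      fix i assume "i \<in> V - A"
      then have "0 < r i A" using r[OF _ AV] by auto
      then show "r i A * (1 + b i / r i A) = r i A + b i" by (simp add: field_simps)
    qed
    finally show "\<kappa> A * (\<Prod>i\<in>V - A. r i A) * (exp ln_bound * ?P) \<le> \<kappa> A * (\<Prod>i\<in>V - A. r i A + b i)" .
  qed
  also have "\<dots> \<le> (\<Sum>A\<in>Pow V. \<kappa> A * (\<Prod>i\<in>V - A. r i A + b i))"
  proof (rule sum_mono2)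
    fix A assume "A \<in> Pow V - S"
    then show "0 \<le> \<kappa> A * (\<Prod>i\<in>V - A. r i A + b i)"
      using \<kappa>[of A] r[of _ A] b by (intro mult_nonneg_nonneg prod_nonneg) (auto simp: add_nonneg_nonneg less_imp_le)
  qed (use fin S in auto)
  also have "\<dots> = ?P" by (rule consistent_identity[OF fin c])
  finally have "(\<Sum>A\<in>S. \<kappa> A * (\<Prod>i\<in>V - A. r i A)) * exp ln_bound * ?P \<le> 1 * ?P" by (simp add: mult_ac)
  then have "(\<Sum>A\<in>S. \<kappa> A * (\<Prod>i\<in>V - A. r i A)) * exp ln_bound \<le> 1"
    using P by (simp only: mult_le_cancel_right_pos)
  then show ?thesis by (simp add: exp_minus field_simps)
qed

section \<open>Coloured random graphs\<close>

lemma prob_pair_pmf_Times: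
  "measure_pmf.prob (pair_pmf p q) (A \<times> B) = measure_pmf.prob p A * measure_pmf.prob q B"
proof -
  have "measure_pmf.prob (pair_pmf p q) (A \<times> B) =
      measure_pmf.prob (pair_pmf p q) ((A \<times> B) \<inter> set_pmf (pair_pmf p q))"
    by (rule measure_Int_set_pmf[symmetric])
  also have "(A \<times> B) \<inter> set_pmf (pair_pmf p q) = (A \<inter> set_pmf p) \<times> (B \<inter> set_pmf q)"
    by auto
  also have "measure_pmf.prob (pair_pmf p q) \<dots> =
      measure_pmf.prob p (A \<inter> set_pmf p) * measure_pmf.prob q (B \<inter> set_pmf q)"
    by (rule measure_pmf_prob_product) (auto intro: countable_subset[OF _ countable_set_pmf])
  finally show ?thesis by (simp add: measure_Int_set_pmf)
qed

lemma prob_Pi_pmf_indep: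
  fixes p :: "'a \<Rightarrow> 'b pmf"
  assumes fin: "finite I" and sub: "I1 \<subseteq> I" "I2 \<subseteq> I" "I1 \<inter> I2 = {}"
    and P: "\<And>f g. (\<forall>x\<in>I1. f x = g x) \<Longrightarrow> P f = P g"
    and Q: "\<And>f g. (\<forall>x\<in>I2. f x = g x) \<Longrightarrow> Q f = Q g"
  shows "measure_pmf.prob (Pi_pmf I d p) {f. P f \<and> Q f} =
    measure_pmf.prob (Pi_pmf I d p) {f. P f} * measure_pmf.prob (Pi_pmf I d p) {f. Q f}"
proof -
  let ?J = "I - I1"
  let ?h = "\<lambda>(f, g) x. if x \<in> I1 then f x else g x"
  let ?p1 = "Pi_pmf I1 d p" and ?p2 = "Pi_pmf ?J d p"
  have I: "I = I1 \<union> ?J" using sub by auto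
  have union: "Pi_pmf I d p = map_pmf ?h (pair_pmf ?p1 ?p2)"
    using fin sub by (subst I, subst Pi_pmf_union) (auto intro: finite_subset)
  have Ph: "P (?h (f, g)) = P f" for f g by (rule P) auto
  have Qh: "Q (?h (f, g)) = Q g" for f g by (rule Q) (use sub in auto)
  have rect: "measure_pmf.prob (Pi_pmf I d p) {f. P' f} = measure_pmf.prob ?p1 A * measure_pmf.prob ?p2 B"
    if "?h -` {f. P' f} = A \<times> B" for P' A B
    unfolding union measure_map_pmf that by (rule prob_pair_pmf_Times)
  have "measure_pmf.prob (Pi_pmf I d p) {f. P f \<and> Q f} =
      measure_pmf.prob ?p1 {f. P f} * measure_pmf.prob ?p2 {g. Q g}"
    by (rule rect) (use Ph Qh in auto)
  moreover have "measure_pmf.prob (Pi_pmf I d p) {f. P f} =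
      measure_pmf.prob ?p1 {f. P f} * measure_pmf.prob ?p2 UNIV"
    by (rule rect) (use Ph in auto)
  moreover have "measure_pmf.prob (Pi_pmf I d p) {f. Q f} =
      measure_pmf.prob ?p1 UNIV * measure_pmf.prob ?p2 {g. Q g}"
    by (rule rect) (use Qh in auto)
  ultimately show ?thesis by simp
qed

text \<open>Parametrised by rates instead of probabilities because rates add: the absence of a
  family of items has probability \<open>exp\<close> of minus the sum of their rates, and merging
  items gives an item whose rate is that sum.\<close>

abbreviation rate_pmf :: "'a set \<Rightarrow> ('a \<Rightarrow> real) \<Rightarrow> ('a \<Rightarrow> bool) pmf" where
  "rate_pmf I u \<equiv> Pi_pmf I False (\<lambda>e. bernoulli_pmf (1 - exp (- u e)))"

lemma rate_pmf_none:
  assumes fin: "finite I" and u: "\<And>e. e \<in> I \<Longrightarrow> 0 \<le> u e" and N: "N \<subseteq> I"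
  shows "measure_pmf.prob (rate_pmf I u) {X. \<forall>e\<in>N. \<not> X e} = exp (- (\<Sum>e\<in>N. u e))"
proof -
  have "{X. \<forall>e\<in>N. \<not> X e} = Pi I (\<lambda>e. if e \<in> N then {False} else UNIV)"
    using N by (auto simp: Pi_def split: if_splits)
  then have "measure_pmf.prob (rate_pmf I u) {X. \<forall>e\<in>N. \<not> X e} =
      (\<Prod>e\<in>I. measure_pmf.prob (bernoulli_pmf (1 - exp (- u e))) (if e \<in> N then {False} else UNIV))"
    by (simp add: measure_Pi_pmf_Pi[OF fin])
  also have "\<dots> = (\<Prod>e\<in>I. if e \<in> N then exp (- u e) else 1)"
    using u by (intro prod.cong) (auto simp: measure_pmf_single)
  also have "\<dots> = (\<Prod>e\<in>N. exp (- u e))"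
    using fin N by (subst prod.inter_filter[symmetric]) (auto intro!: prod.cong)
  finally show ?thesis
    using fin N by (simp add: exp_sum sum_negf[symmetric] finite_subset)
qed

text \<open>A coloured graph is a set of nonempty edges with at most two vertices:
  the singleton \<open>{i}\<close> is present when the vertex \<open>i\<close> is coloured.\<close>

definition coloured_edges :: "'a set \<Rightarrow> 'a set set" where
  "coloured_edges V = {e. e \<subseteq> V \<and> (card e = 1 \<or> card e = 2)}"

definition graph_hit :: "('a set \<Rightarrow> bool) \<Rightarrow> 'a set \<Rightarrow> 'a \<Rightarrow> bool" where
  "graph_hit X A i \<longleftrightarrow> X {i} \<or> (\<exists>j\<in>A. X {i, j})"

text \<open>The clause of \<open>outbreak\<close> that looks only inside A. It is separated from the
  clause on vertices outside A because in both models the two depend on disjoint families of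
  independent variables.\<close>

definition self_infecting :: "('a set \<Rightarrow> 'a \<Rightarrow> bool) \<Rightarrow> 'a set \<Rightarrow> bool" where
  "self_infecting hit A \<longleftrightarrow> (\<forall>B. B \<subset> A \<longrightarrow> (\<exists>i\<in>A - B. hit B i))"

definition hit_rate :: "('a set \<Rightarrow> real) \<Rightarrow> 'a \<Rightarrow> 'a set \<Rightarrow> real" where
  "hit_rate u i A = u {i} + (\<Sum>j\<in>A. u {i, j})"

lemma graph_hit_mono: "A \<subseteq> B \<Longrightarrow> graph_hit X A i \<Longrightarrow> graph_hit X B i"
  by (auto simp: graph_hit_def)

lemma outbreak_iff: "outbreak V hit A \<longleftrightarrow> A \<subseteq> V \<and> (\<forall>i\<in>V - A. \<not> hit A i) \<and> self_infecting hit A"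
  by (simp add: outbreak_def self_infecting_def)

lemma finite_coloured_edges: "finite V \<Longrightarrow> finite (coloured_edges V)"
  by (rule finite_subset[of _ "Pow V"]) (auto simp: coloured_edges_def)

text \<open>\<open>N\<close> consists of the singletons of \<open>U - A\<close> and the edges
  between \<open>U - A\<close> and A. It is disjoint from \<open>coloured_edges A\<close>, which
  decides whether A infects itself, and edges within \<open>U - A\<close> do not enter at all. Hence
  the first factor is independent of U.\<close>

lemma prob_outbreak_graph:
  assumes fin: "finite V" and u: "\<And>e. e \<in> coloured_edges V \<Longrightarrow> 0 \<le> u e" and U: "U \<subseteq> V" and A: "A \<subseteq> U"
  shows "measure_pmf.prob (rate_pmf (coloured_edges V) u) {X. outbreak U (graph_hit X) A} =
    measure_pmf.prob (rate_pmf (coloured_edges V) u) {X. self_infecting (graph_hit X) A} *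
    (\<Prod>i\<in>U - A. exp (- hit_rate u i A))"
proof -
  let ?I = "coloured_edges V" and ?p = "rate_pmf (coloured_edges V) u"
  define N where "N = (\<Union>i\<in>U - A. insert {i} ((\<lambda>j. {i, j}) ` A))"
  have N: "N \<subseteq> ?I"
  proof
    fix e assume "e \<in> N"
    then obtain i where i: "i \<in> U - A" "e = {i} \<or> (\<exists>j\<in>A. e = {i, j})"
      by (auto simp: N_def)
    then show "e \<in> ?I"
      using U A by (auto simp: coloured_edges_def card_insert_if split: if_splits)
  qed
  have outN: "(\<forall>i\<in>U - A. \<not> graph_hit X A i) \<longleftrightarrow> (\<forall>e\<in>N. \<not> X e)" for X
    by (auto simp: N_def graph_hit_def)
  have "measure_pmf.prob ?p {X. self_infecting (graph_hit X) A \<and> (\<forall>e\<in>N. \<not> X e)} =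
      measure_pmf.prob ?p {X. self_infecting (graph_hit X) A} * measure_pmf.prob ?p {X. \<forall>e\<in>N. \<not> X e}"
  proof (rule prob_Pi_pmf_indep[of _ "coloured_edges A" N])
    show "coloured_edges A \<inter> N = {}"
      by (auto simp: N_def coloured_edges_def)
    show "coloured_edges A \<subseteq> ?I" using U A by (auto simp: coloured_edges_def)
    fix f g :: "'a set \<Rightarrow> bool" assume fg: "\<forall>x\<in>coloured_edges A. f x = g x"
    have "graph_hit f B i = graph_hit g B i" if "B \<subset> A" "i \<in> A - B" for B i
    proof -
      have "f {i} = g {i}"
        using that by (intro fg[rule_format]) (auto simp: coloured_edges_def)
      moreover have "f {i, j} = g {i, j}" if "j \<in> B" for j
        using that \<open>B \<subset> A\<close> \<open>i \<in> A - B\<close>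
        by (intro fg[rule_format]) (auto simp: coloured_edges_def card_insert_if)
      ultimately show ?thesis by (auto simp: graph_hit_def)
    qed
    then show "self_infecting (graph_hit f) A = self_infecting (graph_hit g) A"
      unfolding self_infecting_def by meson
  qed (use fin N in \<open>auto simp: finite_coloured_edges\<close>)
  also have "measure_pmf.prob ?p {X. \<forall>e\<in>N. \<not> X e} = exp (- (\<Sum>e\<in>N. u e))"
    by (rule rate_pmf_none) (use fin N u finite_coloured_edges in auto)
  also have "(\<Sum>e\<in>N. u e) = (\<Sum>i\<in>U - A. \<Sum>e\<in>insert {i} ((\<lambda>j. {i, j}) ` A). u e)"
    unfolding N_def
  proof (rule sum.UNION_disjoint)
    show "finite (U - A)" using fin U finite_subset by blast
    show "\<forall>i\<in>U - A. finite (insert {i} ((\<lambda>j. {i, j}) ` A))"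
      using fin U A by (auto intro: finite_subset)
    show "\<forall>i\<in>U - A. \<forall>j\<in>U - A. i \<noteq> j \<longrightarrow>
        insert {i} ((\<lambda>j. {i, j}) ` A) \<inter> insert {j} ((\<lambda>k. {j, k}) ` A) = {}"
      by (auto simp: doubleton_eq_iff)
  qed
  also have "\<dots> = (\<Sum>i\<in>U - A. hit_rate u i A)"
  proof (rule sum.cong[OF refl])
    fix i assume i: "i \<in> U - A"
    have "inj_on (\<lambda>j. {i, j}) A" using i by (auto simp: inj_on_def doubleton_eq_iff)
    moreover have "{i} \<notin> (\<lambda>j. {i, j}) ` A" using i by auto
    moreover have "finite A" using fin U A by (auto intro: finite_subset)
    ultimately show "(\<Sum>e\<in>insert {i} ((\<lambda>j. {i, j}) ` A). u e) = hit_rate u i A"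
      by (simp add: hit_rate_def sum.reindex)
  qed
  also have "exp (- (\<Sum>i\<in>U - A. hit_rate u i A)) = (\<Prod>i\<in>U - A. exp (- hit_rate u i A))"
    using fin U by (simp add: exp_sum sum_negf[symmetric] finite_subset)
  finally show ?thesis
    using A by (simp add: outbreak_iff outN conj_commute)
qed

text \<open>For every U exactly one set is the final set, so the factorised probabilities add up to
  1; since the first factor is the same for all U, these equations all concern one function of
  A.\<close>

lemma consistent_graph:
  assumes fin: "finite V" and u: "\<And>e. e \<in> coloured_edges V \<Longrightarrow> 0 \<le> u e"
  shows "consistent V (\<lambda>i A. exp (- hit_rate u i A))
    (\<lambda>A. measure_pmf.prob (rate_pmf (coloured_edges V) u) {X. self_infecting (graph_hit X) A})"
  unfolding consistent_def
proof (intro allI impI)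
  fix U assume U: "U \<subseteq> V"
  let ?p = "rate_pmf (coloured_edges V) u"
  have finU: "finite U" using fin U finite_subset by blast
  have ex1: "\<exists>!A. outbreak U (graph_hit X) A" for X :: "'a set \<Rightarrow> bool"
    by (rule outbreak_ex1) (rule graph_hit_mono)
  have sub: "outbreak U (graph_hit X) A \<Longrightarrow> A \<subseteq> U" for X A by (simp add: outbreak_def)
  have "(\<Sum>A\<in>Pow U. measure_pmf.prob ?p {X. outbreak U (graph_hit X) A}) =
      measure_pmf.prob ?p (\<Union>A\<in>Pow U. {X. outbreak U (graph_hit X) A})"
    using finU by (intro measure_pmf.finite_measure_finite_Union[symmetric])
      (use ex1 in \<open>auto simp: disjoint_family_on_def\<close>)
  also have "(\<Union>A\<in>Pow U. {X. outbreak U (graph_hit X) A}) = UNIV"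
  proof -
    have "\<exists>A\<in>Pow U. outbreak U (graph_hit X) A" for X
      using ex1[of X] sub[of X] by auto
    then show ?thesis by auto
  qed
  finally show "(\<Sum>A\<in>Pow U. measure_pmf.prob ?p {X. self_infecting (graph_hit X) A} *
      (\<Prod>i\<in>U - A. exp (- hit_rate u i A))) = 1"
    using prob_outbreak_graph[where u = u, OF fin u U] by (metis (no_types, lifting) PowD measure_pmf.prob_space sum.cong space_measure_pmf)
qed

section \<open>The threshold construction\<close>

lemma prob_PiM_indep:
  assumes fin: "finite V" and A: "A \<subseteq> V"
    and M: "\<And>i. prob_space (M i)"
    and P: "\<And>f g. (\<forall>x\<in>A. f x = g x) \<Longrightarrow> P f = P g"
    and Q: "\<And>f g. (\<forall>x\<in>V - A. f x = g x) \<Longrightarrow> Q f = Q g"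
    and meas: "Measurable.pred (PiM A M) P" "Measurable.pred (PiM (V - A) M) Q"
  shows "measure (PiM V M) {x\<in>space (PiM V M). P x \<and> Q x} =
    measure (PiM V M) {x\<in>space (PiM V M). P x} * measure (PiM V M) {x\<in>space (PiM V M). Q x}"
    (is "measure ?V _ = _")
proof -
  interpret pp: product_prob_space M by (intro product_prob_spaceI M)
  let ?J = "V - A"
  let ?A = "PiM A M" and ?B = "PiM ?J M"
  interpret A: prob_space ?A by (rule prob_space_PiM) (rule M)
  interpret J: prob_space ?B by (rule prob_space_PiM) (rule M)
  have V: "V = A \<union> ?J" using A by auto
  have fin': "finite A" "finite ?J" using fin A finite_subset by auto
  have mg: "merge A ?J \<in> ?A \<Otimes>\<^sub>M ?B \<rightarrow>\<^sub>M ?V"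
    using measurable_merge[of A ?J M] V by simp
  have D: "?V = distr (?A \<Otimes>\<^sub>M ?B) ?V (merge A ?J)"
    using pp.distr_merge[of A ?J] fin' V by (metis Diff_disjoint)
  have rect: "measure ?V {x\<in>space ?V. R x} = measure ?A {x\<in>space ?A. P' x} * measure ?B {x\<in>space ?B. Q' x}"
    if R: "Measurable.pred ?V R" and eq: "\<And>f g. R (merge A ?J (f, g)) = (P' f \<and> Q' g)"
      and m: "Measurable.pred ?A P'" "Measurable.pred ?B Q'" for R P' Q'
  proof -
    have "measure ?V {x\<in>space ?V. R x} = measure (distr (?A \<Otimes>\<^sub>M ?B) ?V (merge A ?J)) {x\<in>space ?V. R x}"
      by (subst D) simp
    also have "\<dots> = measure (?A \<Otimes>\<^sub>M ?B) (merge A ?J -` {x\<in>space ?V. R x} \<inter> space (?A \<Otimes>\<^sub>M ?B))"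
      using R by (intro measure_distr mg) simp
    also have "merge A ?J -` {x\<in>space ?V. R x} \<inter> space (?A \<Otimes>\<^sub>M ?B) =
        {x\<in>space ?A. P' x} \<times> {x\<in>space ?B. Q' x}"
      using measurable_space[OF mg] by (auto simp: space_pair_measure eq)
    also have "measure (?A \<Otimes>\<^sub>M ?B) \<dots> = measure ?A {x\<in>space ?A. P' x} * measure ?B {x\<in>space ?B. Q' x}"
    proof -
      have "emeasure (?A \<Otimes>\<^sub>M ?B) ({x\<in>space ?A. P' x} \<times> {x\<in>space ?B. Q' x}) =
          emeasure ?A {x\<in>space ?A. P' x} * emeasure ?B {x\<in>space ?B. Q' x}"
        using m by (intro J.emeasure_pair_measure_Times) simp_all
      then show ?thesis by (simp add: measure_def enn2real_mult)
    qed
    finally show ?thesis .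
  qed
  have rV: "(\<lambda>x. restrict x A) \<in> ?V \<rightarrow>\<^sub>M ?A" "(\<lambda>x. restrict x ?J) \<in> ?V \<rightarrow>\<^sub>M ?B"
    using A by (auto intro!: measurable_restrict_subset)
  have PV: "Measurable.pred ?V P"
  proof -
    have "Measurable.pred ?V (\<lambda>x. P (restrict x A))"
      using measurable_compose[OF rV(1) meas(1)] by simp
    moreover have "P (restrict x A) = P x" for x using P[of "restrict x A" x] by auto
    ultimately show ?thesis by simp
  qed
  have QV: "Measurable.pred ?V Q"
  proof -
    have "Measurable.pred ?V (\<lambda>x. Q (restrict x ?J))"
      using measurable_compose[OF rV(2) meas(2)] by simp
    moreover have "Q (restrict x ?J) = Q x" for x using Q[of "restrict x ?J" x] by auto
    ultimately show ?thesis by simp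
  qed
  have Ph: "P (merge A ?J (f, g)) = P f" for f g using P[of "merge A ?J (f, g)" f] by (auto simp: merge_def)
  have Qh: "Q (merge A ?J (f, g)) = Q g" for f g using Q[of "merge A ?J (f, g)" g] by (auto simp: merge_def)
  have "measure ?V {x\<in>space ?V. P x \<and> Q x} = measure ?A {x\<in>space ?A. P x} * measure ?B {x\<in>space ?B. Q x}"
    by (rule rect) (use PV QV Ph Qh meas in auto)
  moreover have "measure ?V {x\<in>space ?V. P x} = measure ?A {x\<in>space ?A. P x} * measure ?B {x\<in>space ?B. True}"
    by (rule rect) (use PV Ph meas in auto)
  moreover have "measure ?V {x\<in>space ?V. Q x} = measure ?A {x\<in>space ?A. True} * measure ?B {x\<in>space ?B. Q x}"
    by (rule rect) (use QV Qh meas in auto)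
  ultimately show ?thesis by (simp add: A.prob_space J.prob_space)
qed

section \<open>Independent exponential thresholds\<close>

abbreviation exp1 :: "real measure" where
  "exp1 \<equiv> density lborel (exponential_density 1)"

lemma prob_space_exp1: "prob_space exp1"
  by (rule prob_space_exponential_density) simp

lemma exp1_gt:
  assumes "0 \<le> a"
  shows "measure exp1 {x. a < x} = exp (- a)"
proof -
  interpret prob_space exp1 by (rule prob_space_exp1)
  have "distributed exp1 lborel (\<lambda>x. x) (exponential_density 1)"
    unfolding distributed_def
    by (auto simp: distr_id2 intro!: distr_cong)
  from exponential_distributedD_gt[OF this assms] show ?thesis by (simp add: space_density)
qed

abbreviation sellke :: "'a set \<Rightarrow> ('a \<Rightarrow> real) measure" where
  "sellke V \<equiv> PiM V (\<lambda>_. exp1)"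

lemma prob_space_sellke: "prob_space (sellke V)"
  by (rule prob_space_PiM) (rule prob_space_exp1)

lemma measurable_sellke_component:
  assumes "i \<in> V"
  shows "(\<lambda>\<xi>. \<xi> i) \<in> borel_measurable (sellke V)"
proof -
  have "(\<lambda>\<xi>. \<xi> i) \<in> sellke V \<rightarrow>\<^sub>M exp1"
    by (rule measurable_component_singleton[OF assms])
  also have "(sellke V \<rightarrow>\<^sub>M exp1) = borel_measurable (sellke V)"
    by (rule measurable_cong_sets) simp_all
  finally show ?thesis .
qed

text \<open>One exponential variable per vertex replaces all the edge variables at that vertex. The
  probability \<open>exp (- c i A)\<close> of escaping A is the same as in the graph, but now the
  vertices that succumb to a fixed pressure are chosen independently, which edges do not
  provide.\<close>

definition threshold_hit :: "('a \<Rightarrow> 'a set \<Rightarrow> real) \<Rightarrow> ('a \<Rightarrow> real) \<Rightarrow> 'a set \<Rightarrow> 'a \<Rightarrow> bool" where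
  "threshold_hit c \<xi> A i \<longleftrightarrow> \<xi> i \<le> c i A"

lemma measurable_self_infecting:
  assumes "finite A" "A \<subseteq> V"
  shows "Measurable.pred (sellke V) (\<lambda>\<xi>. self_infecting (threshold_hit c \<xi>) A)"
proof -
  have "Measurable.pred (sellke V) (\<lambda>\<xi>. \<forall>B\<in>{B. B \<subset> A}. \<exists>i\<in>A - B. \<xi> i \<le> c i B)"
  proof (rule pred_intros_finite(3), goal_cases)
    case 1
    show "finite {B. B \<subset> A}" using assms by (auto intro: finite_subset[of _ "Pow A"])
  next
    case (2 B)
    show ?case
    proof (rule pred_intros_finite(4), goal_cases)
    case (2 i)
    then have [measurable]: "(\<lambda>\<xi>. \<xi> i) \<in> borel_measurable (sellke V)"
      using assms by (intro measurable_sellke_component) auto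
    show "Measurable.pred (sellke V) (\<lambda>\<xi>. \<xi> i \<le> c i B)" by measurable
    qed (use assms in auto)
  qed
  then show ?thesis by (simp add: self_infecting_def threshold_hit_def)
qed

lemma measurable_no_hit:
  assumes "finite N" "N \<subseteq> V"
  shows "Measurable.pred (sellke V) (\<lambda>\<xi>. \<forall>i\<in>N. \<not> threshold_hit c \<xi> A i)"
  unfolding threshold_hit_def
proof (rule pred_intros_finite(3), goal_cases)
  case (2 i)
  then have [measurable]: "(\<lambda>\<xi>. \<xi> i) \<in> borel_measurable (sellke V)"
    using assms by (intro measurable_sellke_component) auto
  show "Measurable.pred (sellke V) (\<lambda>\<xi>. \<not> \<xi> i \<le> c i A)" by measurable
qed (use assms in auto)

lemma prob_sellke_no_hit:
  assumes "finite V" "N \<subseteq> V" "\<And>i. i \<in> N \<Longrightarrow> 0 \<le> d i"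
  shows "measure (sellke V) {\<xi>\<in>space (sellke V). \<forall>i\<in>N. d i < \<xi> i} = (\<Prod>i\<in>N. exp (- d i))"
proof -
  interpret exp1: prob_space exp1 by (rule prob_space_exp1)
  interpret finite_product_prob_space "\<lambda>_. exp1" V
    by standard (rule assms(1))
  have "{\<xi>\<in>space (sellke V). \<forall>i\<in>N. d i < \<xi> i} = PiE V (\<lambda>i. if i \<in> N then {x. d i < x} else UNIV)"
    using assms(2) by (auto simp: space_PiM PiE_def Pi_def space_density split: if_splits)
  then have "measure (sellke V) {\<xi>\<in>space (sellke V). \<forall>i\<in>N. d i < \<xi> i} =
      (\<Prod>i\<in>V. measure exp1 (if i \<in> N then {x. d i < x} else UNIV))"
    by (simp, subst finite_measure_PiM_emb) auto
  also have "\<dots> = (\<Prod>i\<in>V. if i \<in> N then exp (- d i) else 1)"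
    using assms exp1.prob_space by (intro prod.cong) (auto simp: exp1_gt space_density)
  also have "\<dots> = (\<Prod>i\<in>N. exp (- d i))"
    using assms by (subst prod.inter_filter[symmetric]) (auto intro!: prod.cong)
  finally show ?thesis .
qed

lemma prob_outbreak_sellke:
  assumes fin: "finite V" and c: "\<And>i A. i \<in> V \<Longrightarrow> A \<subseteq> V \<Longrightarrow> 0 \<le> c i A" and U: "U \<subseteq> V" and A: "A \<subseteq> U"
  shows "measure (sellke V) {\<xi>\<in>space (sellke V). outbreak U (threshold_hit c \<xi>) A} =
    measure (sellke V) {\<xi>\<in>space (sellke V). self_infecting (threshold_hit c \<xi>) A} *
    (\<Prod>i\<in>U - A. exp (- c i A))"
proof -
  have "measure (sellke V) {\<xi>\<in>space (sellke V). self_infecting (threshold_hit c \<xi>) A \<and>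
        (\<forall>i\<in>U - A. \<not> threshold_hit c \<xi> A i)} =
      measure (sellke V) {\<xi>\<in>space (sellke V). self_infecting (threshold_hit c \<xi>) A} *
      measure (sellke V) {\<xi>\<in>space (sellke V). \<forall>i\<in>U - A. \<not> threshold_hit c \<xi> A i}"
  proof (rule prob_PiM_indep[OF fin _ prob_space_exp1])
    show "A \<subseteq> V" using A U by auto
    show "Measurable.pred (sellke A) (\<lambda>\<xi>. self_infecting (threshold_hit c \<xi>) A)"
      using fin A U by (intro measurable_self_infecting) (auto intro: finite_subset)
    show "Measurable.pred (sellke (V - A)) (\<lambda>\<xi>. \<forall>i\<in>U - A. \<not> threshold_hit c \<xi> A i)"
      using fin U by (intro measurable_no_hit) (auto intro: finite_subset)
    show "self_infecting (threshold_hit c f) A = self_infecting (threshold_hit c g) A"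
      if fg: "\<forall>x\<in>A. f x = g x" for f g :: "'a \<Rightarrow> real"
    proof -
      have "(\<exists>i\<in>A - B. threshold_hit c f B i) = (\<exists>i\<in>A - B. threshold_hit c g B i)" for B
        using fg by (intro bex_cong refl) (auto simp: threshold_hit_def)
      then show ?thesis by (simp add: self_infecting_def)
    qed
    show "(\<forall>i\<in>U - A. \<not> threshold_hit c f A i) = (\<forall>i\<in>U - A. \<not> threshold_hit c g A i)"
      if fg: "\<forall>x\<in>V - A. f x = g x" for f g :: "'a \<Rightarrow> real"
      using fg U by (intro ball_cong refl) (auto simp: threshold_hit_def)
  qed
  also have "measure (sellke V) {\<xi>\<in>space (sellke V). \<forall>i\<in>U - A. \<not> threshold_hit c \<xi> A i} =
      (\<Prod>i\<in>U - A. exp (- c i A))"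
    unfolding threshold_hit_def not_le
    by (rule prob_sellke_no_hit) (use fin U A in \<open>auto intro!: c\<close>)
  finally show ?thesis
    using A by (simp add: outbreak_iff conj_commute)
qed

lemma measurable_outbreak:
  assumes "finite V" "U \<subseteq> V"
  shows "Measurable.pred (sellke V) (\<lambda>\<xi>. outbreak U (threshold_hit c \<xi>) A)"
proof (cases "A \<subseteq> U")
  case True
  have "Measurable.pred (sellke V) (\<lambda>\<xi>. (\<forall>i\<in>U - A. \<not> threshold_hit c \<xi> A i) \<and> self_infecting (threshold_hit c \<xi>) A)"
    using assms True
    by (intro pred_intros_logic measurable_no_hit measurable_self_infecting) (auto intro: finite_subset)
  then show ?thesis using True by (simp add: outbreak_iff)
qed (simp add: outbreak_iff)

lemma threshold_outbreak_ex1: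
  assumes "\<And>i A B. A \<subseteq> B \<Longrightarrow> c i A \<le> c i B"
  shows "\<exists>!A. outbreak U (threshold_hit c \<xi>) A"
  by (rule outbreak_ex1) (use assms in \<open>auto simp: threshold_hit_def intro: order_trans\<close>)

lemma consistent_sellke:
  assumes fin: "finite V" and c: "\<And>i A. i \<in> V \<Longrightarrow> A \<subseteq> V \<Longrightarrow> 0 \<le> c i A"
    and mono: "\<And>i A B. A \<subseteq> B \<Longrightarrow> c i A \<le> c i B"
  shows "consistent V (\<lambda>i A. exp (- c i A))
    (\<lambda>A. measure (sellke V) {\<xi>\<in>space (sellke V). self_infecting (threshold_hit c \<xi>) A})"
  unfolding consistent_def
proof (intro allI impI)
  interpret prob_space "sellke V" by (rule prob_space_sellke)
  fix U assume U: "U \<subseteq> V"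
  have finU: "finite U" using fin U finite_subset by blast
  have ex1: "\<exists>!A. outbreak U (threshold_hit c \<xi>) A" for \<xi>
    by (rule threshold_outbreak_ex1[OF mono])
  have sub: "outbreak U (threshold_hit c \<xi>) A \<Longrightarrow> A \<subseteq> U" for \<xi> A by (simp add: outbreak_def)
  let ?S = "\<lambda>A. {\<xi>\<in>space (sellke V). outbreak U (threshold_hit c \<xi>) A}"
  have meas: "?S A \<in> sets (sellke V)" for A
    using measurable_outbreak[OF fin U] by simp
  have "(\<Sum>A\<in>Pow U. prob (?S A)) = prob (\<Union>A\<in>Pow U. ?S A)"
    using finU meas by (intro finite_measure_finite_Union[symmetric])
      (use ex1 in \<open>auto simp: disjoint_family_on_def\<close>)
  also have "(\<Union>A\<in>Pow U. ?S A) = space (sellke V)"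
  proof -
    have "\<exists>A\<in>Pow U. outbreak U (threshold_hit c \<xi>) A" for \<xi>
      using ex1[of \<xi>] sub[of \<xi>] by auto
    then show ?thesis by auto
  qed
  finally show "(\<Sum>A\<in>Pow U. prob {\<xi>\<in>space (sellke V). self_infecting (threshold_hit c \<xi>) A} *
      (\<Prod>i\<in>U - A. exp (- c i A))) = 1"
    using prob_outbreak_sellke[where c = c, OF fin c U]
    by (metis (no_types, lifting) PowD prob_space sum.cong)
qed

definition outbreak_prob :: "'a set \<Rightarrow> ('a set \<Rightarrow> real) \<Rightarrow> 'a set set \<Rightarrow> real" where
  "outbreak_prob V u S = measure_pmf.prob (rate_pmf (coloured_edges V) u)
     {X. \<exists>A\<in>S. outbreak V (graph_hit X) A}"

lemma outbreak_prob_sum: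
  assumes fin: "finite V" and u: "\<And>e. e \<in> coloured_edges V \<Longrightarrow> 0 \<le> u e" and S: "S \<subseteq> Pow V"
  shows "outbreak_prob V u S = (\<Sum>A\<in>S. measure_pmf.prob (rate_pmf (coloured_edges V) u)
      {X. self_infecting (graph_hit X) A} * (\<Prod>i\<in>V - A. exp (- hit_rate u i A)))"
proof -
  let ?p = "rate_pmf (coloured_edges V) u"
  have finS: "finite S" using S fin finite_subset by blast
  have ex1: "\<exists>!A. outbreak V (graph_hit X) A" for X :: "'a set \<Rightarrow> bool"
    by (rule outbreak_ex1) (rule graph_hit_mono)
  have "outbreak_prob V u S = measure_pmf.prob ?p (\<Union>A\<in>S. {X. outbreak V (graph_hit X) A})"
    unfolding outbreak_prob_def by (rule arg_cong2[where f = measure]) auto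
  also have "\<dots> = (\<Sum>A\<in>S. measure_pmf.prob ?p {X. outbreak V (graph_hit X) A})"
    using finS by (intro measure_pmf.finite_measure_finite_Union)
      (use ex1 in \<open>auto simp: disjoint_family_on_def\<close>)
  also have "\<dots> = (\<Sum>A\<in>S. measure_pmf.prob ?p {X. self_infecting (graph_hit X) A} *
      (\<Prod>i\<in>V - A. exp (- hit_rate u i A)))"
    using S by (intro sum.cong refl prob_outbreak_graph[OF fin u]) auto
  finally show ?thesis .
qed

text \<open>Both models satisfy the \<open>consistent\<close> equations with the same escape
  probabilities, so \<open>consistent_unique\<close> identifies their kernels, and with them the
  laws of the final sets. Agreement of \<open>c\<close> with \<open>hit_rate\<close> is demanded
  only for \<open>i \<notin> A\<close>: for \<open>i \<in> A\<close> the sum in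
  \<open>hit_rate\<close> would count the singleton \<open>{i, i} = {i}\<close>, that is the colour,
  a second time.\<close>

lemma outbreak_prob_sellke:
  assumes fin: "finite V" and u: "\<And>e. e \<in> coloured_edges V \<Longrightarrow> 0 \<le> u e" and S: "S \<subseteq> Pow V"
    and c: "\<And>i A. i \<in> V \<Longrightarrow> A \<subseteq> V \<Longrightarrow> i \<notin> A \<Longrightarrow> c i A = hit_rate u i A"
    and c0: "\<And>i A. i \<in> V \<Longrightarrow> A \<subseteq> V \<Longrightarrow> 0 \<le> c i A"
    and mono: "\<And>i A B. A \<subseteq> B \<Longrightarrow> c i A \<le> c i B"
  shows "outbreak_prob V u S =
    measure (sellke V) {\<xi>\<in>space (sellke V). \<exists>A\<in>S. outbreak V (threshold_hit c \<xi>) A}"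
proof -
  interpret prob_space "sellke V" by (rule prob_space_sellke)
  let ?\<kappa> = "\<lambda>A. prob {\<xi>\<in>space (sellke V). self_infecting (threshold_hit c \<xi>) A}"
  have finS: "finite S" using S fin finite_subset by blast
  have "consistent V (\<lambda>i A. exp (- c i A)) ?\<kappa>"
    by (rule consistent_sellke) (use fin c0 mono in auto)
  moreover have "(\<Sum>A\<in>Pow U. ?\<kappa> A * (\<Prod>i\<in>U - A. exp (- hit_rate u i A))) =
      (\<Sum>A\<in>Pow U. ?\<kappa> A * (\<Prod>i\<in>U - A. exp (- c i A)))" if "U \<subseteq> V" for U
    by (intro sum.cong refl arg_cong2[where f = "(*)"] prod.cong) (use that in \<open>auto intro!: c[symmetric]\<close>)
  ultimately have "consistent V (\<lambda>i A. exp (- hit_rate u i A)) ?\<kappa>"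
    unfolding consistent_def by simp
  from consistent_unique[OF fin consistent_graph[where u = u, OF fin u] this]
  have \<kappa>: "measure_pmf.prob (rate_pmf (coloured_edges V) u) {X. self_infecting (graph_hit X) A} = ?\<kappa> A"
    if "A \<subseteq> V" for A using that by simp
  have "outbreak_prob V u S = (\<Sum>A\<in>S. ?\<kappa> A * (\<Prod>i\<in>V - A. exp (- c i A)))"
    by (subst outbreak_prob_sum[OF fin _ S])
      (use S c \<kappa> u in \<open>auto intro!: sum.cong prod.cong arg_cong2[where f = "(*)"]\<close>)
  also have "\<dots> = (\<Sum>A\<in>S. prob {\<xi>\<in>space (sellke V). outbreak V (threshold_hit c \<xi>) A})"
    using S by (intro sum.cong refl prob_outbreak_sellke[symmetric, OF fin c0]) auto
  also have "\<dots> = prob (\<Union>A\<in>S. {\<xi>\<in>space (sellke V). outbreak V (threshold_hit c \<xi>) A})"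
  proof (rule finite_measure_finite_Union[symmetric])
    show "(\<lambda>A. {\<xi>\<in>space (sellke V). outbreak V (threshold_hit c \<xi>) A}) ` S \<subseteq> events"
      using measurable_outbreak[OF fin, of V] by auto
    show "disjoint_family_on (\<lambda>A. {\<xi>\<in>space (sellke V). outbreak V (threshold_hit c \<xi>) A}) S"
      using threshold_outbreak_ex1[of c V, OF mono] unfolding disjoint_family_on_def by blast
  qed fact
  also have "(\<Union>A\<in>S. {\<xi>\<in>space (sellke V). outbreak V (threshold_hit c \<xi>) A}) =
      {\<xi>\<in>space (sellke V). \<exists>A\<in>S. outbreak V (threshold_hit c \<xi>) A}" by auto
  finally show ?thesis .
qed

lemma outbreak_prob_markov:
  assumes fin: "finite V" and u: "\<And>e. e \<in> coloured_edges V \<Longrightarrow> 0 \<le> u e" and S: "S \<subseteq> Pow V"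
    and b: "\<And>i. i \<in> V \<Longrightarrow> 0 \<le> b i"
    and big: "\<And>A. A \<in> S \<Longrightarrow>
      K \<le> (\<Sum>i\<in>V - A. ln (1 + b i * exp (hit_rate u i A))) - (\<Sum>i\<in>V. ln (1 + b i))"
  shows "outbreak_prob V u S \<le> exp (- K)"
proof -
  have "consistent V (\<lambda>i A. exp (- hit_rate u i A))
      (\<lambda>A. measure_pmf.prob (rate_pmf (coloured_edges V) u) {X. self_infecting (graph_hit X) A})"
    by (rule consistent_graph) (use fin u in auto)
  then have "(\<Sum>A\<in>S. measure_pmf.prob (rate_pmf (coloured_edges V) u)
      {X. self_infecting (graph_hit X) A} * (\<Prod>i\<in>V - A. exp (- hit_rate u i A))) \<le> exp (- K)"
    by (rule consistent_markov[where b = b, OF fin])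
      (use b big S in \<open>auto simp: exp_minus divide_inverse\<close>)
  moreover have "outbreak_prob V u S = (\<Sum>A\<in>S. measure_pmf.prob (rate_pmf (coloured_edges V) u)
      {X. self_infecting (graph_hit X) A} * (\<Prod>i\<in>V - A. exp (- hit_rate u i A)))"
    by (rule outbreak_prob_sum) (use fin u S in auto)
  ultimately show ?thesis by simp
qed

lemma sellke_chernoff:
  assumes fin: "finite V" and d: "\<And>i. i \<in> V \<Longrightarrow> 0 \<le> d i"
  shows "measure (sellke V) {\<xi>\<in>space (sellke V). T \<le> (\<Sum>i\<in>{i\<in>V. \<xi> i \<le> d i}. z i)}
    \<le> exp (- T + (\<Sum>i\<in>V. (1 - exp (- d i)) * (exp (z i) - 1)))"
proof -
  interpret P: prob_space "sellke V" by (rule prob_space_sellke)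
  interpret E: prob_space exp1 by (rule prob_space_exp1)
  interpret pp: product_prob_space "\<lambda>_::'a. exp1" by (intro product_prob_spaceI prob_space_exp1)
  let ?h = "\<lambda>i x. if x \<le> d i then exp (z i) else (1::real)"
  have hB: "?h i \<in> borel_measurable exp1" for i by measurable
  have int: "integrable exp1 (?h i)" for i
    by (rule E.integrable_const_bound[where B = "max (exp (z i)) 1"]) (use hB in auto)
  have Eh: "(\<integral>x. ?h i x \<partial>exp1) = 1 + (1 - exp (- d i)) * (exp (z i) - 1)" if "i \<in> V" for i
  proof -
    have "(\<integral>x. ?h i x \<partial>exp1) = (\<integral>x. exp (z i) + (1 - exp (z i)) * indicator {x. d i < x} x \<partial>exp1)"
      by (intro Bochner_Integration.integral_cong) (auto simp: indicator_def)
    also have "\<dots> = exp (z i) + (1 - exp (z i)) * measure exp1 {x. d i < x}"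
      by (subst Bochner_Integration.integral_add)
        (use E.prob_space in \<open>auto simp: space_density E.emeasure_eq_measure\<close>)
    finally show ?thesis using exp1_gt[OF d[OF that]] by (simp add: algebra_simps)
  qed
  have prodI: "exp (\<Sum>i\<in>{i\<in>V. \<xi> i \<le> d i}. z i) = (\<Prod>i\<in>V. ?h i (\<xi> i))" for \<xi>
  proof -
    have "(\<Sum>i\<in>{i\<in>V. \<xi> i \<le> d i}. z i) = (\<Sum>i\<in>V. if \<xi> i \<le> d i then z i else 0)"
      using fin by (simp add: sum.inter_filter)
    then show ?thesis using fin by (auto simp: exp_sum intro!: prod.cong)
  qed
  have intP: "integrable (sellke V) (\<lambda>\<xi>. \<Prod>i\<in>V. ?h i (\<xi> i))"
    by (rule pp.product_integrable_prod[OF fin]) (rule int)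
  have "measure (sellke V) {\<xi>\<in>space (sellke V). T \<le> (\<Sum>i\<in>{i\<in>V. \<xi> i \<le> d i}. z i)} =
      measure (sellke V) {\<xi>\<in>space (sellke V). exp T \<le> (\<Prod>i\<in>V. ?h i (\<xi> i))}"
    by (simp flip: prodI)
  also have "\<dots> \<le> (\<integral>\<xi>. (\<Prod>i\<in>V. ?h i (\<xi> i)) \<partial>sellke V) / exp T"
    by (rule integral_Markov_inequality_measure[where A = "{}"])
      (use intP in \<open>auto intro!: prod_nonneg\<close>)
  also have "(\<integral>\<xi>. (\<Prod>i\<in>V. ?h i (\<xi> i)) \<partial>sellke V) = (\<Prod>i\<in>V. 1 + (1 - exp (- d i)) * (exp (z i) - 1))"
    by (subst pp.product_integral_prod[OF fin int]) (simp add: Eh cong: prod.cong)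
  also have "\<dots> \<le> (\<Prod>i\<in>V. exp ((1 - exp (- d i)) * (exp (z i) - 1)))"
  proof (rule prod_mono)
    fix i assume i: "i \<in> V"
    have "0 \<le> exp (- d i) + (1 - exp (- d i)) * exp (z i)"
      using d[OF i] by (intro add_nonneg_nonneg mult_nonneg_nonneg) auto
    then have "0 \<le> 1 + (1 - exp (- d i)) * (exp (z i) - 1)"
      by (simp add: algebra_simps)
    then show "0 \<le> 1 + (1 - exp (- d i)) * (exp (z i) - 1) \<and>
        1 + (1 - exp (- d i)) * (exp (z i) - 1) \<le> exp ((1 - exp (- d i)) * (exp (z i) - 1))"
      using exp_ge_add_one_self by blast
  qed
  also have "\<dots> / exp T = exp (- T + (\<Sum>i\<in>V. (1 - exp (- d i)) * (exp (z i) - 1)))"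
    using fin by (simp add: exp_sum exp_add exp_diff)
  finally show ?thesis by (simp add: divide_right_mono)
qed

section \<open>Bounds for the final set in a weighted graph\<close>

definition weight_rate :: "('a \<Rightarrow> real) \<Rightarrow> real \<Rightarrow> ('a \<Rightarrow> real) \<Rightarrow> 'a set \<Rightarrow> real" where
  "weight_rate w p y e = (if card e = 1 then y (the_elem e) else (\<Prod>i\<in>e. w i) * p)"

locale weighted_graph =
  fixes V :: "'a set" and w :: "'a \<Rightarrow> real" and p :: real and y :: "'a \<Rightarrow> real"
  assumes fin: "finite V" and w_pos: "\<And>i. i \<in> V \<Longrightarrow> 0 < w i"
    and p_nonneg: "0 \<le> p" and y_nonneg: "\<And>i. i \<in> V \<Longrightarrow> 0 \<le> y i"
begin

definition wt :: "'a set \<Rightarrow> real" where "wt A = (\<Sum>i\<in>A. w i)"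

definition pr :: "'a set set \<Rightarrow> real" where
  "pr S = outbreak_prob V (weight_rate w p y) S"

definition hit_prob :: "real \<Rightarrow> 'a \<Rightarrow> real" where
  "hit_prob t i = 1 - exp (- (y i + p * w i * t))"

text \<open>Cutting A down to V and returning 0 outside V makes the threshold monotone in A and
  nonnegative for arbitrary arguments, as the uniqueness of the final set requires.\<close>

definition thr :: "'a \<Rightarrow> 'a set \<Rightarrow> real" where
  "thr i A = (if i \<in> V then y i + p * w i * wt (A \<inter> V) else 0)"

lemma wt_mono: "A \<subseteq> B \<Longrightarrow> B \<subseteq> V \<Longrightarrow> wt A \<le> wt B"
  unfolding wt_def using fin w_pos
  by (intro sum_mono2) (auto intro: finite_subset less_imp_le)

lemma wt_nonneg: "A \<subseteq> V \<Longrightarrow> 0 \<le> wt A"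
  unfolding wt_def using w_pos by (intro sum_nonneg) (auto intro: less_imp_le)

lemma weight_rate_nonneg: "e \<in> coloured_edges V \<Longrightarrow> 0 \<le> weight_rate w p y e"
  using w_pos p_nonneg y_nonneg
  by (auto simp: weight_rate_def coloured_edges_def card_1_singleton_iff
      intro!: mult_nonneg_nonneg prod_nonneg intro: less_imp_le)

lemma hit_rate_weight_rate:
  assumes "i \<in> V" "A \<subseteq> V" "i \<notin> A"
  shows "hit_rate (weight_rate w p y) i A = y i + p * w i * wt A"
proof -
  have "(\<Sum>j\<in>A. weight_rate w p y {i, j}) = (\<Sum>j\<in>A. p * w i * w j)"
  proof (rule sum.cong[OF refl])
    fix j assume "j \<in> A"
    then have "i \<noteq> j" using assms by auto
    then show "weight_rate w p y {i, j} = p * w i * w j" by (simp add: weight_rate_def)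
  qed
  then show ?thesis by (simp add: hit_rate_def wt_def weight_rate_def sum_distrib_left)
qed

lemma thr_nonneg: "0 \<le> thr i A"
  using p_nonneg w_pos[of i] y_nonneg[of i] wt_nonneg[of "A \<inter> V"] by (auto simp: thr_def)

lemma thr_mono: "A \<subseteq> B \<Longrightarrow> thr i A \<le> thr i B"
  using p_nonneg w_pos[of i] wt_mono[of "A \<inter> V" "B \<inter> V"]
  by (auto simp: thr_def intro!: mult_left_mono)

lemma pr_sellke:
  assumes "S \<subseteq> Pow V"
  shows "pr S = measure (sellke V) {\<xi>\<in>space (sellke V). \<exists>A\<in>S. outbreak V (threshold_hit thr \<xi>) A}"
  unfolding pr_def
proof (rule outbreak_prob_sellke)
  fix i A assume "i \<in> V" "A \<subseteq> V" "i \<notin> A"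
  then show "thr i A = hit_rate (weight_rate w p y) i A"
    by (simp add: hit_rate_weight_rate thr_def Int_absorb2)
qed (use fin assms weight_rate_nonneg thr_nonneg thr_mono in auto)

text \<open>Let \<open>D\<close> be the set of vertices whose threshold is exceeded under the pressure \<open>t\<close>. The final set \<open>A\<close> is
  contained in \<open>D\<close> if its weight is at most \<open>t\<close> and contains \<open>D\<close> if its weight is at least \<open>t\<close>; if the
  weight of \<open>A\<close> exceeds \<open>t\<close>, then so does that of \<open>D\<close>, since otherwise the outbreak would stop within \<open>D\<close>.\<close>

lemma pr_le_chernoff:
  assumes t: "0 \<le> t" and S: "S \<subseteq> Pow V"
    and imp: "\<And>A D. A \<in> S \<Longrightarrow> D \<subseteq> V \<Longrightarrow> (wt A \<le> t \<Longrightarrow> A \<subseteq> D) \<Longrightarrow> (t \<le> wt A \<Longrightarrow> D \<subseteq> A) \<Longrightarrow>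
      (t < wt A \<Longrightarrow> t < wt D) \<Longrightarrow> T \<le> (\<Sum>i\<in>D. z i)"
  shows "pr S \<le> exp (- T + (\<Sum>i\<in>V. hit_prob t i * (exp (z i) - 1)))"
proof -
  interpret P: prob_space "sellke V" by (rule prob_space_sellke)
  let ?d = "\<lambda>i. y i + p * w i * t"
  let ?D = "\<lambda>\<xi>. {i\<in>V. \<xi> i \<le> ?d i}"
  have meas: "{\<xi>\<in>space (sellke V). T \<le> (\<Sum>i\<in>?D \<xi>. z i)} \<in> sets (sellke V)"
  proof -
    have "(\<lambda>\<xi>. \<Sum>i\<in>V. if \<xi> i \<le> ?d i then z i else 0) \<in> borel_measurable (sellke V)"
    proof (rule borel_measurable_sum)
      fix i assume "i \<in> V"
      then have [measurable]: "(\<lambda>\<xi>. \<xi> i) \<in> borel_measurable (sellke V)"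
        by (rule measurable_sellke_component)
      show "(\<lambda>\<xi>. if \<xi> i \<le> ?d i then z i else 0) \<in> borel_measurable (sellke V)" by measurable
    qed
    then show ?thesis using fin by (simp add: sum.inter_filter)
  qed
  have "pr S \<le> P.prob {\<xi>\<in>space (sellke V). T \<le> (\<Sum>i\<in>?D \<xi>. z i)}"
    unfolding pr_sellke[OF S]
  proof (rule P.finite_measure_mono[OF _ meas], safe)
    fix \<xi> A assume "\<xi> \<in> space (sellke V)" and A: "A \<in> S" and out: "outbreak V (threshold_hit thr \<xi>) A"
    have AV: "A \<subseteq> V" using A S by auto
    have o1: "\<forall>i\<in>V - A. \<not> threshold_hit thr \<xi> A i" and o2: "\<forall>B. B \<subset> A \<longrightarrow> (\<exists>i\<in>A - B. threshold_hit thr \<xi> B i)"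
      using out by (simp_all add: outbreak_def)
    have closed: "y i + p * w i * wt A < \<xi> i" if "i \<in> V - A" for i
      using o1[rule_format, OF that] that AV by (simp add: threshold_hit_def thr_def Int_absorb2)
    have mono: "p * w i * a \<le> p * w i * b" if "i \<in> V" "a \<le> b" for i a b
      using that w_pos[of i] p_nonneg by (intro mult_left_mono) auto
    have self: "\<exists>i\<in>A - B. \<xi> i \<le> ?d i" if B: "wt B \<le> t" "B \<subset> A" for B
    proof -
      obtain i where i: "i \<in> A - B" "threshold_hit thr \<xi> B i"
        using o2[rule_format, OF B(2)] ..
      moreover have "B \<inter> V = B" "i \<in> V" using B(2) AV i by auto
      ultimately show ?thesis
        using mono[OF _ B(1), of i] by (intro bexI[of _ i]) (simp_all add: threshold_hit_def thr_def)
    qed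
    have sup: "?D \<xi> \<subseteq> A" if "t \<le> wt A"
    proof
      fix i assume i: "i \<in> ?D \<xi>"
      show "i \<in> A"
      proof (rule ccontr)
        assume "i \<notin> A"
        then show False using closed[of i] mono[OF _ that, of i] i by simp
      qed
    qed
    show "T \<le> (\<Sum>i\<in>?D \<xi>. z i)"
    proof (rule imp[OF A])
      show "A \<subseteq> ?D \<xi>" if "wt A \<le> t"
      proof (rule ccontr)
        assume "\<not> A \<subseteq> ?D \<xi>"
        then have "A \<inter> ?D \<xi> \<subset> A" by auto
        moreover have "wt (A \<inter> ?D \<xi>) \<le> t" using wt_mono[of "A \<inter> ?D \<xi>" A] AV that by auto
        ultimately show False using self[of "A \<inter> ?D \<xi>"] AV by blast
      qed
      show "?D \<xi> \<subseteq> A" if "t \<le> wt A" by (rule sup[OF that])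
      show "t < wt (?D \<xi>)" if "t < wt A"
      proof (rule ccontr)
        assume neg: "\<not> t < wt (?D \<xi>)"
        have "?D \<xi> \<noteq> A" using neg that by auto
        then have "?D \<xi> \<subset> A" using sup that by auto
        moreover have "wt (?D \<xi>) \<le> t" using neg by simp
        ultimately show False using self[of "?D \<xi>"] AV by blast
      qed
    qed auto
  qed
  also have "\<dots> \<le> exp (- T + (\<Sum>i\<in>V. hit_prob t i * (exp (z i) - 1)))"
    unfolding hit_prob_def
    by (rule sellke_chernoff[OF fin]) (use t w_pos p_nonneg y_nonneg in \<open>auto intro!: add_nonneg_nonneg mult_nonneg_nonneg intro: less_imp_le\<close>)
  finally show ?thesis .
qed

lemma pr_weight_gt:
  assumes "0 \<le> t" "\<And>D. D \<subseteq> V \<Longrightarrow> t < wt D \<Longrightarrow> T \<le> (\<Sum>i\<in>D. z i)"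
  shows "pr {A\<in>Pow V. t < wt A} \<le> exp (- T + (\<Sum>i\<in>V. hit_prob t i * (exp (z i) - 1)))"
  by (rule pr_le_chernoff) (use assms in auto)

lemma pr_upper:
  assumes "0 \<le> t" "\<And>i. i \<in> V \<Longrightarrow> 0 \<le> z i"
  shows "pr {A\<in>Pow V. wt A \<le> t \<and> T \<le> (\<Sum>i\<in>A. z i)}
    \<le> exp (- T + (\<Sum>i\<in>V. hit_prob t i * (exp (z i) - 1)))"
proof (rule pr_le_chernoff[OF assms(1)])
  fix A D assume *: "A \<in> {A\<in>Pow V. wt A \<le> t \<and> T \<le> (\<Sum>i\<in>A. z i)}" "D \<subseteq> V" "wt A \<le> t \<Longrightarrow> A \<subseteq> D"
  then have "(\<Sum>i\<in>A. z i) \<le> (\<Sum>i\<in>D. z i)"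
    using fin assms(2) by (intro sum_mono2) (auto intro: finite_subset)
  then show "T \<le> (\<Sum>i\<in>D. z i)" using * by auto
qed auto

text \<open>For lower tails: with nonpositive \<open>z\<close> the inclusion
  \<open>D \<subseteq> A\<close> again bounds the sum over A by the sum over D, so that the same
  exponential estimate applies.\<close>

lemma pr_lower:
  assumes "0 \<le> t" "\<And>i. i \<in> V \<Longrightarrow> z i \<le> 0"
  shows "pr {A\<in>Pow V. t \<le> wt A \<and> T \<le> (\<Sum>i\<in>A. z i)}
    \<le> exp (- T + (\<Sum>i\<in>V. hit_prob t i * (exp (z i) - 1)))"
proof (rule pr_le_chernoff[OF assms(1)])
  fix A D assume *: "A \<in> {A\<in>Pow V. t \<le> wt A \<and> T \<le> (\<Sum>i\<in>A. z i)}" "D \<subseteq> V" "t \<le> wt A \<Longrightarrow> D \<subseteq> A"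
  then have "(\<Sum>i\<in>D. - z i) \<le> (\<Sum>i\<in>A. - z i)"
    using fin assms(2) by (intro sum_mono2) (auto intro: finite_subset)
  then show "T \<le> (\<Sum>i\<in>D. z i)" using * by (auto simp: sum_negf)
qed auto

lemma pr_markov:
  assumes S: "S \<subseteq> Pow V" and b: "\<And>i. i \<in> V \<Longrightarrow> 0 \<le> b i"
    and big: "\<And>A. A \<in> S \<Longrightarrow>
      K \<le> (\<Sum>i\<in>V - A. ln (1 + b i * exp (y i + p * w i * wt A))) - (\<Sum>i\<in>V. ln (1 + b i))"
  shows "pr S \<le> exp (- K)"
  unfolding pr_def
proof (rule outbreak_prob_markov[OF fin _ S b])
  fix A assume A: "A \<in> S"
  have "(\<Sum>i\<in>V - A. ln (1 + b i * exp (hit_rate (weight_rate w p y) i A))) =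
      (\<Sum>i\<in>V - A. ln (1 + b i * exp (y i + p * w i * wt A)))"
    using A S by (intro sum.cong refl) (subst hit_rate_weight_rate, auto)
  then show "K \<le> (\<Sum>i\<in>V - A. ln (1 + b i * exp (hit_rate (weight_rate w p y) i A))) - (\<Sum>i\<in>V. ln (1 + b i))"
    using big[OF A] by simp
qed (use weight_rate_nonneg in auto)

lemma pr_mono: "S \<subseteq> S' \<Longrightarrow> pr S \<le> pr S'"
  unfolding pr_def outbreak_prob_def by (intro measure_pmf.finite_measure_mono) auto

lemma pr_Un: "pr (S \<union> S') \<le> pr S + pr S'"
proof -
  let ?E = "\<lambda>S. {X. \<exists>A\<in>S. outbreak V (graph_hit X) A}"
  have "?E (S \<union> S') = ?E S \<union> ?E S'" by auto
  then show ?thesis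
    unfolding pr_def outbreak_prob_def by (simp add: measure_Un_le)
qed

lemma pr_UN:
  assumes "finite I"
  shows "pr (\<Union>k\<in>I. S k) \<le> (\<Sum>k\<in>I. pr (S k))"
proof -
  let ?E = "\<lambda>S. {X. \<exists>A\<in>S. outbreak V (graph_hit X) A}"
  have "?E (\<Union>k\<in>I. S k) = (\<Union>k\<in>I. ?E (S k))" by auto
  then show ?thesis
    unfolding pr_def outbreak_prob_def
    using measure_pmf.finite_measure_subadditive_finite[OF assms, of "\<lambda>k. ?E (S k)"] by auto
qed

end

section \<open>Finding a giant by random colourings\<close>

lemma exp_le_linear:
  fixes u :: real
  shows "0 \<le> u \<Longrightarrow> u \<le> 1 \<Longrightarrow> exp u - 1 \<le> 2 * u"
    and "0 \<le> u \<Longrightarrow> u \<le> 1/4 \<Longrightarrow> exp u - 1 \<le> 5/4 * u"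
proof -
  assume u: "0 \<le> u"
  show "u \<le> 1 \<Longrightarrow> exp u - 1 \<le> 2 * u"
    using exp_bound[OF u] mult_left_mono[of u 1 u] u by (simp add: power2_eq_square)
  show "u \<le> 1/4 \<Longrightarrow> exp u - 1 \<le> 5/4 * u"
    using exp_bound[OF u] mult_left_mono[of u "1/4" u] u by (simp add: power2_eq_square)
qed

text \<open>The product of \<open>1 + u + u\<^sup>2 / 2\<close> and
  \<open>1 - u + u\<^sup>2 / 2\<close> is at least 1, so the lower Taylor bound for
  \<open>exp u\<close> can be inverted.\<close>

lemma exp_minus_le_quadratic:
  fixes u :: real
  assumes "0 \<le> u"
  shows "exp (- u) \<le> 1 - u + u\<^sup>2 / 2"
proof -
  have pos: "0 < 1 + u + u\<^sup>2 / 2" using assms by (simp add: add_pos_nonneg)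
  have "(1 + u + u\<^sup>2 / 2) * (1 - u + u\<^sup>2 / 2) = 1 + (u\<^sup>2)\<^sup>2 / 4"
    by (simp add: field_simps power2_eq_square)
  then have "1 / (1 + u + u\<^sup>2 / 2) \<le> 1 - u + u\<^sup>2 / 2"
    using pos by (simp add: divide_le_eq mult.commute)
  moreover have "exp (- u) \<le> 1 / (1 + u + u\<^sup>2 / 2)"
    using exp_lower_Taylor_quadratic[OF assms] pos by (simp add: exp_minus inverse_eq_divide frac_le)
  ultimately show ?thesis by simp
qed

lemma exp_minus_le_linear:
  fixes u :: real
  assumes "0 \<le> u" "u \<le> 1/2"
  shows "exp (- u) - 1 \<le> - (3/4) * u"
proof -
  have "u\<^sup>2 \<le> u * (1/2)" unfolding power2_eq_square using assms by (intro mult_left_mono) auto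
  then show ?thesis using exp_minus_le_quadratic[OF assms(1)] by simp
qed

lemma one_minus_exp_ge_half:
  fixes u :: real
  assumes "0 \<le> u" "u \<le> 1"
  shows "u / 2 \<le> 1 - exp (- u)"
proof -
  have "u\<^sup>2 \<le> u * 1" unfolding power2_eq_square using assms by (intro mult_left_mono) auto
  then show ?thesis using exp_minus_le_quadratic[OF assms(1)] by simp
qed

lemma rate_pmf_chernoff:
  assumes fin: "finite J" and u: "\<And>j. j \<in> J \<Longrightarrow> 0 \<le> u j"
  shows "measure_pmf.prob (rate_pmf J u) {B. T \<le> (\<Sum>j\<in>{j\<in>J. B j}. z j)}
    \<le> exp (- T + (\<Sum>j\<in>J. (1 - exp (- u j)) * (exp (z j) - 1)))"
proof -
  let ?p = "rate_pmf J u"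
  let ?h = "\<lambda>j b. if b then exp (z j) else (1::real)"
  have prodI: "exp (\<Sum>j\<in>{j\<in>J. B j}. z j) = (\<Prod>j\<in>J. ?h j (B j))" for B
  proof -
    have "(\<Sum>j\<in>{j\<in>J. B j}. z j) = (\<Sum>j\<in>J. if B j then z j else 0)"
      using fin by (simp add: sum.inter_filter)
    then show ?thesis using fin by (auto simp: exp_sum intro!: prod.cong)
  qed
  have int: "integrable (measure_pmf (bernoulli_pmf q)) (?h j)" for q j
    by (rule integrable_measure_pmf_finite) (simp add: finite_subset[OF subset_UNIV])
  have "measure_pmf.prob ?p {B. T \<le> (\<Sum>j\<in>{j\<in>J. B j}. z j)} =
      measure_pmf.prob ?p {B\<in>space ?p. exp T \<le> (\<Prod>j\<in>J. ?h j (B j))}"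
    by (simp flip: prodI)
  also have "\<dots> \<le> measure_pmf.expectation ?p (\<lambda>B. \<Prod>j\<in>J. ?h j (B j)) / exp T"
    by (rule integral_Markov_inequality_measure[where A = "{}"])
      (use fin int in \<open>auto intro!: prod_nonneg integrable_prod_Pi_pmf\<close>)
  also have "measure_pmf.expectation ?p (\<lambda>B. \<Prod>j\<in>J. ?h j (B j)) =
      (\<Prod>j\<in>J. 1 + (1 - exp (- u j)) * (exp (z j) - 1))"
  proof (subst expectation_prod_Pi_pmf[OF fin int])
    show "(\<Prod>j\<in>J. measure_pmf.expectation (bernoulli_pmf (1 - exp (- u j))) (?h j)) =
        (\<Prod>j\<in>J. 1 + (1 - exp (- u j)) * (exp (z j) - 1))"
      using u by (intro prod.cong) (auto simp: algebra_simps)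
  qed auto
  also have "\<dots> \<le> (\<Prod>j\<in>J. exp ((1 - exp (- u j)) * (exp (z j) - 1)))"
  proof (rule prod_mono)
    fix j assume j: "j \<in> J"
    have "0 \<le> exp (- u j) + (1 - exp (- u j)) * exp (z j)"
      using u[OF j] by (intro add_nonneg_nonneg mult_nonneg_nonneg) auto
    then have "0 \<le> 1 + (1 - exp (- u j)) * (exp (z j) - 1)"
      by (simp add: algebra_simps)
    then show "0 \<le> 1 + (1 - exp (- u j)) * (exp (z j) - 1) \<and>
        1 + (1 - exp (- u j)) * (exp (z j) - 1) \<le> exp ((1 - exp (- u j)) * (exp (z j) - 1))"
      using exp_ge_add_one_self by blast
  qed
  also have "\<dots> / exp T = exp (- T + (\<Sum>j\<in>J. (1 - exp (- u j)) * (exp (z j) - 1)))"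
    using fin by (simp add: exp_sum exp_add exp_diff)
  finally show ?thesis by (simp add: divide_right_mono)
qed

text \<open>The items of \<open>J\<close> will be the components of a graph, coloured independently with rates proportional
  to their masses. A colouring is good if the coloured items are tiny in total or together look like
  the giant component.\<close>

locale colouring =
  fixes J :: "'a set" and sz wt :: "'a \<Rightarrow> real" and M e \<beta> c :: real and k1 N :: nat
  assumes fin: "finite J" and sz_nonneg: "\<And>j. j \<in> J \<Longrightarrow> 0 \<le> sz j" and wt_nonneg: "\<And>j. j \<in> J \<Longrightarrow> 0 \<le> wt j"
    and M_pos: "0 < M" and e_pos: "0 < e" and e_le: "e \<le> 1/4"
    and \<beta>_def: "\<beta> = 1 / 2 ^ k1" and \<beta>_le: "80 * \<beta> \<le> e" and N_ge: "k1 + 2 \<le> N"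
    and c_le: "c \<le> 1/8" "c \<le> (1 - exp (- \<beta>)) * exp (- (3840 * \<beta>)) * (1 - exp (- (32 * e)))"
begin

text \<open>Normalised by \<open>\<alpha> k * (M / 64) = 2 ^ k * \<beta>\<close>: at the threshold
  mass \<open>M / 64\<close> the exponent is \<beta> for index 0, 1 for index \<open>k1\<close> and
  at least 4 for index \<open>N\<close>. Thus small items stay in the linear regime up to
  \<open>k1\<close>, while at the end large ones are coloured with probability at least 7/8.\<close>

definition "\<alpha> k = 2 ^ k * (64 * \<beta>) / M" for k :: nat

definition "mass j = sz j + wt j" for j

definition good :: "('a \<Rightarrow> bool) \<Rightarrow> bool" where
  "good B \<longleftrightarrow> (\<Sum>j\<in>{j\<in>J. B j}. mass j) < M / 64 \<or>
    (\<Sum>j\<in>{j\<in>J. B j}. sz j) \<in> {(2 - e) * M..(2 + e) * M} \<and>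
    (\<Sum>j\<in>{j\<in>J. B j}. wt j) \<in> {(2 - e) * M..(2 + e) * M}"

definition P :: "nat \<Rightarrow> (('a \<Rightarrow> bool) \<Rightarrow> bool) \<Rightarrow> real" where
  "P k E = measure_pmf.prob (rate_pmf J (\<lambda>j. \<alpha> k * mass j)) {B. E B}"

definition "small = {j\<in>J. mass j < M / 64}"
definition "large = {j\<in>J. M / 64 \<le> mass j}"
definition "mean S k = (\<Sum>j\<in>S. (1 - exp (- (\<alpha> k * mass j))) * mass j)" for S k
definition "tot S B = (\<Sum>j\<in>{j\<in>S. B j}. mass j)" for S B

lemma \<beta>_pos: "0 < \<beta>" by (simp add: \<beta>_def)

lemma \<alpha>_pos: "0 < \<alpha> k" using \<beta>_pos M_pos by (simp add: \<alpha>_def)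

lemma mass_nonneg: "j \<in> J \<Longrightarrow> 0 \<le> mass j"
  using sz_nonneg wt_nonneg by (simp add: mass_def)

lemma \<alpha>_mass_nonneg: "j \<in> J \<Longrightarrow> 0 \<le> \<alpha> k * mass j"
  using \<alpha>_pos[of k] mass_nonneg by simp

lemma tot_mono: "S \<subseteq> J \<Longrightarrow> tot S B \<le> tot J B"
  unfolding tot_def using fin mass_nonneg by (intro sum_mono2) auto

text \<open>Size and weight near \<open>2 * M\<close> make a mass near \<open>4 * M\<close>. A good
  colouring therefore has mass below \<open>M / 64\<close> or between 7/2 and 9/2 of
  \<open>M\<close>, and every later contradiction is a colouring whose mass violates this.\<close>

lemma good_cases:
  assumes "good B" "M / 64 \<le> tot J B"
  shows "(2 - e) * M \<le> (\<Sum>j\<in>{j\<in>J. B j}. sz j)" "(\<Sum>j\<in>{j\<in>J. B j}. sz j) \<le> (2 + e) * M"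
    "(2 - e) * M \<le> (\<Sum>j\<in>{j\<in>J. B j}. wt j)" "(\<Sum>j\<in>{j\<in>J. B j}. wt j) \<le> (2 + e) * M"
    "7/2 * M \<le> tot J B" "tot J B \<le> 9/2 * M"
proof -
  show *: "(2 - e) * M \<le> (\<Sum>j\<in>{j\<in>J. B j}. sz j)" "(\<Sum>j\<in>{j\<in>J. B j}. sz j) \<le> (2 + e) * M"
    "(2 - e) * M \<le> (\<Sum>j\<in>{j\<in>J. B j}. wt j)" "(\<Sum>j\<in>{j\<in>J. B j}. wt j) \<le> (2 + e) * M"
    using assms by (auto simp: good_def tot_def)
  have "tot J B = (\<Sum>j\<in>{j\<in>J. B j}. sz j) + (\<Sum>j\<in>{j\<in>J. B j}. wt j)"
    by (simp add: tot_def mass_def sum.distrib)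
  moreover have "e * M \<le> 1/4 * M" using e_le M_pos by (intro mult_right_mono) auto
  ultimately show "7/2 * M \<le> tot J B" "tot J B \<le> 9/2 * M"
    using * by (simp_all add: algebra_simps)
qed

lemma P_compl: "P k (\<lambda>B. \<not> E B) = 1 - P k E"
proof -
  have "{B. \<not> E B} = UNIV - {B. E B}" by auto
  then show ?thesis unfolding P_def by (simp add: measure_pmf.prob_compl[simplified])
qed

lemma P_mono: "(\<And>B. E B \<Longrightarrow> E' B) \<Longrightarrow> P k E \<le> P k E'"
  unfolding P_def by (intro measure_pmf.finite_measure_mono) auto

lemma P_disj: "P k (\<lambda>B. E B \<or> E' B) \<le> P k E + P k E'"
proof -
  have "{B. E B \<or> E' B} = {B. E B} \<union> {B. E' B}" by auto
  then show ?thesis unfolding P_def by (simp add: measure_Un_le)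
qed

lemma P_none:
  assumes "S \<subseteq> J"
  shows "P k (\<lambda>B. \<forall>j\<in>S. \<not> B j) = exp (- (\<alpha> k * (\<Sum>j\<in>S. mass j)))"
  unfolding P_def using rate_pmf_none[OF fin _ assms, of "\<lambda>j. \<alpha> k * mass j"] \<alpha>_mass_nonneg
  by (simp add: sum_distrib_left)

lemma P_single:
  assumes "j \<in> J"
  shows "P k (\<lambda>B. B j) = 1 - exp (- (\<alpha> k * mass j))"
  using P_none[of "{j}" k] P_compl[of k "\<lambda>B. B j"] assms by simp

text \<open>The factor \<theta> is kept on both sides of the event so that a positive value yields
  upper tails and a negative one lower tails; \<open>K\<close> then has the sign of
  \<theta>.\<close>

lemma P_chernoff:
  assumes S: "S \<subseteq> J" and k: "\<And>j. j \<in> S \<Longrightarrow> exp (\<theta> * mass j) - 1 \<le> K * mass j"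
  shows "P k (\<lambda>B. \<theta> * T \<le> \<theta> * tot S B) \<le> exp (- (\<theta> * T) + K * mean S k)"
proof -
  let ?z = "\<lambda>j. if j \<in> S then \<theta> * mass j else 0"
  have fS: "finite S" using S fin finite_subset by blast
  have eq: "(\<Sum>j\<in>{j\<in>J. B j}. ?z j) = \<theta> * tot S B" for B
  proof -
    have "(\<Sum>j\<in>{j\<in>J. B j}. ?z j) = (\<Sum>j\<in>{j\<in>S. B j}. \<theta> * mass j)"
      using S fin by (intro sum.mono_neutral_cong_right) auto
    then show ?thesis by (simp add: tot_def sum_distrib_left)
  qed
  have "P k (\<lambda>B. \<theta> * T \<le> \<theta> * tot S B) \<le>
      exp (- (\<theta> * T) + (\<Sum>j\<in>J. (1 - exp (- (\<alpha> k * mass j))) * (exp (?z j) - 1)))"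
    unfolding P_def using rate_pmf_chernoff[OF fin, of "\<lambda>j. \<alpha> k * mass j" "\<theta> * T" ?z] \<alpha>_mass_nonneg
    unfolding eq by blast
  also have "(\<Sum>j\<in>J. (1 - exp (- (\<alpha> k * mass j))) * (exp (?z j) - 1)) =
      (\<Sum>j\<in>S. (1 - exp (- (\<alpha> k * mass j))) * (exp (\<theta> * mass j) - 1))"
    using S fin by (intro sum.mono_neutral_cong_right) auto
  also have "\<dots> \<le> (\<Sum>j\<in>S. (1 - exp (- (\<alpha> k * mass j))) * (K * mass j))"
    using S k \<alpha>_mass_nonneg by (intro sum_mono mult_left_mono) auto
  also have "\<dots> = K * mean S k"
    by (simp add: mean_def sum_distrib_left mult_ac)
  finally show ?thesis by simp
qed

text \<open>With \<open>\<theta> = - 32 / M\<close> the exponents on small items are at most 1/2 in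
  absolute value, where \<open>exp (- u) - 1\<close> is at most \<open>- (3/4) * u\<close>. The rate
  8 is 24 minus 16.\<close>

lemma P_small_lower:
  assumes "S \<subseteq> small"
  shows "P k (\<lambda>B. tot S B \<le> mean S k / 2) \<le> exp (- (8 * mean S k / M))"
proof -
  have "P k (\<lambda>B. (- 32 / M) * (mean S k / 2) \<le> (- 32 / M) * tot S B)
      \<le> exp (- ((- 32 / M) * (mean S k / 2)) + (- 24 / M) * mean S k)"
  proof (rule P_chernoff)
    fix j assume j: "j \<in> S"
    then have "0 \<le> 32 / M * mass j" "32 / M * mass j \<le> 1/2"
      using assms M_pos mass_nonneg[of j] by (auto simp: small_def field_simps)
    from exp_minus_le_linear[OF this]
    show "exp (- 32 / M * mass j) - 1 \<le> - 24 / M * mass j" by simp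
  qed (use assms in \<open>auto simp: small_def\<close>)
  moreover have "(- 32 / M) * (mean S k / 2) \<le> (- 32 / M) * tot S B \<longleftrightarrow> tot S B \<le> mean S k / 2" for B
    using M_pos by (subst mult_le_cancel_left_neg) auto
  ultimately show ?thesis using M_pos by (simp add: field_simps)
qed

text \<open>The first form has the larger \<theta> and serves for a threshold as low as
  \<open>e * M\<close> when the mean is tiny. The second has the better factor 5/4 and serves when
  the mean is comparable to \<open>M\<close>.\<close>

lemma P_small_upper:
  assumes "S \<subseteq> small"
  shows "P k (\<lambda>B. T \<le> tot S B) \<le> exp (- (64 * T / M) + 128 * mean S k / M)"
    and "P k (\<lambda>B. T \<le> tot S B) \<le> exp (- (16 * T / M) + 20 * mean S k / M)"
proof -
  have u: "0 \<le> 64 / M * mass j \<and> 64 / M * mass j \<le> 1" if "j \<in> S" for j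
    using assms M_pos mass_nonneg[of j] that by (auto simp: small_def field_simps)
  have SJ: "S \<subseteq> J" using assms by (auto simp: small_def)
  have iff: "x / M * T \<le> x / M * tot S B \<longleftrightarrow> T \<le> tot S B" if "0 < x" for x B
    using M_pos that by (subst mult_le_cancel_left_pos) auto
  have "P k (\<lambda>B. 64 / M * T \<le> 64 / M * tot S B) \<le> exp (- (64 / M * T) + 128 / M * mean S k)"
    by (rule P_chernoff[OF SJ]) (use exp_le_linear(1) u in fastforce)
  then show "P k (\<lambda>B. T \<le> tot S B) \<le> exp (- (64 * T / M) + 128 * mean S k / M)"
    by (subst (asm) iff) simp_all
  have "P k (\<lambda>B. 16 / M * T \<le> 16 / M * tot S B) \<le> exp (- (16 / M * T) + 20 / M * mean S k)"
  proof (rule P_chernoff[OF SJ])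
    fix j assume "j \<in> S"
    then have "0 \<le> 16 / M * mass j" "16 / M * mass j \<le> 1/4" using u[of j] by auto
    from exp_le_linear(2)[OF this] show "exp (16 / M * mass j) - 1 \<le> 20 / M * mass j" by simp
  qed
  then show "P k (\<lambda>B. T \<le> tot S B) \<le> exp (- (16 * T / M) + 20 * mean S k / M)"
    by (subst (asm) iff) simp_all
qed

text \<open>Doubling the rate squares the probability \<open>u\<close> of staying uncoloured, and
  \<open>1 - u\<^sup>2 \<le> 2 * (1 - u)\<close>. As the mean at most doubles, it cannot leap over a
  window whose ends differ by a factor 2.\<close>

lemma mean_Suc: "S \<subseteq> J \<Longrightarrow> mean S (Suc k) \<le> 2 * mean S k"
  unfolding mean_def sum_distrib_left
proof (rule sum_mono)
  fix j assume "S \<subseteq> J" "j \<in> S"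
  then have m: "0 \<le> mass j" "j \<in> J" using mass_nonneg by auto
  define u where "u = exp (- (\<alpha> k * mass j))"
  have eq: "exp (- (\<alpha> (Suc k) * mass j)) = u\<^sup>2"
    by (simp add: u_def \<alpha>_def power2_eq_square flip: exp_add)
  have "1 - u\<^sup>2 \<le> 2 * (1 - u)" using zero_le_power2[of "1 - u"] by (simp add: power2_eq_square algebra_simps)
  then show "(1 - exp (- (\<alpha> (Suc k) * mass j))) * mass j \<le> 2 * ((1 - exp (- (\<alpha> k * mass j))) * mass j)"
    unfolding eq u_def[symmetric] mult.assoc[symmetric] using m(1) by (rule mult_right_mono)
qed

lemma exp_small_bounds: "exp (- 80 :: real) \<le> 1/8" "exp (- 4 :: real) \<le> 1/8" "exp (- 12 :: real) \<le> 1/8"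
  "exp (- 28 :: real) \<le> 1/8" "exp (-2 :: real) \<le> 1/2"
proof -
  have *: "exp (- x) \<le> 1/8" if "4 \<le> x" for x :: real
  proof -
    have "8 \<le> 1 + x + x\<^sup>2 / 2" using that power_mono[of 4 x 2] by simp
    also have "\<dots> \<le> exp x" using that by (intro exp_lower_Taylor_quadratic) auto
    finally show ?thesis by (simp add: exp_minus field_simps)
  qed
  show "exp (- 80 :: real) \<le> 1/8" "exp (- 4 :: real) \<le> 1/8" "exp (- 12 :: real) \<le> 1/8"
    "exp (- 28 :: real) \<le> 1/8" by (rule *, simp)+
  have "2 \<le> exp (2::real)" using exp_ge_add_one_self[of 2] by linarith
  then show "exp (-2 :: real) \<le> 1/2" by (simp add: exp_minus field_simps)
qed

text \<open>Goodness is used throughout in the form \<open>H\<close>: any event of probability at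
  least \<open>c\<close> contains a good colouring. Were the mean above \<open>10 * M\<close>, the
  coloured mass would typically exceed \<open>5 * M\<close>, more than any good colouring
  has.\<close>

lemma mean_le:
  assumes H: "\<And>E. c \<le> P k E \<Longrightarrow> \<exists>B. E B \<and> good B"
  shows "mean small k \<le> 10 * M"
proof (rule ccontr)
  assume neg: "\<not> mean small k \<le> 10 * M"
  have "P k (\<lambda>B. tot small B \<le> mean small k / 2) \<le> exp (- (8 * mean small k / M))"
    by (rule P_small_lower) simp
  also have "\<dots> \<le> exp (- 80)" using neg M_pos by (simp add: field_simps)
  finally have "c \<le> P k (\<lambda>B. \<not> tot small B \<le> mean small k / 2)"
    using exp_small_bounds(1) c_le(1) unfolding P_compl by simp
  from H[OF this] obtain B where B: "\<not> tot small B \<le> mean small k / 2" "good B" by auto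
  have "tot small B \<le> tot J B" by (rule tot_mono) (auto simp: small_def)
  then show False using good_cases(6)[OF B(2)] B(1) neg M_pos by auto
qed

text \<open>Passing from index \<open>k1\<close> to index 0 multiplies the rate by \<beta>. On small
  items the exponent \<open>v\<close> at index \<open>k1\<close> is at most 1, so \<open>1 - exp (-
  (\<beta> * v)) \<le> \<beta> * v \<le> 2 * \<beta> * (1 - exp (- v))\<close> and the mean shrinks
  by a factor \<open>2 * \<beta>\<close>.\<close>

lemma mean_zero_le:
  assumes "mean small k1 \<le> 10 * M"
  shows "mean small 0 \<le> 20 * \<beta> * M"
proof -
  have \<alpha>k1: "\<alpha> k1 = 64 / M" unfolding \<alpha>_def using \<beta>_def by simp
  have \<alpha>0: "\<alpha> 0 = \<beta> * (64 / M)" by (simp add: \<alpha>_def)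
  have "mean small 0 \<le> (\<Sum>j\<in>small. 2 * \<beta> * ((1 - exp (- (\<alpha> k1 * mass j))) * mass j))"
    unfolding mean_def
  proof (rule sum_mono)
    fix j assume "j \<in> small"
    then have j: "0 \<le> mass j" "64 / M * mass j \<le> 1" "0 \<le> 64 / M * mass j"
      using mass_nonneg[of j] M_pos by (auto simp: small_def field_simps)
    have "1 - exp (- (\<alpha> 0 * mass j)) \<le> \<alpha> 0 * mass j"
      using exp_ge_add_one_self[of "- (\<alpha> 0 * mass j)"] by simp
    also have "\<dots> = 2 * \<beta> * ((64 / M * mass j) / 2)" by (simp add: \<alpha>0)
    also have "\<dots> \<le> 2 * \<beta> * (1 - exp (- (64 / M * mass j)))"
      using one_minus_exp_ge_half[OF j(3,2)] \<beta>_pos by (intro mult_left_mono) auto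
    finally show "(1 - exp (- (\<alpha> 0 * mass j))) * mass j \<le> 2 * \<beta> * ((1 - exp (- (\<alpha> k1 * mass j))) * mass j)"
      using j(1) unfolding \<alpha>k1 mult.assoc[symmetric] by (rule mult_right_mono)
  qed
  also have "\<dots> = 2 * \<beta> * mean small k1" by (simp add: mean_def sum_distrib_left)
  also have "\<dots> \<le> 2 * \<beta> * (10 * M)" using assms \<beta>_pos by (intro mult_left_mono) auto
  finally show ?thesis by simp
qed

lemma \<alpha>_N: "256 / M \<le> \<alpha> N"
proof -
  have "(2::real) ^ (k1 + 2) \<le> 2 ^ N" using N_ge by (rule power_increasing) simp
  then have "4 * 64 \<le> 2 ^ N * (64 * \<beta>)" by (simp add: \<beta>_def field_simps)
  then show ?thesis unfolding \<alpha>_def using M_pos by (simp add: divide_right_mono)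
qed

lemma large_exp:
  assumes "j \<in> large"
  shows "exp (- (\<alpha> N * mass j)) \<le> 1/8"
proof -
  have "4 = 256 / M * (M / 64)" using M_pos by simp
  also have "\<dots> \<le> \<alpha> N * mass j"
    using assms \<alpha>_N M_pos \<alpha>_pos[of N] by (intro mult_mono) (auto simp: large_def)
  finally have "exp (- (\<alpha> N * mass j)) \<le> exp (- 4)" by simp
  then show ?thesis using exp_small_bounds(2) by linarith
qed

text \<open>Each large item is coloured with probability at least 7/8 at the last rate, hence occurs
  in a good colouring and has mass at most \<open>6 * M\<close>. This makes
  \<open>- 1 / (12 * M)\<close> an admissible Chernoff parameter; a total above
  \<open>60 * M\<close> would then give a coloured mass above \<open>5 * M\<close> with probability
  at least 1/2.\<close>

lemma large_total:
  assumes H: "\<And>E. c \<le> P N E \<Longrightarrow> \<exists>B. E B \<and> good B"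
  shows "(\<Sum>j\<in>large. mass j) \<le> 60 * M"
proof (rule ccontr)
  have LJ: "large \<subseteq> J" by (auto simp: large_def)
  assume neg: "\<not> (\<Sum>j\<in>large. mass j) \<le> 60 * M"
  have m6: "mass j \<le> 6 * M" if j: "j \<in> large" for j
  proof -
    have "c \<le> P N (\<lambda>B. B j)"
      using large_exp[OF j] c_le(1) P_single[of j N] LJ j by auto
    from H[OF this] obtain B where B: "B j" "good B" by auto
    have "mass j \<le> tot J B"
      unfolding tot_def using B(1) j LJ mass_nonneg fin by (intro member_le_sum) auto
    then show ?thesis using good_cases(6)[OF B(2)] j M_pos by (auto simp: large_def)
  qed
  let ?\<theta> = "- (1 / (12 * M))"
  have mean: "7/8 * (60 * M) \<le> mean large N"
  proof -
    have "7/8 * (60 * M) \<le> 7/8 * (\<Sum>j\<in>large. mass j)"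
      using neg by simp
    also have "\<dots> = (\<Sum>j\<in>large. 7/8 * mass j)" by (simp only: sum_distrib_left)
    also have "\<dots> \<le> mean large N"
      unfolding mean_def
    proof (intro sum_mono mult_right_mono)
      fix j assume "j \<in> large"
      then show "7/8 \<le> 1 - exp (- (\<alpha> N * mass j))" "0 \<le> mass j"
        using large_exp[of j] LJ mass_nonneg[of j] by (linarith, auto)
    qed
    finally show ?thesis .
  qed
  have "P N (\<lambda>B. ?\<theta> * (5 * M) \<le> ?\<theta> * tot large B) \<le>
      exp (- (?\<theta> * (5 * M)) + (- (1 / (16 * M))) * mean large N)"
  proof (rule P_chernoff[OF LJ])
    fix j assume j: "j \<in> large"
    then have "0 \<le> 1 / (12 * M) * mass j" "1 / (12 * M) * mass j \<le> 1/2"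
      using m6[OF j] mass_nonneg[of j] LJ M_pos by (auto simp: field_simps)
    from exp_minus_le_linear[OF this]
    show "exp (?\<theta> * mass j) - 1 \<le> - (1 / (16 * M)) * mass j" using M_pos by (simp add: field_simps)
  qed
  also have "\<dots> \<le> exp (- 2)"
    using mean M_pos by (simp add: field_simps)
  finally have "P N (\<lambda>B. ?\<theta> * (5 * M) \<le> ?\<theta> * tot large B) \<le> exp (- 2)" .
  then have "c \<le> P N (\<lambda>B. \<not> (?\<theta> * (5 * M) \<le> ?\<theta> * tot large B))"
    using exp_small_bounds(5) c_le(1) unfolding P_compl by simp
  from H[OF this] obtain B where B: "\<not> (?\<theta> * (5 * M) \<le> ?\<theta> * tot large B)" "good B" by auto
  then have "5 * M < tot large B" using M_pos by (simp add: field_simps)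
  moreover have "tot large B \<le> tot J B" by (rule tot_mono[OF LJ])
  ultimately show False using good_cases(6)[OF B(2)] M_pos by auto
qed

text \<open>If all items were small, the coloured mass would be concentrated around its mean, and for some rate
  of the geometric grid this mean lies in the forbidden gap.\<close>

lemma large_nonempty:
  assumes H: "\<And>k E. k \<le> N \<Longrightarrow> c \<le> P k E \<Longrightarrow> \<exists>B. E B \<and> good B"
    and HN: "P N (\<lambda>B. tot J B < M / 64) < c" and mean0: "mean small 0 \<le> 20 * \<beta> * M"
  shows "large \<noteq> {}"
proof
  assume "large = {}"
  then have SJ: "small = J" by (auto simp: small_def large_def)
  have meanN: "M \<le> mean small N"
  proof (rule ccontr)
    assume neg: "\<not> M \<le> mean small N"
    have "P N (\<lambda>B. 3 * M \<le> tot small B) \<le> exp (- (16 * (3 * M) / M) + 20 * mean small N / M)"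
      by (rule P_small_upper) simp
    also have "\<dots> \<le> exp (- 28)" using neg M_pos by (simp add: field_simps)
    finally have "P N (\<lambda>B. tot J B < M / 64 \<or> 3 * M \<le> tot small B) \<le> 1/4"
      using P_disj[of N "\<lambda>B. tot J B < M / 64" "\<lambda>B. 3 * M \<le> tot small B"] HN exp_small_bounds(4) c_le(1) by simp
    then have "c \<le> P N (\<lambda>B. \<not> (tot J B < M / 64 \<or> 3 * M \<le> tot small B))"
      unfolding P_compl using c_le(1) by simp
    from H[OF order.refl this] obtain B where B: "\<not> (tot J B < M / 64 \<or> 3 * M \<le> tot small B)" "good B"
      by auto
    then show False using good_cases(5)[OF B(2)] M_pos SJ by auto
  qed
  have ex: "\<exists>k. k \<le> N \<and> M / 2 \<le> mean small k"
    using meanN M_pos by (intro exI[of _ N]) auto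
  \<comment> \<open>At the first index where the mean reaches \<open>M / 2\<close> it is still below
    \<open>M\<close> by \<open>mean_Suc\<close>. Concentration then places the coloured mass between
    \<open>M / 4\<close> and \<open>2 * M\<close>, where no good colouring lies.\<close>
  define k where "k = (LEAST k. k \<le> N \<and> M / 2 \<le> mean small k)"
  have k: "k \<le> N" "M / 2 \<le> mean small k"
    using LeastI_ex[OF ex] by (auto simp: k_def)
  have "20 * \<beta> \<le> 1/16" using \<beta>_le e_le by simp
  then have "20 * \<beta> * M \<le> 1/16 * M" using M_pos by (intro mult_right_mono) auto
  then have "mean small 0 < M / 2" using mean0 M_pos by linarith
  then have "k \<noteq> 0" using k(2) by (cases k) auto
  then obtain k' where k': "k = Suc k'" by (cases k) auto
  have "\<not> (k' \<le> N \<and> M / 2 \<le> mean small k')"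
    using not_less_Least[of k' "\<lambda>k. k \<le> N \<and> M / 2 \<le> mean small k"] k' by (simp add: k_def)
  then have "mean small k' < M / 2" using k(1) k' by auto
  then have upper: "mean small k < M"
    using mean_Suc[of small k'] k' by (auto simp: small_def)
  have "P k (\<lambda>B. tot small B \<le> mean small k / 2) \<le> exp (- (8 * mean small k / M))"
    by (rule P_small_lower) simp
  also have "\<dots> \<le> exp (- 4)" using k(2) M_pos by (simp add: field_simps)
  finally have 1: "P k (\<lambda>B. tot small B \<le> mean small k / 2) \<le> 1/8" using exp_small_bounds(2) by simp
  have "P k (\<lambda>B. 2 * M \<le> tot small B) \<le> exp (- (16 * (2 * M) / M) + 20 * mean small k / M)"
    by (rule P_small_upper) simp
  also have "\<dots> \<le> exp (- 12)" using upper M_pos by (simp add: field_simps)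
  finally have 2: "P k (\<lambda>B. 2 * M \<le> tot small B) \<le> 1/8" using exp_small_bounds(3) by simp
  have "c \<le> P k (\<lambda>B. \<not> (tot small B \<le> mean small k / 2 \<or> 2 * M \<le> tot small B))"
    using P_disj[of k "\<lambda>B. tot small B \<le> mean small k / 2" "\<lambda>B. 2 * M \<le> tot small B"] 1 2 c_le(1)
    unfolding P_compl by simp
  from H[OF k(1) this] obtain B where
    B: "\<not> (tot small B \<le> mean small k / 2 \<or> 2 * M \<le> tot small B)" "good B" by auto
  then show False using good_cases(5)[OF B(2)] k(2) M_pos SJ by auto
qed

lemma P_conj_indep:
  assumes "S \<inter> T = {}" "S \<subseteq> J" "T \<subseteq> J"
    and "\<And>f g. (\<forall>x\<in>S. f x = g x) \<Longrightarrow> E f = E g" "\<And>f g. (\<forall>x\<in>T. f x = g x) \<Longrightarrow> E' f = E' g"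
  shows "P k (\<lambda>B. E B \<and> E' B) = P k E * P k E'"
  unfolding P_def by (rule prob_Pi_pmf_indep[OF fin assms(2,3,1)]) (use assms(4,5) in auto)

text \<open>At the smallest rate of the grid, a large item is with probability bounded below the only large
  item that is coloured, while the small ones contribute little; so it must look like the giant.\<close>

lemma large_giant:
  assumes H: "\<And>E. c \<le> P 0 E \<Longrightarrow> \<exists>B. E B \<and> good B"
    and mean0: "mean small 0 \<le> 20 * \<beta> * M" and tot: "(\<Sum>j\<in>large. mass j) \<le> 60 * M"
    and j: "j \<in> large"
  shows "sz j \<in> {(2 - 2 * e) * M..(2 + 2 * e) * M}" "wt j \<in> {(2 - 2 * e) * M..(2 + 2 * e) * M}"
proof -
  have LJ: "large \<subseteq> J" and SJ: "small \<subseteq> J" and LS: "large \<inter> small = {}"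
    by (auto simp: large_def small_def)
  have fL: "finite large" using fin LJ finite_subset by blast
  let ?E1 = "\<lambda>B::'a \<Rightarrow> bool. B j" and ?E2 = "\<lambda>B. \<forall>i\<in>large - {j}. \<not> B i" and ?E3 = "\<lambda>B. \<not> e * M \<le> tot small B"
  have \<alpha>0: "\<alpha> 0 = \<beta> * 64 / M" by (simp add: \<alpha>_def)
  \<comment> \<open>The three probabilities behind the bound on \<open>c\<close>: item
    \<open>j\<close> is coloured, its exponent being at least \<beta>; no other large item is, the
    exponent being at most 64 * 60 times \<beta>; and the small items contribute less than
    \<open>e * M\<close>.\<close>
  have p1: "1 - exp (- \<beta>) \<le> P 0 ?E1"
  proof -
    have "\<beta> = \<alpha> 0 * (M / 64)" using M_pos by (simp add: \<alpha>0)
    also have "\<dots> \<le> \<alpha> 0 * mass j" using j \<alpha>_pos[of 0] by (intro mult_left_mono) (auto simp: large_def)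
    finally show ?thesis using P_single[of j 0] j LJ by auto
  qed
  have p2: "exp (- (3840 * \<beta>)) \<le> P 0 ?E2"
  proof -
    have "(\<Sum>i\<in>large - {j}. mass i) \<le> (\<Sum>i\<in>large. mass i)"
      using fL LJ mass_nonneg by (intro sum_mono2) auto
    then have "\<alpha> 0 * (\<Sum>i\<in>large - {j}. mass i) \<le> \<alpha> 0 * (60 * M)"
      using tot \<alpha>_pos[of 0] by (intro mult_left_mono) auto
    also have "\<dots> = 3840 * \<beta>" using M_pos by (simp add: \<alpha>0)
    finally have "\<alpha> 0 * (\<Sum>i\<in>large - {j}. mass i) \<le> 3840 * \<beta>" .
    moreover have "large - {j} \<subseteq> J" using LJ by auto
    ultimately show ?thesis by (subst P_none) simp_all
  qed
  have p3: "1 - exp (- (32 * e)) \<le> P 0 ?E3"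
  proof -
    have "P 0 (\<lambda>B. e * M \<le> tot small B) \<le> exp (- (64 * (e * M) / M) + 128 * mean small 0 / M)"
      by (rule P_small_upper) simp
    also have "\<dots> \<le> exp (- (32 * e))"
    proof -
      have "128 * mean small 0 / M \<le> 128 * (20 * \<beta> * M) / M"
        by (intro divide_right_mono mult_left_mono mean0) (use M_pos in auto)
      also have "\<dots> \<le> 32 * e" using \<beta>_le M_pos by simp
      finally show ?thesis using M_pos by simp
    qed
    finally show ?thesis unfolding P_compl by simp
  qed
  have "P 0 (\<lambda>B. ?E1 B \<and> (?E2 B \<and> ?E3 B)) = P 0 ?E1 * P 0 (\<lambda>B. ?E2 B \<and> ?E3 B)"
    by (rule P_conj_indep[of "{j}" "(large - {j}) \<union> small"])
      (use j LJ SJ LS in \<open>auto simp: tot_def cong: sum.cong conj_cong\<close>)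
  also have "P 0 (\<lambda>B. ?E2 B \<and> ?E3 B) = P 0 ?E2 * P 0 ?E3"
    by (rule P_conj_indep[of "large - {j}" small])
      (use LJ SJ LS in \<open>auto simp: tot_def cong: sum.cong conj_cong\<close>)
  finally have "P 0 (\<lambda>B. ?E1 B \<and> (?E2 B \<and> ?E3 B)) = P 0 ?E1 * P 0 ?E2 * P 0 ?E3" by (simp add: mult.assoc)
  moreover have "(1 - exp (- \<beta>)) * exp (- (3840 * \<beta>)) * (1 - exp (- (32 * e))) \<le> P 0 ?E1 * P 0 ?E2 * P 0 ?E3"
    using p1 p2 p3 \<beta>_pos e_pos by (intro mult_mono mult_nonneg_nonneg) (auto simp: P_def)
  ultimately have "c \<le> P 0 (\<lambda>B. ?E1 B \<and> (?E2 B \<and> ?E3 B))" using c_le(2) by linarith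
  from H[OF this] obtain B where B: "B j" "\<forall>i\<in>large - {j}. \<not> B i" "tot small B < e * M" "good B" by auto
  have split: "{i\<in>J. B i} = insert j {i\<in>small. B i}"
    using B(1,2) j by (force simp: large_def small_def not_less)
  have jn: "j \<notin> {i\<in>small. B i}" using j LS by auto
  have fS: "finite {i\<in>small. B i}" using fin SJ by (auto intro: finite_subset)
  have sum: "(\<Sum>i\<in>{i\<in>J. B i}. f i) = f j + (\<Sum>i\<in>{i\<in>small. B i}. f i)" for f :: "'a \<Rightarrow> real"
    unfolding split using jn fS by simp
  have "M / 64 \<le> tot J B"
    unfolding tot_def sum using j by (auto simp: large_def intro!: add_increasing2 sum_nonneg mass_nonneg[OF subsetD[OF SJ]])
  note g = good_cases[OF B(4) this, unfolded sum]
  have nn: "0 \<le> (\<Sum>i\<in>{i\<in>small. B i}. sz i)" "0 \<le> (\<Sum>i\<in>{i\<in>small. B i}. wt i)"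
    by (auto intro!: sum_nonneg sz_nonneg[OF subsetD[OF SJ]] wt_nonneg[OF subsetD[OF SJ]])
  have "(\<Sum>i\<in>{i\<in>small. B i}. sz i) + (\<Sum>i\<in>{i\<in>small. B i}. wt i) < e * M"
    using B(3) by (simp add: tot_def mass_def sum.distrib)
  moreover have "0 < e * M" using e_pos M_pos by simp
  ultimately show "sz j \<in> {(2 - 2 * e) * M..(2 + 2 * e) * M}" "wt j \<in> {(2 - 2 * e) * M..(2 + 2 * e) * M}"
    using g nn by (simp_all add: algebra_simps)
qed

text \<open>Two large items would both have mass at least \<open>3 * M\<close> and be coloured
  together with probability at least 3/4 at the last rate. A good colouring would then have mass at
  least \<open>6 * M\<close>, which is impossible.\<close>

theorem unique_giant:
  assumes good: "\<And>k. k \<le> N \<Longrightarrow> P k (\<lambda>B. \<not> good B) < c"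
    and notsmall: "P N (\<lambda>B. tot J B < M / 64) < c"
  shows "\<exists>K\<in>J. sz K \<in> {(2 - 2 * e) * M..(2 + 2 * e) * M} \<and> wt K \<in> {(2 - 2 * e) * M..(2 + 2 * e) * M} \<and>
    (\<forall>j\<in>J - {K}. mass j < M / 64)"
proof -
  have H: "\<exists>B. E B \<and> good B" if "k \<le> N" "c \<le> P k E" for k E
  proof (rule ccontr)
    assume "\<not> (\<exists>B. E B \<and> good B)"
    then have "P k E \<le> P k (\<lambda>B. \<not> good B)" by (intro P_mono) auto
    then show False using that good[OF that(1)] by simp
  qed
  have k1N: "k1 \<le> N" using N_ge by simp
  have mean0: "mean small 0 \<le> 20 * \<beta> * M"
    by (rule mean_zero_le, rule mean_le, rule H[OF k1N])
  have tot: "(\<Sum>j\<in>large. mass j) \<le> 60 * M"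
    by (rule large_total, rule H[OF order.refl])
  have giant: "sz j \<in> {(2 - 2 * e) * M..(2 + 2 * e) * M}" "wt j \<in> {(2 - 2 * e) * M..(2 + 2 * e) * M}"
    if "j \<in> large" for j
    using large_giant[OF H[OF le0] mean0 tot that] by auto
  have "large \<noteq> {}" by (rule large_nonempty[OF _ notsmall mean0]) (rule H)
  then obtain K where K: "K \<in> large" by auto
  have "large \<subseteq> {K}"
  proof
    fix j assume j: "j \<in> large"
    show "j \<in> {K}"
    proof (rule ccontr)
      assume ne: "j \<notin> {K}"
      have jK: "j \<in> J" "K \<in> J" using j K by (auto simp: large_def)
      have n1: "P N (\<lambda>B. \<not> B j) \<le> 1/8" "P N (\<lambda>B. \<not> B K) \<le> 1/8"
        unfolding P_compl using P_single[OF jK(1), of N] P_single[OF jK(2), of N] large_exp[OF j] large_exp[OF K] by auto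
      then have "c \<le> P N (\<lambda>B. \<not> (\<not> B j \<or> \<not> B K))"
        using P_disj[of N "\<lambda>B. \<not> B j" "\<lambda>B. \<not> B K"] c_le(1) unfolding P_compl by simp
      from H[OF order.refl this] obtain B where B: "B j" "B K" "good B" by auto
      have "mass j + mass K = (\<Sum>i\<in>{j, K}. mass i)" using ne by auto
      also have "\<dots> \<le> tot J B"
        unfolding tot_def using fin B jK mass_nonneg by (intro sum_mono2) auto
      finally have le: "mass j + mass K \<le> tot J B" .
      have eM: "e * M \<le> 1/4 * M" using e_le M_pos by (intro mult_right_mono) auto
      have "3 * M \<le> mass i" if "i \<in> large" for i
        using giant[OF that] eM by (simp add: mass_def algebra_simps)
      from this[OF j] this[OF K] le show False
        using good_cases(6)[OF B(3)] M_pos by auto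
    qed
  qed
  then have "mass j < M / 64" if "j \<in> J - {K}" for j
    using that by (force simp: large_def)
  then show ?thesis using giant[OF K] K by (auto simp: large_def intro!: bexI[of _ K])
qed

end

section \<open>Outbreaks in the barely supercritical regime\<close>

lemma exp_le_quadratic:
  fixes u :: real
  assumes "0 \<le> u" "u \<le> 1"
  shows "exp u - 1 \<le> u + u\<^sup>2"
  using exp_bound[OF assms] by simp

lemma exp_minus_ge_cubic:
  fixes z :: real
  assumes "0 \<le> z"
  shows "1 - z + z\<^sup>2 / 2 - z ^ 3 / 6 \<le> exp (- z)"
proof -
  let ?g = "\<lambda>z::real. exp (- z) - (1 - z + z\<^sup>2 / 2 - z ^ 3 / 6)"
  have "?g 0 \<le> ?g z"
  proof (rule DERIV_nonneg_imp_nondecreasing[OF assms])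
    fix u :: real assume u: "0 \<le> u"
    have "(?g has_real_derivative (- exp (- u) - (- 1 + u - u\<^sup>2 / 2))) (at u)"
      by (auto intro!: derivative_eq_intros simp: power2_eq_square power3_eq_cube field_simps)
    moreover have "0 \<le> - exp (- u) - (- 1 + u - u\<^sup>2 / 2)"
      using exp_minus_le_quadratic[OF u] by simp
    ultimately show "\<exists>y. (?g has_real_derivative y) (at u) \<and> 0 \<le> y" by blast
  qed
  then show ?thesis by simp
qed

text \<open>The contribution of one vertex to the logarithm of the product martingale. The
  difference is \<open>ln (1 + u)\<close> with \<open>u = a * (exp z - 1) / (1 + a)\<close>.
  Replacing \<open>1 / (1 + a)\<close> by \<open>1 - a\<close> costs
  \<open>2 * a\<^sup>2 * z\<close>, and \<open>ln (1 + u) \<ge> u - u\<^sup>2\<close> costs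
  \<open>4 * a\<^sup>2 * z\<close>.\<close>

lemma ln_ratio_lower:
  fixes a z :: real
  assumes a: "0 \<le> a" "a \<le> 1/2" and z: "0 \<le> z" "z \<le> 1"
  shows "a * (z + z\<^sup>2 / 2) - 6 * a\<^sup>2 * z \<le> ln (1 + a * exp z) - ln (1 + a)"
proof -
  define h where "h = exp z - 1"
  have h: "0 \<le> h" "h \<le> 2 * z" "z + z\<^sup>2 / 2 \<le> h"
    using exp_le_linear(1)[of z] exp_lower_Taylor_quadratic[of z] z by (auto simp: h_def)
  define u where "u = a * h / (1 + a)"
  have u0: "0 \<le> u" using a h by (simp add: u_def)
  have u_le: "u \<le> a * h"
    using a h mult_left_mono[of 1 "1 + a" "a * h"] by (simp add: u_def divide_le_eq)
  have ah: "a * h \<le> 1/2 * 2" using a h z by (intro mult_mono) auto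
  have u_ge: "a * h - a * a * h \<le> u"
  proof -
    have "(a * h - a * a * h) * (1 + a) = a * h * (1 - a * a)" by (simp add: algebra_simps)
    also have "\<dots> \<le> a * h * 1" using a h by (intro mult_left_mono) auto
    finally show ?thesis using a by (simp add: u_def le_divide_eq)
  qed
  have "1 + a * exp z = (1 + a) * (1 + u)"
    using a by (simp add: u_def h_def field_simps)
  then have "ln (1 + a * exp z) - ln (1 + a) = ln (1 + u)"
    using a u0 by (simp add: ln_mult)
  also have "u - u\<^sup>2 \<le> \<dots>"
    using u0 u_le ah by (intro ln_one_plus_pos_lower_bound) auto
  finally have "u - u\<^sup>2 \<le> ln (1 + a * exp z) - ln (1 + a)" .
  moreover have "u\<^sup>2 \<le> (a * h)\<^sup>2" using u0 u_le by (intro power_mono)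
  moreover have "(a * h)\<^sup>2 \<le> a\<^sup>2 * (4 * z)"
  proof -
    have "h * h \<le> 2 * (2 * z)" using h z by (intro mult_mono) auto
    then have "a\<^sup>2 * (h * h) \<le> a\<^sup>2 * (4 * z)" by (intro mult_left_mono) auto
    then show ?thesis by (simp add: power2_eq_square mult_ac)
  qed
  moreover have "a * a * h \<le> a\<^sup>2 * (2 * z)"
    using h by (simp add: power2_eq_square mult_left_mono)
  moreover have "a * (z + z\<^sup>2 / 2) \<le> a * h" using h(3) a(1) by (rule mult_left_mono)
  ultimately show ?thesis using u_ge by (simp add: algebra_simps)
qed

lemma one_minus_exp_le: "1 - exp (- u) \<le> (u :: real)"
  using exp_ge_add_one_self[of "- u"] by simp

text \<open>Here \<open>p = (1 + \<phi>) / l\<close> with \<open>\<phi> = f / l\<^bsup>1/3\<^esup>\<close>, and \<open>M = \<phi> l / C\<close>. All error terms are controlled by one small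
  constant \<open>\<eta>\<close>, chosen after \<open>e\<close> and \<open>\<kappa>\<close>; the assumptions \<open>h1\<close> to \<open>h8\<close> say how small, and \<open>hf1\<close> to \<open>hf3\<close> say how
  large \<open>f\<close> has to be. Vertices with \<open>\<phi> w\<^sub>i > \<eta>\<close> are too heavy for Taylor expansions of \<open>exp (p w\<^sub>i t)\<close>,
  but uniform integrability of \<open>w\<^sup>3\<close> makes their total weight negligible.\<close>

locale regime = weighted_graph V w p y
  for V :: "'a set" and w :: "'a \<Rightarrow> real" and p :: real and y :: "'a \<Rightarrow> real" +
  fixes \<phi> C e N0 \<kappa> \<eta> x f :: real
  assumes V_ne: "V \<noteq> {}" and p_def: "p = (1 + \<phi>) / sum w V" and y_def: "y = (\<lambda>i. p * x * (1 + w i))"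
    and C_pos: "0 < C" and e_pos: "0 < e" and e_le: "e \<le> 1/256" and N0: "0 \<le> N0"
    and \<kappa>: "0 < \<kappa>" "\<kappa> \<le> 1" and \<eta>_pos: "0 < \<eta>" and \<eta>_le: "\<eta> \<le> 1"
    and \<phi>_pos: "0 < \<phi>" and \<phi>_le: "\<phi> \<le> \<eta>" and f_pos: "0 < f" and f_cube: "f ^ 3 = \<phi> ^ 3 * sum w V"
    and s2: "\<bar>(\<Sum>i\<in>V. (w i)\<^sup>2) - sum w V\<bar> \<le> \<eta> * \<phi> * sum w V"
    and s3: "\<bar>(\<Sum>i\<in>V. w i ^ 3) - C * sum w V\<bar> \<le> \<eta> * sum w V"
    and cnt: "real (card V) \<le> N0 * sum w V"
    and high: "(\<Sum>i\<in>{i\<in>V. \<eta> < \<phi> * w i}. w i ^ 3) \<le> \<eta> ^ 3 * sum w V"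
    and wmax: "\<And>i. i \<in> V \<Longrightarrow> f * (w i)\<^sup>2 \<le> \<eta> * (\<phi> * sum w V)"
    and f_le: "f \<le> \<eta> * (\<phi> * sum w V)"
    and x0: "0 \<le> x" and x_le: "x \<le> \<kappa> * \<phi> * (\<phi> * sum w V)"
    and h1: "2 * \<eta> + 16 * \<eta> / C \<le> e / 8"
    and h2: "\<eta> + 6 * \<kappa> \<le> e / (4 * C)"
    and h3: "2 * \<eta> * ((C + 2) * 3 / C + (2 * C + 6) * \<kappa>) + 192 / e * \<eta> \<le> e / 32" "64 / e * \<eta> \<le> 1"
    and h4: "4 * \<eta> + 2 * \<eta> / C + (C + 2) * \<kappa> * \<eta> / 2 + 4 * (\<eta> + 12 * \<eta> / C) \<le> e / 8"
    and h5: "2 * (N0 + 1) * \<kappa> * \<eta> + 3 * \<eta> / C \<le> e / (4 * C)"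
    and h6: "16 * (3 / C + 1) * \<eta> \<le> (e / C)\<^sup>2" "e / C \<le> 1"
    and h7: "36 * \<eta> / C\<^sup>2 \<le> e / (4 * C)"
    and h8: "\<kappa> * \<eta> \<le> 1 / C"
    and hf1: "64 * C * (4 * C + 8) \<le> e\<^sup>2 * f\<^sup>2"
    and hf2: "393216 * C * (C + 1) \<le> e\<^sup>2 * f\<^sup>2"
    and hf3: "384 * (C + 1) \<le> e * \<kappa> * f\<^sup>2"
begin

section \<open>Scales and moment sums\<close>

definition "l = sum w V"
text \<open>This is \<open>f * l powr (2/3)\<close>, the order of the giant. Deviations of relative
  size \<phi> cost \<phi> times \<phi> times \<open>L\<close> in the exponent, which by
  \<open>f3\<close> is \<open>f ^ 3\<close>; this exceeds \<open>2 * f\<close> with room for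
  constants once \<open>f\<close> is large.\<close>

definition "L = \<phi> * l"
definition "low = {i\<in>V. \<phi> * w i \<le> \<eta>}"
definition "hi = {i\<in>V. \<eta> < \<phi> * w i}"
definition "S2 = (\<Sum>i\<in>V. (w i)\<^sup>2)"
definition "S3 = (\<Sum>i\<in>V. w i ^ 3)"
definition "H1 = (\<Sum>i\<in>hi. w i)"
definition "H2 = (\<Sum>i\<in>hi. (w i)\<^sup>2)"
definition "H3 = (\<Sum>i\<in>hi. w i ^ 3)"

lemma low_hi: "V = low \<union> hi" "low \<inter> hi = {}" "finite low" "finite hi" "low \<subseteq> V" "hi \<subseteq> V"
  using fin by (auto simp: low_def hi_def)

lemma sum_low: "(\<Sum>i\<in>low. g i) = (\<Sum>i\<in>V. g i) - (\<Sum>i\<in>hi. g i)" for g :: "'a \<Rightarrow> real"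
  using sum.union_disjoint[OF low_hi(3,4,2), of g] low_hi(1) by simp

lemma w_nonneg: "i \<in> V \<Longrightarrow> 0 \<le> w i" using w_pos by (auto intro: less_imp_le)

lemma l_pos: "0 < l" unfolding l_def using fin V_ne w_pos by (intro sum_pos) auto
lemma L_pos: "0 < L" using l_pos \<phi>_pos by (simp add: L_def)
lemma p_pos: "0 < p" using l_pos \<phi>_pos by (simp add: p_def l_def)
lemma pl: "p * l = 1 + \<phi>" using l_pos by (simp add: p_def l_def)
lemma pL: "p * L = \<phi> * (1 + \<phi>)" using pl by (simp add: L_def mult_ac)
lemma \<phi>_le1: "\<phi> \<le> 1" using \<phi>_le \<eta>_le by simp
lemma f3: "\<phi>\<^sup>2 * L = f ^ 3" using f_cube by (simp add: L_def l_def power2_eq_square power3_eq_cube mult_ac)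
lemma x_le': "x \<le> \<kappa> * \<phi> * L" using x_le by (simp add: L_def l_def)
lemma x_le_\<eta>: "x \<le> \<kappa> * \<eta> * L"
proof -
  have "\<kappa> * \<phi> * L \<le> \<kappa> * \<eta> * L" using \<phi>_le \<kappa> L_pos by (intro mult_right_mono mult_left_mono) auto
  then show ?thesis using x_le' by linarith
qed
lemma x_le_L: "x \<le> L / C"
  using x_le_\<eta> mult_right_mono[OF h8, of L] L_pos by simp

lemma S2_le: "S2 \<le> (1 + \<eta> * \<phi>) * l" and S2_ge: "(1 - \<eta> * \<phi>) * l \<le> S2"
  using s2 by (auto simp: S2_def l_def algebra_simps abs_le_iff)
lemma S3_le: "S3 \<le> (C + \<eta>) * l" and S3_ge: "(C - \<eta>) * l \<le> S3"
  using s3 by (auto simp: S3_def l_def algebra_simps abs_le_iff)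
lemma S2_nonneg: "0 \<le> S2" unfolding S2_def by (intro sum_nonneg) auto

lemma \<eta>\<phi>2: "\<eta> * \<phi> * \<phi> \<le> \<eta> * \<phi>"
  using \<phi>_le1 \<phi>_pos \<eta>_pos by (simp add: mult_left_le)

lemma pS2_le: "p * S2 \<le> 1 + \<phi> + 2 * \<eta> * \<phi>"
proof -
  have "p * S2 \<le> p * ((1 + \<eta> * \<phi>) * l)" using S2_le p_pos by (intro mult_left_mono) auto
  also have "\<dots> = (p * l) * (1 + \<eta> * \<phi>)" by simp
  also have "\<dots> = 1 + \<phi> + \<eta> * \<phi> + \<eta> * \<phi> * \<phi>" by (simp add: pl algebra_simps)
  finally show ?thesis using \<eta>\<phi>2 by simp
qed

lemma pS2_le4: "p * S2 \<le> 4"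
  using pS2_le \<phi>_le1 mult_mono[OF \<eta>_le \<phi>_le1] \<phi>_pos by simp

lemma pS3_le: "p * S3 \<le> C + \<eta> * (C + 2)"
proof -
  have "p * S3 \<le> p * ((C + \<eta>) * l)" using S3_le p_pos by (intro mult_left_mono) auto
  also have "\<dots> = (p * l) * (C + \<eta>)" by simp
  also have "\<dots> = C + \<eta> + \<phi> * (C + \<eta>)" by (simp add: pl algebra_simps)
  also have "\<phi> * (C + \<eta>) \<le> \<eta> * (C + 1)" using \<phi>_le \<eta>_le C_pos \<phi>_pos \<eta>_pos by (intro mult_mono) auto
  finally show ?thesis by (simp add: algebra_simps)
qed

lemma pS3_le2: "p * S3 \<le> 2 * (C + 1)"
proof -
  have "C + \<eta> * (C + 2) \<le> C + 1 * (C + 2)" using \<eta>_le C_pos by (intro add_left_mono mult_right_mono) auto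
  with pS3_le show ?thesis by (rule order_trans[OF order_trans]) simp
qed

lemma hi_w: "i \<in> hi \<Longrightarrow> \<eta> \<le> \<phi> * w i" by (simp add: hi_def)

lemma H3_le: "H3 \<le> \<eta> ^ 3 * l" using high by (simp add: H3_def hi_def l_def)

lemma H3_le': "H3 \<le> \<eta> * l"
proof -
  have "\<eta> ^ 3 \<le> \<eta>" using power_decreasing[of 1 3 \<eta>] \<eta>_le \<eta>_pos by simp
  then have "\<eta> ^ 3 * l \<le> \<eta> * l" using l_pos by (intro mult_right_mono) auto
  then show ?thesis using H3_le by linarith
qed

text \<open>On heavy vertices 1 is at most \<open>\<phi> * w i / \<eta>\<close>, so each power of
  the weight that is given up costs a factor \<open>\<phi> / \<eta>\<close>. The cube of \<eta> in
  the bound for \<open>H3\<close> pays for one such factor here and for two in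
  \<open>H1_le\<close>.\<close>

lemma H2_le: "H2 \<le> \<eta> * \<phi> * l"
proof -
  have "\<eta> * H2 \<le> \<phi> * H3"
    unfolding H2_def H3_def sum_distrib_left
  proof (rule sum_mono)
    fix i assume i: "i \<in> hi"
    have "\<eta> * (w i)\<^sup>2 \<le> (\<phi> * w i) * (w i)\<^sup>2" using hi_w[OF i] by (intro mult_right_mono) auto
    then show "\<eta> * (w i)\<^sup>2 \<le> \<phi> * w i ^ 3" by (simp add: power2_eq_square power3_eq_cube)
  qed
  also have "\<dots> \<le> \<phi> * (\<eta> ^ 3 * l)" using H3_le \<phi>_pos by (intro mult_left_mono) auto
  also have "\<dots> = \<eta> * (\<eta> * (\<eta> * \<phi> * l))" by (simp add: power3_eq_cube)
  finally have "H2 \<le> \<eta> * (\<eta> * \<phi> * l)" using \<eta>_pos by (simp only: mult_le_cancel_left_pos)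
  also have "\<dots> \<le> 1 * (\<eta> * \<phi> * l)" using \<eta>_le \<eta>_pos \<phi>_pos l_pos by (intro mult_right_mono) auto
  finally show ?thesis by simp
qed

lemma H1_le: "H1 \<le> \<eta> * \<phi> * L"
proof -
  have "\<eta>\<^sup>2 * H1 \<le> \<phi>\<^sup>2 * H3"
    unfolding H1_def H3_def sum_distrib_left
  proof (rule sum_mono)
    fix i assume i: "i \<in> hi"
    have "0 \<le> w i" using i w_nonneg low_hi by auto
    moreover have "\<eta>\<^sup>2 \<le> (\<phi> * w i)\<^sup>2" using hi_w[OF i] \<eta>_pos by (intro power_mono) auto
    ultimately have "\<eta>\<^sup>2 * w i \<le> (\<phi> * w i)\<^sup>2 * w i" by (intro mult_right_mono) auto
    then show "\<eta>\<^sup>2 * w i \<le> \<phi>\<^sup>2 * w i ^ 3" by (simp add: power2_eq_square power3_eq_cube mult_ac)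
  qed
  also have "\<dots> \<le> \<phi>\<^sup>2 * (\<eta> ^ 3 * l)" using H3_le by (intro mult_left_mono) auto
  also have "\<dots> = \<eta>\<^sup>2 * (\<eta> * \<phi> * L)" by (simp add: power3_eq_cube power2_eq_square L_def)
  finally show ?thesis using \<eta>_pos by (simp only: mult_le_cancel_left_pos zero_less_power)
qed

lemma y_eq: "y i = p * x * (1 + w i)"
  by (rule fun_cong[OF y_def])

text \<open>The part \<open>p * x * w i\<close> of the colouring rate acts as additional infected
  weight x, so the effective pressure is \<open>x + t\<close>. The remaining part
  \<open>p * x\<close> is the same for all vertices.\<close>

lemma hit_le: "hit_prob t i \<le> p * x + p * w i * (x + t)"
proof -
  have "hit_prob t i \<le> y i + p * w i * t"
    unfolding hit_prob_def by (rule one_minus_exp_le)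
  then show ?thesis unfolding y_eq by (simp add: algebra_simps)
qed

lemma hit_nonneg: "0 \<le> t \<Longrightarrow> i \<in> V \<Longrightarrow> 0 \<le> hit_prob t i"
proof -
  assume "0 \<le> t" "i \<in> V"
  then have "0 \<le> y i + p * w i * t"
    using y_nonneg[of i] w_nonneg[of i] p_pos by (intro add_nonneg_nonneg mult_nonneg_nonneg) auto
  then show ?thesis by (simp only: hit_prob_def diff_ge_0_iff_ge exp_le_one_iff neg_le_0_iff_le)
qed

lemma sum_w2_hit:
  assumes t: "0 \<le> t"
  shows "(\<Sum>i\<in>V. (w i)\<^sup>2 * hit_prob t i) \<le> 4 * x + p * S3 * (x + t)"
proof -
  have "(\<Sum>i\<in>V. (w i)\<^sup>2 * hit_prob t i) \<le> (\<Sum>i\<in>V. (w i)\<^sup>2 * (p * x + p * w i * (x + t)))"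
    using hit_le by (intro sum_mono mult_left_mono) auto
  also have "\<dots> = p * S2 * x + p * S3 * (x + t)"
    by (simp add: S2_def S3_def sum_distrib_left sum_distrib_right sum.distrib power2_eq_square power3_eq_cube algebra_simps)
  also have "p * S2 * x \<le> 4 * x" using pS2_le4 x0 by (intro mult_right_mono)
  finally show ?thesis by simp
qed

lemma eta_C_small: "16 * \<eta> / C \<le> 1" "2 * \<eta> \<le> C"
proof -
  show *: "16 * \<eta> / C \<le> 1" using h1 e_le \<eta>_pos by linarith
  then show "2 * \<eta> \<le> C" using C_pos \<eta>_pos by (simp add: field_simps)
qed

lemma low_rate:
  assumes i: "i \<in> low" and t: "0 \<le> t" "t \<le> 3 * L / C"
  shows "0 \<le> p * w i * t" "p * w i * t \<le> 6 * \<eta> / C"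
proof -
  have w: "0 \<le> w i" "\<phi> * w i \<le> \<eta>" using i w_nonneg low_hi by (auto simp: low_def)
  show "0 \<le> p * w i * t" using w p_pos t by simp
  have "p * w i * t \<le> p * w i * (3 * L / C)" using w p_pos t by (intro mult_left_mono) auto
  also have "\<dots> = 3 / C * (p * L * w i)" by simp
  also have "p * L * w i = (1 + \<phi>) * (\<phi> * w i)" by (simp add: pL)
  also have "3 / C * ((1 + \<phi>) * (\<phi> * w i)) \<le> 3 / C * (2 * \<eta>)"
    using w \<phi>_le1 \<phi>_pos C_pos by (intro mult_left_mono mult_mono) auto
  finally show "p * w i * t \<le> 6 * \<eta> / C" by simp
qed

lemma S3_low_ge: "(C - 2 * \<eta>) * l \<le> S3 - H3"
  using S3_ge H3_le' by (simp add: algebra_simps)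

lemma p2S3_low_ge: "(C - 2 * \<eta>) / l \<le> p\<^sup>2 * (S3 - H3)"
proof -
  have "(C - 2 * \<eta>) / l \<le> (1 + \<phi>)\<^sup>2 * ((C - 2 * \<eta>) / l)"
    using \<phi>_pos eta_C_small(2) l_pos mult_right_mono[of 1 "(1 + \<phi>)\<^sup>2" "(C - 2 * \<eta>) / l"]
    by (simp add: one_le_power)
  also have "\<dots> = p\<^sup>2 * ((C - 2 * \<eta>) * l)"
    using l_pos by (simp add: p_def l_def[symmetric] power2_eq_square)
  also have "\<dots> \<le> p\<^sup>2 * (S3 - H3)" using S3_low_ge by (intro mult_left_mono) auto
  finally show ?thesis .
qed

text \<open>Up to errors the expected infected weight under pressure \<open>t\<close> is
  \<open>t + \<phi> * t - C * t\<^sup>2 / (2 * l)\<close>. It falls back to \<open>t\<close> at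
  \<open>t = 2 * L / C\<close>, which is where the giant is located. The expansion is confined to
  light vertices because \<open>p * w i * t\<close> must be uniformly small.\<close>

lemma mean_low_weight:
  assumes t: "0 \<le> t" "t \<le> 3 * L / C"
  shows "(\<Sum>i\<in>low. w i * hit_prob t i) \<le>
    6 * x + t * (1 + \<phi> + 2 * \<eta> * \<phi>) - (1 - 6 * \<eta> / C) * (C - 2 * \<eta>) * (t\<^sup>2 / (2 * l))"
proof -
  let ?a = "1 - 6 * \<eta> / C"
  have a: "0 \<le> ?a" using eta_C_small(1) \<eta>_pos C_pos by (simp add: field_simps)
  have "(\<Sum>i\<in>low. w i * hit_prob t i) \<le>
      (\<Sum>i\<in>low. p * x * (w i + (w i)\<^sup>2) + p * t * (w i)\<^sup>2 - ?a * (p\<^sup>2 * t\<^sup>2 / 2) * w i ^ 3)"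
  proof (rule sum_mono)
    fix i assume i: "i \<in> low"
    then have w: "0 \<le> w i" "0 \<le> y i" using w_nonneg y_nonneg low_hi by auto
    define z where "z = p * w i * t"
    have z: "0 \<le> z" "z \<le> 6 * \<eta> / C" using low_rate[OF i t] by (auto simp: z_def)
    \<comment> \<open>A vertex is infected by the pressure or, failing that, by its colour. The
      second alternative costs at most \<open>y i\<close>, so only the pressure needs an expansion
      to second order.\<close>
    have "exp (- z) * (1 - exp (- y i)) \<le> 1 * y i"
      using exp_ge_add_one_self[of "- y i"] z w by (intro mult_mono) auto
    moreover have "hit_prob t i = 1 - exp (- z) + exp (- z) * (1 - exp (- y i))"
      by (simp add: hit_prob_def z_def exp_add[symmetric] algebra_simps)
    moreover have "1 - exp (- z) \<le> z - z\<^sup>2 / 2 + z ^ 3 / 6"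
      using exp_minus_ge_cubic[OF z(1)] by simp
    moreover have "z ^ 3 / 6 \<le> z\<^sup>2 / 2 * (6 * \<eta> / C)"
    proof -
      have "z ^ 3 / 6 = z\<^sup>2 / 2 * (z / 3)" by (simp add: power2_eq_square power3_eq_cube)
      also have "\<dots> \<le> z\<^sup>2 / 2 * (6 * \<eta> / C)" using z by (intro mult_left_mono) auto
      finally show ?thesis .
    qed
    moreover have "?a * (z\<^sup>2 / 2) = z\<^sup>2 / 2 - z\<^sup>2 / 2 * (6 * \<eta> / C)"
      by (simp add: algebra_simps)
    ultimately have "hit_prob t i \<le> y i + z - ?a * (z\<^sup>2 / 2)" by linarith
    then have "w i * hit_prob t i \<le> w i * (y i + z - ?a * (z\<^sup>2 / 2))" using w by (intro mult_left_mono)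
    also have "\<dots> = p * x * (w i + (w i)\<^sup>2) + p * t * (w i)\<^sup>2 - ?a * (p\<^sup>2 * t\<^sup>2 / 2) * w i ^ 3"
      unfolding y_eq z_def by (simp add: power2_eq_square power3_eq_cube algebra_simps)
    finally show "w i * hit_prob t i \<le> p * x * (w i + (w i)\<^sup>2) + p * t * (w i)\<^sup>2 - ?a * (p\<^sup>2 * t\<^sup>2 / 2) * w i ^ 3" .
  qed
  also have "\<dots> = p * x * (\<Sum>i\<in>low. w i + (w i)\<^sup>2) + p * t * (\<Sum>i\<in>low. (w i)\<^sup>2) - ?a * (p\<^sup>2 * t\<^sup>2 / 2) * (\<Sum>i\<in>low. w i ^ 3)"
    by (simp only: sum_subtractf sum.distrib sum_distrib_left[symmetric])
  also have "(\<Sum>i\<in>low. w i ^ 3) = S3 - H3" by (simp add: sum_low S3_def H3_def)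
  also have "p * x * (\<Sum>i\<in>low. w i + (w i)\<^sup>2) \<le> 6 * x"
  proof -
    have "(\<Sum>i\<in>low. w i + (w i)\<^sup>2) \<le> (\<Sum>i\<in>V. w i + (w i)\<^sup>2)"
      using fin low_hi w_nonneg by (intro sum_mono2) auto
    also have "\<dots> = l + S2" by (simp add: l_def S2_def sum.distrib)
    finally have "p * x * (\<Sum>i\<in>low. w i + (w i)\<^sup>2) \<le> p * x * (l + S2)"
      using p_pos x0 by (intro mult_left_mono) auto
    also have "\<dots> = (p * l + p * S2) * x" by (simp add: algebra_simps)
    also have "\<dots> \<le> 6 * x" using pS2_le4 pl \<phi>_le1 x0 by (intro mult_right_mono) auto
    finally show ?thesis .
  qed
  also have "p * t * (\<Sum>i\<in>low. (w i)\<^sup>2) \<le> t * (1 + \<phi> + 2 * \<eta> * \<phi>)"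
  proof -
    have "p * t * (\<Sum>i\<in>low. (w i)\<^sup>2) \<le> p * t * S2"
      unfolding S2_def using fin low_hi p_pos t by (intro mult_left_mono sum_mono2) auto
    also have "\<dots> = t * (p * S2)" by simp
    also have "\<dots> \<le> t * (1 + \<phi> + 2 * \<eta> * \<phi>)" using pS2_le t by (intro mult_left_mono) auto
    finally show ?thesis .
  qed
  finally have "(\<Sum>i\<in>low. w i * hit_prob t i) \<le>
      6 * x + t * (1 + \<phi> + 2 * \<eta> * \<phi>) - ?a * (p\<^sup>2 * t\<^sup>2 / 2) * (S3 - H3)" by simp
  moreover have "?a * (C - 2 * \<eta>) * (t\<^sup>2 / (2 * l)) \<le> ?a * (p\<^sup>2 * t\<^sup>2 / 2) * (S3 - H3)"
  proof -
    have "?a * (C - 2 * \<eta>) * (t\<^sup>2 / (2 * l)) = ?a * (t\<^sup>2 / 2) * ((C - 2 * \<eta>) / l)" by simp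
    also have "\<dots> \<le> ?a * (t\<^sup>2 / 2) * (p\<^sup>2 * (S3 - H3))"
      using p2S3_low_ge a by (intro mult_left_mono) auto
    finally show ?thesis by (simp add: mult_ac)
  qed
  ultimately show ?thesis by linarith
qed

text \<open>Just beyond the zero of the drift the mean infected weight falls short of
  \<open>t\<close> by at least \<open>3/8 * e * \<phi> * t\<close>, apart from \<open>6 * x\<close>.
  With \<theta> of order \<phi> this shortfall gives an exponent of order
  \<open>e\<^sup>2 * \<phi>\<^sup>2 * L = e\<^sup>2 * f ^ 3\<close>. Heavy vertices, for which
  \<open>\<theta> * w i\<close> need not be small, are conceded in full through
  \<open>H1\<close>.\<close>

lemma pr_weight_large: "pr {A\<in>Pow V. (2 + e) * L / C < wt A} \<le> exp (- 2 * f)"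
proof -
  define t where "t = (2 + e) * L / C"
  define a where "a = \<eta> / C"
  have t0: "0 \<le> t" "t \<le> 3 * L / C" "2 * L / C \<le> t" "x \<le> t"
  proof -
    show "0 \<le> t" using e_pos L_pos C_pos by (simp add: t_def)
    show "t \<le> 3 * L / C" unfolding t_def using e_le L_pos C_pos
      by (intro divide_right_mono mult_right_mono) auto
    show t2: "2 * L / C \<le> t" unfolding t_def using e_pos L_pos C_pos
      by (intro divide_right_mono mult_right_mono) auto
    have "L / C \<le> 2 * L / C" using L_pos C_pos by (intro divide_right_mono) auto
    then show "x \<le> t" using x_le_L t2 by linarith
  qed
  have mean: "(\<Sum>i\<in>low. w i * hit_prob t i) \<le> 6 * x + t - 3 * e / 8 * \<phi> * t"
  proof -
    have "0 \<le> a" "16 * a \<le> 1" using eta_C_small \<eta>_pos C_pos by (simp_all add: a_def)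
    have "(1 - 6 * \<eta> / C) * (C - 2 * \<eta>) * (t\<^sup>2 / (2 * l)) =
        (1 - 6 * a) * (1 - 2 * a) * ((1 + e / 2) * \<phi> * t)"
      using C_pos l_pos by (simp add: a_def t_def L_def power2_eq_square field_simps)
    moreover have "(1 + e / 2 - 16 * a) * (\<phi> * t) \<le> (1 - 6 * a) * (1 - 2 * a) * ((1 + e / 2) * \<phi> * t)"
    proof -
      have "e * a \<le> 1 * a" using e_le \<open>0 \<le> a\<close> by (intro mult_right_mono) auto
      then have "1 + e / 2 - 16 * a \<le> (1 - 8 * a) * (1 + e / 2)"
        using \<open>0 \<le> a\<close> by (simp add: algebra_simps)
      also have "\<dots> \<le> (1 - 6 * a) * (1 - 2 * a) * (1 + e / 2)"
        using e_pos \<open>0 \<le> a\<close> by (intro mult_right_mono) (auto simp: algebra_simps)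
      finally have "(1 + e / 2 - 16 * a) * (\<phi> * t) \<le> (1 - 6 * a) * (1 - 2 * a) * (1 + e / 2) * (\<phi> * t)"
        using \<phi>_pos t0 by (intro mult_right_mono) auto
      then show ?thesis by (simp add: mult_ac)
    qed
    ultimately have "(\<Sum>i\<in>low. w i * hit_prob t i) \<le>
        6 * x + t * (1 + \<phi> + 2 * \<eta> * \<phi>) - (1 + e / 2 - 16 * a) * (\<phi> * t)"
      using mean_low_weight[OF t0(1,2)] by linarith
    also have "\<dots> = 6 * x + t + (2 * \<eta> + 16 * a - e / 2) * (\<phi> * t)" by (simp add: algebra_simps)
    also have "(2 * \<eta> + 16 * a - e / 2) * (\<phi> * t) \<le> (- (3 * e / 8)) * (\<phi> * t)"
      using h1 \<phi>_pos t0 by (intro mult_right_mono) (auto simp: a_def)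
    finally show ?thesis by (simp add: mult_ac)
  qed
  \<comment> \<open>Since \<open>(4 * C + 8) * t\<close> bounds the sum of squared weights, this
    choice makes the second-order term exactly \<open>e / 8 * \<phi> * t\<close>, a third of the
    available shortfall.\<close>
  define \<theta> where "\<theta> = e * \<phi> / (8 * (4 * C + 8))"
  have \<theta>: "0 < \<theta>" using e_pos \<phi>_pos C_pos by (simp add: \<theta>_def)
  have \<theta>_le: "\<theta> \<le> \<phi>"
    using e_le \<phi>_pos C_pos mult_mono[of e 1 \<phi> "\<phi> * (8 * (4 * C + 8))"] e_pos by (simp add: \<theta>_def divide_le_eq)
  have \<theta>w: "0 \<le> \<theta> * w i" "\<theta> * w i \<le> 1" if "i \<in> low" for i
  proof -
    have w: "0 \<le> w i" "\<phi> * w i \<le> \<eta>" using that w_nonneg by (auto simp: low_def)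
    then show "0 \<le> \<theta> * w i" using \<theta> by simp
    show "\<theta> * w i \<le> 1" using mult_right_mono[OF \<theta>_le w(1)] w(2) \<eta>_le by linarith
  qed
  let ?z = "\<lambda>i. if i \<in> low then \<theta> * w i else 0"
  have "pr {A\<in>Pow V. t < wt A} \<le> exp (- (\<theta> * (t - H1)) + (\<Sum>i\<in>V. hit_prob t i * (exp (?z i) - 1)))"
  proof (rule pr_weight_gt[OF t0(1)])
    fix D assume D: "D \<subseteq> V" "t < wt D"
    have fD: "finite D" using D fin finite_subset by blast
    have "wt D = (\<Sum>i\<in>D \<inter> low. w i) + (\<Sum>i\<in>D \<inter> hi. w i)"
      unfolding wt_def using D low_hi fD
      by (subst sum.union_disjoint[symmetric]) (auto intro!: sum.cong)
    moreover have "(\<Sum>i\<in>D \<inter> hi. w i) \<le> H1"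
      unfolding H1_def using low_hi w_nonneg by (intro sum_mono2) auto
    ultimately have "\<theta> * (t - H1) \<le> \<theta> * (\<Sum>i\<in>D \<inter> low. w i)"
      using D \<theta> by (intro mult_left_mono) auto
    also have "\<dots> = (\<Sum>i\<in>D. ?z i)"
      using fD by (auto simp: sum_distrib_left sum.inter_restrict intro!: sum.cong)
    finally show "\<theta> * (t - H1) \<le> (\<Sum>i\<in>D. ?z i)" .
  qed
  also have "(\<Sum>i\<in>V. hit_prob t i * (exp (?z i) - 1)) = (\<Sum>i\<in>low. hit_prob t i * (exp (\<theta> * w i) - 1))"
    using low_hi fin by (intro sum.mono_neutral_cong_right) auto
  also have "\<dots> \<le> (\<Sum>i\<in>low. hit_prob t i * (\<theta> * w i + (\<theta> * w i)\<^sup>2))"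
    using \<theta>w hit_nonneg[OF t0(1)] low_hi by (intro sum_mono mult_left_mono exp_le_quadratic) auto
  also have "\<dots> = \<theta> * (\<Sum>i\<in>low. w i * hit_prob t i) + \<theta>\<^sup>2 * (\<Sum>i\<in>low. (w i)\<^sup>2 * hit_prob t i)"
    by (simp add: sum_distrib_left sum.distrib[symmetric] power2_eq_square algebra_simps)
  also have "(\<Sum>i\<in>low. (w i)\<^sup>2 * hit_prob t i) \<le> (4 * C + 8) * t"
  proof -
    have "(\<Sum>i\<in>low. (w i)\<^sup>2 * hit_prob t i) \<le> (\<Sum>i\<in>V. (w i)\<^sup>2 * hit_prob t i)"
      using fin low_hi hit_nonneg[OF t0(1)] by (intro sum_mono2) auto
    also have "\<dots> \<le> 4 * x + p * S3 * (x + t)" by (rule sum_w2_hit[OF t0(1)])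
    also have "p * S3 * (x + t) \<le> 2 * (C + 1) * (2 * t)"
      using t0 x0 C_pos by (intro mult_mono[OF pS3_le2]) auto
    also have "4 * x + 2 * (C + 1) * (2 * t) \<le> (4 * C + 8) * t" using t0 by (simp add: algebra_simps)
    finally show ?thesis by simp
  qed
  also have "- (\<theta> * (t - H1)) + (\<theta> * (\<Sum>i\<in>low. w i * hit_prob t i) + \<theta>\<^sup>2 * ((4 * C + 8) * t)) \<le> - 2 * f"
  proof -
    have "- (\<theta> * (t - H1)) + (\<theta> * (\<Sum>i\<in>low. w i * hit_prob t i) + \<theta>\<^sup>2 * ((4 * C + 8) * t)) =
        \<theta> * (H1 - t + (\<Sum>i\<in>low. w i * hit_prob t i) + \<theta> * (4 * C + 8) * t)"
      by (simp add: power2_eq_square algebra_simps)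
    also have "\<dots> \<le> \<theta> * (- (e / 8 * \<phi> * (2 * L / C)))"
    proof (rule mult_left_mono)
      have "\<theta> * (4 * C + 8) * t = e / 8 * \<phi> * t"
      proof -
        obtain K where K: "4 * C + 8 = K" by blast
        then have "0 < K" using C_pos by simp
        then show ?thesis unfolding \<theta>_def K by simp
      qed
      moreover have "H1 + 6 * x \<le> e / 8 * \<phi> * t"
      proof -
        have "H1 + 6 * x \<le> (\<eta> + 6 * \<kappa>) * (\<phi> * L)" using H1_le x_le' by (simp add: algebra_simps)
        also have "\<dots> \<le> e / (4 * C) * (\<phi> * L)" using h2 \<phi>_pos L_pos by (intro mult_right_mono) auto
        also have "\<dots> = e / 8 * \<phi> * (2 * L / C)" by simp
        also have "\<dots> \<le> e / 8 * \<phi> * t" using t0(3) e_pos \<phi>_pos by (intro mult_left_mono) auto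
        finally show ?thesis .
      qed
      moreover have "e / 8 * \<phi> * (2 * L / C) \<le> e / 8 * \<phi> * t"
        using t0(3) e_pos \<phi>_pos by (intro mult_left_mono) auto
      ultimately show "H1 - t + (\<Sum>i\<in>low. w i * hit_prob t i) + \<theta> * (4 * C + 8) * t \<le> - (e / 8 * \<phi> * (2 * L / C))"
        using mean by linarith
    qed (use \<theta> in simp)
    also have "\<dots> = - (e\<^sup>2 * (\<phi>\<^sup>2 * L) / (32 * C * (4 * C + 8)))"
    proof -
      obtain K where K: "4 * C + 8 = K" by blast
      show ?thesis unfolding \<theta>_def K by (simp add: power2_eq_square mult_ac)
    qed
    also have "\<dots> = - (f * (e\<^sup>2 * f\<^sup>2 / (32 * C * (4 * C + 8))))"
      unfolding f3 by (simp add: power2_eq_square power3_eq_cube)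
    also have "\<dots> \<le> - (f * 2)"
    proof -
      have "2 \<le> e\<^sup>2 * f\<^sup>2 / (32 * C * (4 * C + 8))"
        using hf1 C_pos by (subst le_divide_eq) auto
      then show ?thesis using f_pos by (intro le_imp_neg_le mult_left_mono) auto
    qed
    finally show ?thesis by simp
  qed
  finally show ?thesis using \<theta> by (simp add: t_def mult_left_mono add_left_mono)
qed

text \<open>Under pressure \<open>t\<close> the squared weights sum to about
  \<open>p * S3 * t\<close>, that is \<open>C * t\<close>. The tolerated deviation is of order
  \<open>L\<close> rather than \<open>\<phi> * L\<close>, so a parameter of order
  \<open>f / L\<close> suffices, and the bound \<open>wmax\<close> keeps
  \<open>\<theta> * (w i)\<^sup>2\<close> small even for the heaviest vertices. The value
  \<open>R = 64 / e\<close> comes from \<open>\<theta> * (e / 32 * L) = 2 * f\<close>.\<close>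

lemma pr_quad:
  assumes t: "0 \<le> t" "t \<le> 3 * L / C"
  shows "pr {A\<in>Pow V. wt A \<le> t \<and> C * t + e / 16 * L \<le> (\<Sum>i\<in>A. (w i)\<^sup>2)} \<le> exp (- 2 * f)"
proof -
  define R where "R = 64 / e"
  define \<theta> where "\<theta> = R * f / L"
  have R: "0 < R" using e_pos by (simp add: R_def)
  have \<theta>: "0 < \<theta>" using R f_pos L_pos by (simp add: \<theta>_def)
  have z: "0 \<le> \<theta> * (w i)\<^sup>2" "\<theta> * (w i)\<^sup>2 \<le> R * \<eta>" if i: "i \<in> V" for i
  proof -
    show "0 \<le> \<theta> * (w i)\<^sup>2" using \<theta> by simp
    have "R * (f * (w i)\<^sup>2) \<le> R * (\<eta> * L)"
      using wmax[OF i] R by (intro mult_left_mono) (auto simp: L_def l_def)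
    then show "\<theta> * (w i)\<^sup>2 \<le> R * \<eta>"
      using L_pos by (simp add: \<theta>_def divide_le_eq mult_ac)
  qed
  have R\<eta>: "R * \<eta> \<le> 1" "0 \<le> R * \<eta>" using h3(2) R \<eta>_pos by (simp_all add: R_def)
  define Q where "Q = (\<Sum>i\<in>V. (w i)\<^sup>2 * hit_prob t i)"
  define g where "g = (C + 2) * 3 / C + (2 * C + 6) * \<kappa>"
  have g0: "0 \<le> g" using C_pos \<kappa> by (simp add: g_def)
  have Q_le: "Q \<le> C * t + \<eta> * g * L"
  proof -
    have "Q \<le> 4 * x + p * S3 * (x + t)" unfolding Q_def by (rule sum_w2_hit[OF t(1)])
    also have "p * S3 * (x + t) = p * S3 * x + p * S3 * t" by (simp add: algebra_simps)
    also have "p * S3 * x \<le> 2 * (C + 1) * x" using pS3_le2 x0 by (intro mult_right_mono) auto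
    also have "p * S3 * t \<le> (C + \<eta> * (C + 2)) * t" using pS3_le t by (intro mult_right_mono) auto
    finally have "Q \<le> C * t + \<eta> * (C + 2) * t + (2 * C + 6) * x" by (simp add: algebra_simps)
    also have "\<eta> * (C + 2) * t \<le> \<eta> * (C + 2) * (3 * L / C)"
      using t \<eta>_pos C_pos by (intro mult_left_mono) auto
    also have "(2 * C + 6) * x \<le> (2 * C + 6) * (\<kappa> * \<eta> * L)"
      using x_le_\<eta> C_pos by (intro mult_left_mono) auto
    finally show ?thesis by (simp add: g_def algebra_simps)
  qed
  have Ct: "C * t \<le> 3 * L" using t C_pos by (simp add: field_simps)
  have "pr {A\<in>Pow V. wt A \<le> t \<and> C * t + e / 16 * L \<le> (\<Sum>i\<in>A. (w i)\<^sup>2)} \<le>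
      pr {A\<in>Pow V. wt A \<le> t \<and> \<theta> * (C * t + e / 16 * L) \<le> (\<Sum>i\<in>A. \<theta> * (w i)\<^sup>2)}"
    using \<theta> by (intro pr_mono) (auto simp flip: sum_distrib_left)
  also have "\<dots> \<le> exp (- (\<theta> * (C * t + e / 16 * L)) + (\<Sum>i\<in>V. hit_prob t i * (exp (\<theta> * (w i)\<^sup>2) - 1)))"
    by (rule pr_upper[OF t(1)]) (use z in auto)
  also have "(\<Sum>i\<in>V. hit_prob t i * (exp (\<theta> * (w i)\<^sup>2) - 1)) \<le> (\<Sum>i\<in>V. hit_prob t i * ((1 + R * \<eta>) * (\<theta> * (w i)\<^sup>2)))"
  proof (intro sum_mono mult_left_mono)
    fix i assume i: "i \<in> V"
    have "exp (\<theta> * (w i)\<^sup>2) - 1 \<le> \<theta> * (w i)\<^sup>2 + (\<theta> * (w i)\<^sup>2)\<^sup>2"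
      using z[OF i] R\<eta> by (intro exp_le_quadratic) auto
    also have "(\<theta> * (w i)\<^sup>2)\<^sup>2 \<le> R * \<eta> * (\<theta> * (w i)\<^sup>2)"
      unfolding power2_eq_square[of "\<theta> * (w i)\<^sup>2"] using z[OF i] by (intro mult_right_mono)
    finally show "exp (\<theta> * (w i)\<^sup>2) - 1 \<le> (1 + R * \<eta>) * (\<theta> * (w i)\<^sup>2)" by (simp add: algebra_simps)
  qed (use hit_nonneg[OF t(1)] in auto)
  also have "\<dots> = \<theta> * ((1 + R * \<eta>) * Q)"
    by (simp add: Q_def sum_distrib_left mult_ac)
  also have "- (\<theta> * (C * t + e / 16 * L)) + \<theta> * ((1 + R * \<eta>) * Q) \<le> - 2 * f"
  proof -
    have "(1 + R * \<eta>) * Q \<le> (1 + R * \<eta>) * (C * t + \<eta> * g * L)"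
      using Q_le R\<eta> by (intro mult_left_mono) auto
    also have "\<dots> = C * t + R * \<eta> * (C * t) + (1 + R * \<eta>) * (\<eta> * g * L)" by (simp add: algebra_simps)
    also have "R * \<eta> * (C * t) \<le> R * \<eta> * (3 * L)" using Ct R\<eta> by (intro mult_left_mono) auto
    also have "(1 + R * \<eta>) * (\<eta> * g * L) \<le> 2 * (\<eta> * g * L)"
      using R\<eta> g0 \<eta>_pos L_pos by (intro mult_right_mono) auto
    also have "C * t + R * \<eta> * (3 * L) + 2 * (\<eta> * g * L) = C * t + (2 * \<eta> * g + 192 / e * \<eta>) * L"
      by (simp add: R_def algebra_simps)
    also have "(2 * \<eta> * g + 192 / e * \<eta>) * L \<le> e / 32 * L"
      using h3(1) L_pos unfolding g_def by (intro mult_right_mono) auto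
    finally have "(1 + R * \<eta>) * Q \<le> C * t + e / 32 * L" by simp
    then have "\<theta> * ((1 + R * \<eta>) * Q) \<le> \<theta> * (C * t + e / 32 * L)" using \<theta> by (intro mult_left_mono) auto
    then have "- (\<theta> * (C * t + e / 16 * L)) + \<theta> * ((1 + R * \<eta>) * Q) \<le> - (\<theta> * (e / 32 * L))"
      by (simp add: algebra_simps)
    also have "\<theta> * (e / 32 * L) = 2 * f" using L_pos e_pos by (simp add: \<theta>_def R_def)
    finally show ?thesis by simp
  qed
  finally show ?thesis by simp
qed

lemma size_rate: "2 * f \<le> e / C / (4 * (3 / C + 1)) * (e / C) * L / 2"
proof -
  have "16 * (3 / C + 1) * f \<le> 16 * (3 / C + 1) * (\<eta> * L)"
    using f_le C_pos by (intro mult_left_mono) (auto simp: L_def l_def)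
  also have "\<dots> = 16 * (3 / C + 1) * \<eta> * L" by simp
  also have "\<dots> \<le> (e / C)\<^sup>2 * L" using h6 L_pos by (intro mult_right_mono) auto
  finally have *: "16 * (3 / C + 1) * f \<le> (e / C)\<^sup>2 * L" .
  obtain D where D: "D = 3 / C + 1" by blast
  have "0 < D" unfolding D using C_pos by (simp add: add_pos_pos)
  moreover have "2 * f * (8 * D) \<le> (e / C)\<^sup>2 * L" using *[folded D] by (simp add: mult_ac)
  ultimately have "2 * f \<le> (e / C)\<^sup>2 * L / (8 * D)" by (subst le_divide_eq) simp
  then show ?thesis unfolding D[symmetric] by (simp add: power2_eq_square mult_ac)
qed

lemma sum_hit_le:
  assumes t: "0 \<le> t" "t \<le> 3 * L / C"
  shows "(\<Sum>i\<in>V. hit_prob t i) \<le> t + e / (4 * C) * L"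
proof -
  have "(\<Sum>i\<in>V. hit_prob t i) \<le> (\<Sum>i\<in>V. p * x + p * w i * (x + t))"
    using hit_le by (intro sum_mono) auto
  also have "\<dots> = p * card V * x + p * l * (x + t)"
    by (simp add: sum.distrib l_def sum_distrib_left sum_distrib_right)
  also have "p * card V * x \<le> p * (N0 * l) * x"
    using cnt p_pos x0 by (intro mult_right_mono mult_left_mono) (auto simp: l_def)
  also have "p * (N0 * l) * x = N0 * (1 + \<phi>) * x" using pl by (simp add: mult_ac)
  also have "N0 * (1 + \<phi>) * x \<le> N0 * 2 * x"
    using N0 \<phi>_le1 x0 by (intro mult_right_mono mult_left_mono) auto
  also have "p * l * (x + t) = x + \<phi> * x + t + \<phi> * t" by (simp add: pl algebra_simps)
  also have "\<phi> * x \<le> 1 * x" using \<phi>_le1 x0 by (intro mult_right_mono)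
  also have "\<phi> * t \<le> \<eta> * (3 * L / C)" using \<phi>_le \<phi>_pos t by (intro mult_mono) auto
  finally have "(\<Sum>i\<in>V. hit_prob t i) \<le> t + (2 * (N0 + 1) * x + 3 * \<eta> / C * L)"
    by (simp add: algebra_simps)
  also have "2 * (N0 + 1) * x \<le> 2 * (N0 + 1) * (\<kappa> * \<eta> * L)"
    using x_le_\<eta> N0 by (intro mult_left_mono) auto
  also have "2 * (N0 + 1) * (\<kappa> * \<eta> * L) + 3 * \<eta> / C * L = (2 * (N0 + 1) * \<kappa> * \<eta> + 3 * \<eta> / C) * L"
    by (simp add: algebra_simps)
  also have "\<dots> \<le> e / (4 * C) * L" using h5 L_pos by (intro mult_right_mono) auto
  finally show ?thesis by simp
qed

lemma sum_hit_ge: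
  assumes t: "0 \<le> t" "t \<le> 3 * L / C"
  shows "t - e / (4 * C) * L \<le> (\<Sum>i\<in>V. hit_prob t i)"
proof -
  have "p * t \<le> p * (3 * L / C)" using t p_pos by (intro mult_left_mono) auto
  also have "\<dots> = 3 / C * (p * L)" by simp
  also have "\<dots> \<le> 3 / C * (\<eta> * 2)"
    unfolding pL using \<phi>_le \<phi>_le1 \<phi>_pos C_pos by (intro mult_left_mono mult_mono) auto
  finally have pt: "p * t \<le> 6 * \<eta> / C" by simp
  have "(p * S2) * (p * t) * t / 2 \<le> 4 * (6 * \<eta> / C) * (3 * L / C) / 2"
    using pS2_le4 pt t p_pos S2_nonneg C_pos \<eta>_pos L_pos by (intro divide_right_mono mult_mono) auto
  also have "\<dots> = 36 * \<eta> / C\<^sup>2 * L" by (simp add: power2_eq_square)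
  also have "\<dots> \<le> e / (4 * C) * L" using h7 L_pos by (intro mult_right_mono) auto
  finally have err: "(p * S2) * (p * t) * t / 2 \<le> e / (4 * C) * L" .
  have "t \<le> (p * l) * t" using pl \<phi>_pos t mult_right_mono[of 1 "p * l" t] by simp
  then have "t - e / (4 * C) * L \<le> (p * l) * t - (p * S2) * (p * t) * t / 2" using err by linarith
  also have "\<dots> = (\<Sum>i\<in>V. p * w i * t - (p * w i * t)\<^sup>2 / 2)"
    by (simp add: l_def S2_def sum_subtractf sum_distrib_left sum_distrib_right sum_divide_distrib power2_eq_square mult_ac)
  also have "\<dots> \<le> (\<Sum>i\<in>V. hit_prob t i)"
  proof (rule sum_mono)
    fix i assume i: "i \<in> V"
    have z: "0 \<le> p * w i * t" using i w_nonneg p_pos t by simp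
    have "exp (- (y i + p * w i * t)) \<le> exp (- (p * w i * t))" using y_nonneg[OF i] by simp
    then show "p * w i * t - (p * w i * t)\<^sup>2 / 2 \<le> hit_prob t i"
      using exp_minus_le_quadratic[OF z] unfolding hit_prob_def by linarith
  qed
  finally show ?thesis .
qed

text \<open>The expected number of infected vertices is \<open>p * l * t\<close> up to small
  multiples of \<open>L\<close>, and \<open>p * l = 1 + \<phi>\<close> is close to 1; so size and
  weight agree to leading order. As the tolerance \<open>e / C * L\<close> is of order
  \<open>L\<close>, a constant \<theta> suffices and the exponent is of order \<open>L\<close>, far
  above \<open>f\<close>.\<close>

lemma pr_size:
  assumes t: "0 \<le> t" "t \<le> 3 * L / C"
  shows "pr {A\<in>Pow V. wt A \<le> t \<and> t + e / C * L \<le> real (card A)} \<le> exp (- 2 * f)"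
    and "pr {A\<in>Pow V. t \<le> wt A \<and> real (card A) \<le> t - e / C * L} \<le> exp (- 2 * f)"
proof -
  define \<nu> where "\<nu> = e / C"
  \<comment> \<open>Chosen so that \<open>\<theta> * (3 / C + 1) = \<nu> / 4\<close>. The
    second-order term then uses at most a quarter of \<open>\<theta> * \<nu> * L\<close> and the
    error of the mean another quarter, which leaves the half estimated in
    \<open>size_rate\<close>.\<close>
  define \<theta> where "\<theta> = \<nu> / (4 * (3 / C + 1))"
  define m where "m = (\<Sum>i\<in>V. hit_prob t i)"
  have \<nu>: "0 < \<nu>" "\<nu> \<le> 1" using h6 e_pos C_pos by (simp_all add: \<nu>_def)
  have c1: "1 \<le> 3 / C + 1" using C_pos by simp
  have \<theta>: "0 < \<theta>" "\<theta> \<le> 1"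
  proof -
    obtain D where D: "3 / C + 1 = D" by blast
    show "0 < \<theta>" "\<theta> \<le> 1"
      using c1 \<nu> unfolding \<theta>_def D by (simp_all add: divide_le_eq)
  qed
  have m: "m \<le> t + \<nu> / 4 * L" "t - \<nu> / 4 * L \<le> m"
    using sum_hit_le[OF t] sum_hit_ge[OF t] by (simp_all add: m_def \<nu>_def mult.commute)
  have rate: "2 * f \<le> \<theta> * \<nu> * L / 2" using size_rate by (simp add: \<theta>_def \<nu>_def)
  have \<theta>2: "\<theta>\<^sup>2 * (t + \<nu> / 4 * L) \<le> \<theta> * \<nu> * L / 4"
  proof -
    have "t + \<nu> / 4 * L \<le> (3 / C + 1) * L"
    proof -
      have "\<nu> / 4 * L \<le> 1 * L" using \<nu> L_pos by (intro mult_right_mono) auto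
      then show ?thesis using t by (simp add: algebra_simps)
    qed
    then have "\<theta>\<^sup>2 * (t + \<nu> / 4 * L) \<le> \<theta>\<^sup>2 * ((3 / C + 1) * L)" by (intro mult_left_mono) auto
    also have "\<dots> = \<theta> * (\<theta> * (3 / C + 1)) * L" by (simp add: power2_eq_square)
    also have "\<theta> * (3 / C + 1) = \<nu> / 4"
    proof -
      obtain D where D: "3 / C + 1 = D" by blast
      show ?thesis using c1 unfolding \<theta>_def D by simp
    qed
    finally show ?thesis by simp
  qed
  have "pr {A\<in>Pow V. wt A \<le> t \<and> t + e / C * L \<le> real (card A)} \<le>
      pr {A\<in>Pow V. wt A \<le> t \<and> \<theta> * (t + \<nu> * L) \<le> (\<Sum>i\<in>A. \<theta>)}"
    using \<theta> by (intro pr_mono) (auto simp: \<nu>_def mult.commute)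
  also have "\<dots> \<le> exp (- (\<theta> * (t + \<nu> * L)) + (\<Sum>i\<in>V. hit_prob t i * (exp \<theta> - 1)))"
    by (rule pr_upper[OF t(1)]) (use \<theta> in auto)
  also have "(\<Sum>i\<in>V. hit_prob t i * (exp \<theta> - 1)) = (exp \<theta> - 1) * m"
    by (simp add: m_def sum_distrib_left mult.commute)
  also have "\<dots> \<le> (\<theta> + \<theta>\<^sup>2) * (t + \<nu> / 4 * L)"
    using exp_le_quadratic[of \<theta>] \<theta> m t \<nu> L_pos by (intro mult_mono) (auto simp: m_def intro!: sum_nonneg hit_nonneg)
  also have "- (\<theta> * (t + \<nu> * L)) + (\<theta> + \<theta>\<^sup>2) * (t + \<nu> / 4 * L) \<le> - 2 * f"
  proof -
    have "(\<theta> + \<theta>\<^sup>2) * (t + \<nu> / 4 * L) = \<theta> * t + \<theta> * \<nu> * L / 4 + \<theta>\<^sup>2 * (t + \<nu> / 4 * L)"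
      "\<theta> * (t + \<nu> * L) = \<theta> * t + \<theta> * \<nu> * L" by (simp_all add: algebra_simps)
    then show ?thesis using \<theta>2 rate by linarith
  qed
  finally show "pr {A\<in>Pow V. wt A \<le> t \<and> t + e / C * L \<le> real (card A)} \<le> exp (- 2 * f)" by simp
  have "pr {A\<in>Pow V. t \<le> wt A \<and> real (card A) \<le> t - e / C * L} \<le>
      pr {A\<in>Pow V. t \<le> wt A \<and> - \<theta> * (t - \<nu> * L) \<le> (\<Sum>i\<in>A. - \<theta>)}"
    using \<theta> by (intro pr_mono) (auto simp: \<nu>_def mult.commute)
  also have "\<dots> \<le> exp (- (- \<theta> * (t - \<nu> * L)) + (\<Sum>i\<in>V. hit_prob t i * (exp (- \<theta>) - 1)))"
    by (rule pr_lower[OF t(1)]) (use \<theta> in auto)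
  also have "(\<Sum>i\<in>V. hit_prob t i * (exp (- \<theta>) - 1)) = - ((1 - exp (- \<theta>)) * m)"
    by (simp add: m_def sum_distrib_left algebra_simps sum_subtractf)
  also have "- (- \<theta> * (t - \<nu> * L)) + - ((1 - exp (- \<theta>)) * m) \<le> - 2 * f"
  proof -
    have "(\<theta> - \<theta>\<^sup>2 / 2) * m \<le> (1 - exp (- \<theta>)) * m"
      using exp_minus_le_quadratic[of \<theta>] \<theta> t
      by (intro mult_right_mono) (auto simp: m_def intro!: sum_nonneg hit_nonneg)
    moreover have "\<theta>\<^sup>2 \<le> \<theta> * 1" unfolding power2_eq_square using \<theta> by (intro mult_left_mono) auto
    then have "(\<theta> - \<theta>\<^sup>2 / 2) * (t - \<nu> / 4 * L) \<le> (\<theta> - \<theta>\<^sup>2 / 2) * m"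
      using m \<theta> by (intro mult_left_mono) auto
    ultimately have *: "(\<theta> - \<theta>\<^sup>2 / 2) * (t - \<nu> / 4 * L) \<le> (1 - exp (- \<theta>)) * m" by linarith
    have "0 \<le> \<theta>\<^sup>2 * (\<nu> * L)" "0 \<le> \<theta>\<^sup>2 * (t + \<nu> / 4 * L)" using \<nu> L_pos t by simp_all
    moreover have "(\<theta> - \<theta>\<^sup>2 / 2) * (t - \<nu> / 4 * L) =
        \<theta> * t - \<theta> * \<nu> * L / 4 - \<theta>\<^sup>2 * (t + \<nu> / 4 * L) / 2 + \<theta>\<^sup>2 * (\<nu> * L) / 4"
      "- \<theta> * (t - \<nu> * L) = - (\<theta> * t) + \<theta> * \<nu> * L" by (simp_all add: field_simps)
    ultimately show ?thesis using * \<theta>2 rate by linarith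
  qed
  finally show "pr {A\<in>Pow V. t \<le> wt A \<and> real (card A) \<le> t - e / C * L} \<le> exp (- 2 * f)" by simp
qed

text \<open>With \<open>t\<close> the weight and \<open>Q\<close> the sum of squared weights of the final set, this is the drift of the
  exploration: it stays positive up to the positive root near \<open>t = 2 M\<close> of \<open>\<phi> t - C t\<^sup>2 / (2 l)\<close>.\<close>

lemma gap_exponent:
  assumes t: "0 \<le> t" "t \<le> (2 - e) * L / C" and Q: "Q \<le> C * t + e / 8 * L" "0 \<le> Q"
  shows "\<phi> * e / 8 * (t + x) + x \<le> p * (t + x) * (S2 - H2) + p\<^sup>2 * (t + x)\<^sup>2 / 2 * (S3 - H3)
      - 6 * (e * \<phi> / (96 * (C + 1))) * p * (t + x) * S3 - t - p * (t + x) * (1 + 6 * \<eta> / C) * Q"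
proof -
  define s where "s = t + x"
  define a where "a = \<eta> / C"
  define \<theta> where "\<theta> = e * \<phi> / (96 * (C + 1))"
  have a: "0 \<le> a" "16 * a \<le> 1" using eta_C_small \<eta>_pos C_pos by (simp_all add: a_def)
  have s: "0 \<le> s" "t \<le> s" "C * s \<le> 3 * L"
  proof -
    show "0 \<le> s" "t \<le> s" using t x0 by (simp_all add: s_def)
    have "s \<le> (2 - e) * L / C + L / C" using t x_le_L by (simp add: s_def)
    then have "C * s \<le> (2 - e) * L + L" using C_pos by (simp add: field_simps)
    also have "\<dots> \<le> 3 * L" using e_pos L_pos by (simp add: algebra_simps)
    finally show "C * s \<le> 3 * L" .
  qed
  have \<theta>: "0 < \<theta>" using e_pos \<phi>_pos C_pos by (simp add: \<theta>_def)
  have I1: "(1 + \<phi> - 4 * \<eta> * \<phi>) * s \<le> p * s * (S2 - H2)"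
  proof -
    have "1 + \<phi> - 4 * \<eta> * \<phi> \<le> (p * l) * (1 - 2 * \<eta> * \<phi>)"
      using \<eta>\<phi>2 unfolding pl by (simp add: algebra_simps)
    also have "\<dots> = p * ((1 - 2 * \<eta> * \<phi>) * l)" by simp
    also have "\<dots> \<le> p * (S2 - H2)"
      using S2_ge H2_le p_pos by (intro mult_left_mono) (auto simp: algebra_simps)
    finally have "(1 + \<phi> - 4 * \<eta> * \<phi>) * s \<le> p * (S2 - H2) * s" using s by (intro mult_right_mono)
    then show ?thesis by (simp add: mult_ac)
  qed
  have I2: "(C - 2 * \<eta>) / l * (s\<^sup>2 / 2) \<le> p\<^sup>2 * s\<^sup>2 / 2 * (S3 - H3)"
  proof -
    have "(C - 2 * \<eta>) / l * (s\<^sup>2 / 2) \<le> p\<^sup>2 * (S3 - H3) * (s\<^sup>2 / 2)"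
      using p2S3_low_ge by (intro mult_right_mono) auto
    then show ?thesis by (simp add: mult_ac)
  qed
  have I3: "6 * \<theta> * p * s * S3 \<le> e * \<phi> / 8 * s"
  proof -
    have "6 * \<theta> * p * s * S3 = (6 * \<theta> * s) * (p * S3)" by simp
    also have "\<dots> \<le> (6 * \<theta> * s) * (2 * (C + 1))"
      using pS3_le2 \<theta> s by (intro mult_left_mono) auto
    also have "\<dots> = e * \<phi> / 8 * s"
    proof -
      obtain K where K: "C + 1 = K" by blast
      then have "0 < K" using C_pos by simp
      then show ?thesis unfolding \<theta>_def K by simp
    qed
    finally show ?thesis .
  qed
  define \<mu> where "\<mu> = \<eta> + 12 * a"
  have I4: "p * s * (1 + 6 * \<eta> / C) * Q \<le> C * s\<^sup>2 / l + s * \<phi> * (e / 8 + 4 * \<mu>)"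
  proof -
    have "(1 + \<phi>) * (1 + 6 * a) \<le> (1 + \<eta>) * (1 + 6 * a)" using \<phi>_le a by (intro mult_right_mono) auto
    also have "\<dots> = 1 + \<eta> + 6 * a + 6 * (\<eta> * a)" by (simp add: algebra_simps)
    also have "\<eta> * a \<le> 1 * a" using \<eta>_le a by (intro mult_right_mono) auto
    finally have \<mu>: "(1 + \<phi>) * (1 + 6 * a) \<le> 1 + \<mu>" by (simp add: \<mu>_def)
    have \<mu>0: "0 \<le> \<mu>" using a \<eta>_pos by (simp add: \<mu>_def)
    have "C * t \<le> C * s" using s C_pos by (intro mult_left_mono) auto
    then have Qs: "Q \<le> C * s + e / 8 * L" using Q by linarith
    have "e / 8 * L \<le> 1 * L" using e_le L_pos by (intro mult_right_mono) auto
    then have "C * s + e / 8 * L \<le> 4 * L" using s by linarith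
    then have \<mu>Q: "\<mu> * (C * s + e / 8 * L) \<le> \<mu> * (4 * L)" using \<mu>0 by (intro mult_left_mono) auto
    have "p * s * (1 + 6 * \<eta> / C) * Q = s / l * ((1 + \<phi>) * (1 + 6 * a) * Q)"
      by (simp add: p_def l_def a_def)
    also have "\<dots> \<le> s / l * ((1 + \<mu>) * (C * s + e / 8 * L))"
      using \<mu> \<mu>0 Qs Q s l_pos by (intro mult_left_mono mult_mono) auto
    also have "\<dots> \<le> s / l * (C * s + e / 8 * L + \<mu> * (4 * L))"
    proof (rule mult_left_mono)
      show "(1 + \<mu>) * (C * s + e / 8 * L) \<le> C * s + e / 8 * L + \<mu> * (4 * L)"
        unfolding distrib_right[of 1 \<mu>] mult_1_left using \<mu>Q by linarith
    qed (use s l_pos in simp)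
    also have "\<dots> = C * s\<^sup>2 / l + s * \<phi> * (e / 8 + 4 * \<mu>)"
      using l_pos by (simp add: L_def power2_eq_square field_simps)
    finally show ?thesis .
  qed
  have I5: "(C + 2 * \<eta>) * (s / (2 * l)) \<le> \<phi> * (1 - e / 2 + 2 * a + (C + 2) * \<kappa> * \<eta> / 2)"
  proof -
    have "s \<le> (2 - e) * L / C + \<kappa> * \<eta> * L" using t x_le_\<eta> by (simp add: s_def)
    then have "s / (2 * l) \<le> ((2 - e) * L / C + \<kappa> * \<eta> * L) / (2 * l)"
      using l_pos by (intro divide_right_mono) auto
    also have "\<dots> = \<phi> * ((1 - e / 2) / C + \<kappa> * \<eta> / 2)" using l_pos C_pos by (simp add: L_def field_simps)
    finally have "(C + 2 * \<eta>) * (s / (2 * l)) \<le> (C + 2 * \<eta>) * (\<phi> * ((1 - e / 2) / C + \<kappa> * \<eta> / 2))"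
      using C_pos \<eta>_pos by (intro mult_left_mono) auto
    also have "\<dots> = \<phi> * ((1 - e / 2) * (1 + 2 * a) + (C + 2 * \<eta>) * (\<kappa> * \<eta> / 2))"
      using C_pos by (simp add: a_def field_simps)
    also have "\<dots> \<le> \<phi> * (1 - e / 2 + 2 * a + (C + 2) * (\<kappa> * \<eta> / 2))"
    proof (rule mult_left_mono[OF add_mono])
      show "(1 - e / 2) * (1 + 2 * a) \<le> 1 - e / 2 + 2 * a" using e_pos a by (simp add: algebra_simps)
      show "(C + 2 * \<eta>) * (\<kappa> * \<eta> / 2) \<le> (C + 2) * (\<kappa> * \<eta> / 2)"
        using \<eta>_le \<eta>_pos \<kappa> by (intro mult_right_mono) auto
    qed (use \<phi>_pos in simp)
    finally show ?thesis by (simp add: mult_ac)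
  qed
  have h4': "4 * \<eta> + 2 * a + (C + 2) * \<kappa> * \<eta> / 2 + 4 * \<mu> \<le> e / 8"
    using h4 by (simp add: a_def \<mu>_def)
  have I6: "(C + 2 * \<eta>) / l * (s\<^sup>2 / 2) \<le> s * (\<phi> * (1 - e / 2 + 2 * a + (C + 2) * \<kappa> * \<eta> / 2))"
  proof -
    have "(C + 2 * \<eta>) / l * (s\<^sup>2 / 2) = s * ((C + 2 * \<eta>) * (s / (2 * l)))" by (simp add: power2_eq_square mult_ac)
    also have "\<dots> \<le> s * (\<phi> * (1 - e / 2 + 2 * a + (C + 2) * \<kappa> * \<eta> / 2))"
      using I5 s by (intro mult_left_mono)
    finally show ?thesis .
  qed
  \<comment> \<open>Arranged so that \<open>C * s\<^sup>2 / l\<close> cancels against the loss in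
    \<open>I4\<close>. What remains is the parabola \<open>C * s\<^sup>2 / (2 * l)\<close> with its
    error, which \<open>I6\<close> keeps below \<open>\<phi> * s\<close> by a margin of order
    \<open>e\<close> because \<open>t\<close> is at most \<open>(2 - e) * L / C\<close>.\<close>
  have split: "(C - 2 * \<eta>) / l * (s\<^sup>2 / 2) = C * s\<^sup>2 / l - (C + 2 * \<eta>) / l * (s\<^sup>2 / 2)"
    by (simp add: diff_divide_distrib add_divide_distrib algebra_simps)
  define r where "r = (C + 2) * \<kappa> * \<eta> / 2"
  have "\<phi> * s * (4 * \<eta> + 2 * a + r + 4 * \<mu>) \<le> \<phi> * s * (e / 8)"
    using h4' \<phi>_pos s unfolding r_def by (intro mult_left_mono) auto
  moreover have "(1 + \<phi> - 4 * \<eta> * \<phi>) * s - e * \<phi> / 8 * s - s * (\<phi> * (1 - e / 2 + 2 * a + r)) - s * \<phi> * (e / 8 + 4 * \<mu>)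
      = s + \<phi> * s * (e / 4) - \<phi> * s * (4 * \<eta> + 2 * a + r + 4 * \<mu>)"
    by (simp add: algebra_simps)
  ultimately have "s + \<phi> * s * (e / 8) \<le> (1 + \<phi> - 4 * \<eta> * \<phi>) * s - e * \<phi> / 8 * s - s * (\<phi> * (1 - e / 2 + 2 * a + r)) - s * \<phi> * (e / 8 + 4 * \<mu>)"
    by linarith
  then have "s + \<phi> * s * (e / 8) - t \<le> p * s * (S2 - H2) + p\<^sup>2 * s\<^sup>2 / 2 * (S3 - H3) - 6 * \<theta> * p * s * S3 - t - p * s * (1 + 6 * \<eta> / C) * Q"
    using I1 I2 I3 I4 I6 split unfolding r_def by linarith
  moreover have "s + \<phi> * s * (e / 8) - t = \<phi> * e / 8 * s + x" by (simp add: s_def algebra_simps)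
  ultimately show ?thesis unfolding s_def[symmetric] \<theta>_def[symmetric] by simp
qed

text \<open>The martingale is taken with \<open>b i = \<theta> * w i\<close> on light vertices.
  Stopping inside the gap makes its logarithm at least \<theta> times the drift, and this is at
  least \<open>2 * f\<close> for either of two reasons: the weight is already of order
  \<open>L / C\<close>, or x is within a factor 2 of its largest value. The second alternative later
  excludes a tiny final set.\<close>

lemma pr_gap:
  "pr {A\<in>Pow V. wt A \<le> (2 - e) * L / C \<and> (\<Sum>i\<in>A. (w i)\<^sup>2) < C * wt A + e / 8 * L \<and>
      (L / (256 * C) \<le> wt A \<or> \<kappa> * \<phi> * L / 2 \<le> x)} \<le> exp (- 2 * f)"
proof -
  \<comment> \<open>The constant 96 balances the error \<open>6 * \<theta> * p * S3\<close>, at most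
    \<open>12 * (C + 1) * \<theta>\<close>, against an eighth of the gain
    \<open>e * \<phi>\<close>.\<close>
  define \<theta> where "\<theta> = e * \<phi> / (96 * (C + 1))"
  let ?b = "\<lambda>i. if i \<in> low then \<theta> * w i else 0"
  obtain K where K: "C + 1 = K" by blast
  then have K1: "1 < K" "0 < K" using C_pos by auto
  have \<theta>: "0 < \<theta>" using e_pos \<phi>_pos C_pos by (simp add: \<theta>_def)
  have \<theta>_le: "\<theta> \<le> \<phi> / 2"
  proof -
    have "(e * 2) * \<phi> \<le> (96 * K) * \<phi>" using e_le K1 \<phi>_pos by (intro mult_right_mono) auto
    then have "e * \<phi> \<le> \<phi> / 2 * (96 * K)" by (simp add: mult_ac)
    then show ?thesis unfolding \<theta>_def K using K1 by (subst pos_divide_le_eq) auto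
  qed
  have \<theta>w: "0 \<le> \<theta> * w i" "\<theta> * w i \<le> 1/2" if "i \<in> low" for i
  proof -
    have w: "0 \<le> w i" "\<phi> * w i \<le> \<eta>" using that w_nonneg by (auto simp: low_def)
    then show "0 \<le> \<theta> * w i" using \<theta> by simp
    show "\<theta> * w i \<le> 1/2" using mult_right_mono[OF \<theta>_le w(1)] w(2) \<eta>_le by simp
  qed
  show ?thesis
    unfolding mult_minus_left
  proof (rule pr_markov)
    show "0 \<le> ?b i" if "i \<in> V" for i using \<theta>w by simp
    fix A assume A: "A \<in> {A\<in>Pow V. wt A \<le> (2 - e) * L / C \<and> (\<Sum>i\<in>A. (w i)\<^sup>2) < C * wt A + e / 8 * L \<and>
      (L / (256 * C) \<le> wt A \<or> \<kappa> * \<phi> * L / 2 \<le> x)}"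
    then have AV: "A \<subseteq> V" by auto
    have fA: "finite A" using AV fin finite_subset by blast
    define s where "s = wt A + x"
    have t0: "0 \<le> wt A" using wt_nonneg[OF AV] .
    have s0: "0 \<le> s" using t0 x0 by (simp add: s_def)
    have s3: "s \<le> 3 * L / C"
    proof -
      have "s \<le> (2 - e) * L / C + L / C" using A x_le_L by (auto simp: s_def)
      also have "\<dots> = (3 - e) * L / C" by (simp add: add_divide_distrib[symmetric] algebra_simps)
      also have "\<dots> \<le> 3 * L / C" using e_pos L_pos C_pos by (intro divide_right_mono mult_right_mono) auto
      finally show ?thesis .
    qed
    let ?g = "\<lambda>i. ln (1 + \<theta> * w i * exp (p * w i * s))"
    have eta6: "6 * \<eta> / C \<le> 1" using eta_C_small(1) \<eta>_pos C_pos by (simp add: field_simps)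
    have pos: "0 < 1 + \<theta> * w i * exp (p * w i * s)" if "i \<in> low" for i
      using \<theta>w[OF that] by (simp add: add_pos_nonneg)
    have "(\<Sum>i\<in>low - A. ?g i) \<le> (\<Sum>i\<in>low - A. ln (1 + ?b i * exp (y i + p * w i * wt A)))"
    proof (rule sum_mono)
      fix i assume i: "i \<in> low - A"
      have "p * w i * s \<le> y i + p * w i * wt A"
        unfolding y_eq s_def using p_pos x0 by (simp add: algebra_simps)
      then have "\<theta> * w i * exp (p * w i * s) \<le> \<theta> * w i * exp (y i + p * w i * wt A)"
        using \<theta>w[of i] i by (intro mult_left_mono) auto
      then show "?g i \<le> ln (1 + ?b i * exp (y i + p * w i * wt A))"
        using pos[of i] i by (simp add: ln_mono)
    qed
    also have "\<dots> = (\<Sum>i\<in>V - A. ln (1 + ?b i * exp (y i + p * w i * wt A)))"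
      using fin low_hi by (intro sum.mono_neutral_left) auto
    finally have L1: "(\<Sum>i\<in>low - A. ?g i) \<le> (\<Sum>i\<in>V - A. ln (1 + ?b i * exp (y i + p * w i * wt A)))" .
    have L2: "(\<Sum>i\<in>V. ln (1 + ?b i)) = (\<Sum>i\<in>low. ln (1 + \<theta> * w i))"
      using fin low_hi by (intro sum.mono_neutral_cong_right) auto
    have L3: "(\<Sum>i\<in>low - A. ?g i) = (\<Sum>i\<in>low. ?g i) - (\<Sum>i\<in>low \<inter> A. ?g i)"
      using low_hi(3) sum.Int_Diff[of low ?g A] by simp
    \<comment> \<open>The martingale runs over \<open>V - A\<close> only. The vertices of A that are
      missing from it cost their weight and, to first order in the pressure, the sum of their
      squared weights; this is where the quadratic condition on A enters.\<close>
    have L4: "(\<Sum>i\<in>low \<inter> A. ?g i) \<le> \<theta> * (wt A + p * s * (1 + 6 * \<eta> / C) * (\<Sum>i\<in>A. (w i)\<^sup>2))"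
    proof -
      have "(\<Sum>i\<in>low \<inter> A. ?g i) \<le> (\<Sum>i\<in>low \<inter> A. \<theta> * w i + \<theta> * p * s * (1 + 6 * \<eta> / C) * (w i)\<^sup>2)"
      proof (rule sum_mono)
        fix i assume i: "i \<in> low \<inter> A"
        define z where "z = p * w i * s"
        have z: "0 \<le> z" "z \<le> 6 * \<eta> / C" using low_rate[of i s] i s0 s3 by (auto simp: z_def)
        have "?g i \<le> \<theta> * w i * exp z"
          using \<theta>w[of i] i unfolding z_def[symmetric] by (intro ln_add_one_self_le_self) auto
        also have "\<dots> \<le> \<theta> * w i * (1 + z * (1 + 6 * \<eta> / C))"
        proof (rule mult_left_mono)
          have "exp z \<le> 1 + z + z\<^sup>2" using exp_le_quadratic[of z] z eta6 by simp
          moreover have "z\<^sup>2 \<le> z * (6 * \<eta> / C)" unfolding power2_eq_square using z by (intro mult_left_mono)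
          moreover have "z * (1 + 6 * \<eta> / C) = z + z * (6 * \<eta> / C)" by (simp only: distrib_left mult_1_right)
          ultimately show "exp z \<le> 1 + z * (1 + 6 * \<eta> / C)" by linarith
        qed (use \<theta>w[of i] i in auto)
        also have "\<dots> = \<theta> * w i + \<theta> * p * s * (1 + 6 * \<eta> / C) * (w i)\<^sup>2"
          unfolding z_def by (simp only: distrib_left mult_1_right power2_eq_square mult_ac)
        finally show "?g i \<le> \<theta> * w i + \<theta> * p * s * (1 + 6 * \<eta> / C) * (w i)\<^sup>2" .
      qed
      also have "\<dots> \<le> (\<Sum>i\<in>A. \<theta> * w i + \<theta> * p * s * (1 + 6 * \<eta> / C) * (w i)\<^sup>2)"
        using fA AV \<theta> w_nonneg p_pos s0 \<eta>_pos C_pos by (intro sum_mono2) auto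
      also have "\<dots> = \<theta> * (wt A + p * s * (1 + 6 * \<eta> / C) * (\<Sum>i\<in>A. (w i)\<^sup>2))"
      proof -
        obtain q where q: "1 + 6 * \<eta> / C = q" by blast
        show ?thesis
          unfolding q by (simp only: wt_def sum.distrib sum_distrib_left[symmetric] distrib_left mult.assoc)
      qed
      finally show ?thesis .
    qed
    have L5: "\<theta> * (p * s * (S2 - H2) + p\<^sup>2 * s\<^sup>2 / 2 * (S3 - H3) - 6 * \<theta> * p * s * S3) \<le>
        (\<Sum>i\<in>low. ?g i) - (\<Sum>i\<in>low. ln (1 + \<theta> * w i))"
    proof -
      have "\<theta> * (p * s * (S2 - H2) + p\<^sup>2 * s\<^sup>2 / 2 * (S3 - H3) - 6 * \<theta> * p * s * S3) \<le>
          \<theta> * (p * s * (S2 - H2) + p\<^sup>2 * s\<^sup>2 / 2 * (S3 - H3) - 6 * \<theta> * p * s * (S3 - H3))"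
      proof (intro mult_left_mono diff_mono order.refl)
        have "0 \<le> H3" unfolding H3_def using low_hi w_nonneg by (intro sum_nonneg) auto
        then show "S3 - H3 \<le> S3" by simp
      qed (use \<theta> p_pos s0 in auto)
      also have "\<dots> = (\<Sum>i\<in>low. \<theta> * p * s * (w i)\<^sup>2 + \<theta> * (p\<^sup>2 * s\<^sup>2 / 2) * w i ^ 3 - 6 * \<theta>\<^sup>2 * p * s * w i ^ 3)"
        unfolding sum_subtractf sum.distrib sum_distrib_left[symmetric] sum_low[of "\<lambda>i. (w i)\<^sup>2"] sum_low[of "\<lambda>i. w i ^ 3"]
          S2_def[symmetric] S3_def[symmetric] H2_def[symmetric] H3_def[symmetric]
        by (simp add: algebra_simps power2_eq_square)
      also have "\<dots> \<le> (\<Sum>i\<in>low. ?g i - ln (1 + \<theta> * w i))"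
      proof (rule sum_mono)
        fix i assume i: "i \<in> low"
        define z where "z = p * w i * s"
        have z: "0 \<le> z" "z \<le> 1" using low_rate[OF i s0 s3] eta6 by (auto simp: z_def)
        have "\<theta> * w i * (z + z\<^sup>2 / 2) - 6 * (\<theta> * w i)\<^sup>2 * z \<le> ?g i - ln (1 + \<theta> * w i)"
          unfolding z_def[symmetric] by (rule ln_ratio_lower[OF \<theta>w[OF i] z])
        moreover have "\<theta> * w i * (z + z\<^sup>2 / 2) - 6 * (\<theta> * w i)\<^sup>2 * z =
            \<theta> * p * s * (w i)\<^sup>2 + \<theta> * (p\<^sup>2 * s\<^sup>2 / 2) * w i ^ 3 - 6 * \<theta>\<^sup>2 * p * s * w i ^ 3"
          unfolding z_def by (simp add: algebra_simps power2_eq_square power3_eq_cube)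
        ultimately show "\<theta> * p * s * (w i)\<^sup>2 + \<theta> * (p\<^sup>2 * s\<^sup>2 / 2) * w i ^ 3 - 6 * \<theta>\<^sup>2 * p * s * w i ^ 3 \<le>
            ?g i - ln (1 + \<theta> * w i)" by simp
      qed
      finally show ?thesis by (simp add: sum_subtractf)
    qed
    have "\<phi> * e / 8 * s + x \<le> p * s * (S2 - H2) + p\<^sup>2 * s\<^sup>2 / 2 * (S3 - H3)
        - 6 * \<theta> * p * s * S3 - wt A - p * s * (1 + 6 * \<eta> / C) * (\<Sum>i\<in>A. (w i)\<^sup>2)"
      unfolding s_def \<theta>_def by (rule gap_exponent[OF t0]) (use A in \<open>auto intro!: sum_nonneg\<close>)
    then have "\<theta> * (\<phi> * e / 8 * s + x) \<le> \<theta> * (p * s * (S2 - H2) + p\<^sup>2 * s\<^sup>2 / 2 * (S3 - H3)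
        - 6 * \<theta> * p * s * S3 - wt A - p * s * (1 + 6 * \<eta> / C) * (\<Sum>i\<in>A. (w i)\<^sup>2))"
      using \<theta> by (intro mult_left_mono) auto
    also have "\<dots> = \<theta> * (p * s * (S2 - H2) + p\<^sup>2 * s\<^sup>2 / 2 * (S3 - H3) - 6 * \<theta> * p * s * S3) -
        \<theta> * (wt A + p * s * (1 + 6 * \<eta> / C) * (\<Sum>i\<in>A. (w i)\<^sup>2))"
      by (simp only: right_diff_distrib distrib_left diff_diff_eq)
    also have "\<dots> \<le> (\<Sum>i\<in>V - A. ln (1 + ?b i * exp (y i + p * w i * wt A))) - (\<Sum>i\<in>V. ln (1 + ?b i))"
      using L1 L2 L3 L4 L5 by linarith
    finally have D: "\<theta> * (\<phi> * e / 8 * s + x) \<le>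
      (\<Sum>i\<in>V - A. ln (1 + ?b i * exp (y i + p * w i * wt A))) - (\<Sum>i\<in>V. ln (1 + ?b i))" .
    have "2 * f \<le> \<theta> * (\<phi> * e / 8 * s + x)"
    proof (cases "L / (256 * C) \<le> wt A")
      case True
      have "2 * f = f * 2" by simp
      also have "\<dots> \<le> f * (e\<^sup>2 * f\<^sup>2 / (196608 * C * K))"
        using hf2 f_pos C_pos K1 unfolding K by (intro mult_left_mono) (auto simp: le_divide_eq)
      also have "\<dots> = e\<^sup>2 * f ^ 3 / (196608 * C * K)" by (simp add: power2_eq_square power3_eq_cube)
      also have "\<dots> = \<theta> * (\<phi> * e / 8 * (L / (256 * C)))"
        unfolding f3[symmetric] \<theta>_def K by (simp add: power2_eq_square mult_ac)
      also have "\<dots> \<le> \<theta> * (\<phi> * e / 8 * s + x)"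
      proof -
        have "\<phi> * e / 8 * (L / (256 * C)) \<le> \<phi> * e / 8 * s"
          using True x0 \<phi>_pos e_pos by (intro mult_left_mono) (auto simp: s_def)
        then show ?thesis using x0 \<theta> by (intro mult_left_mono) auto
      qed
      finally show ?thesis .
    next
      case False
      then have x: "\<kappa> * \<phi> * L / 2 \<le> x" using A by auto
      have "2 * f = f * 2" by simp
      also have "\<dots> \<le> f * (e * \<kappa> * f\<^sup>2 / (192 * K))"
        using hf3 f_pos K1 unfolding K by (intro mult_left_mono) (auto simp: le_divide_eq)
      also have "\<dots> = e * \<kappa> * f ^ 3 / (192 * K)" by (simp add: power2_eq_square power3_eq_cube)
      also have "\<dots> = \<theta> * (\<kappa> * \<phi> * L / 2)"
        unfolding f3[symmetric] \<theta>_def K by (simp add: power2_eq_square mult_ac)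
      also have "\<dots> \<le> \<theta> * (\<phi> * e / 8 * s + x)"
        using x s0 \<phi>_pos e_pos \<theta> by (intro mult_left_mono) (auto simp: add_increasing)
      finally show ?thesis .
    qed
    then have "2 * f \<le> (\<Sum>i\<in>V - A. ln (1 + ?b i * exp (y i + p * w i * wt A))) - (\<Sum>i\<in>V. ln (1 + ?b i))"
      using D by linarith
    then show "2 * f \<le> \<dots>" .
  qed auto
qed

definition "M = L / C"

definition good_set :: "'a set \<Rightarrow> bool" where
  "good_set A \<longleftrightarrow> real (card A) + wt A < M / 64 \<or>
    real (card A) \<in> {(2 - 2 * e) * M..(2 + 2 * e) * M} \<and> wt A \<in> {(2 - 2 * e) * M..(2 + 2 * e) * M}"

text \<open>\<open>pr_quad\<close> needs a deterministic \<open>t\<close>, whereas the weight of A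
  is random. Rounding it up to a multiple of \<open>e / 16 * L / C\<close> changes
  \<open>C * wt A\<close> by at most \<open>e / 16 * L\<close>, half of the slack, and leaves about
  \<open>32 / e\<close> values for a union bound.\<close>

lemma quad_grid:
  assumes A: "A \<subseteq> V" "wt A \<le> (2 - e) * L / C" and Q: "C * wt A + e / 8 * L \<le> (\<Sum>i\<in>A. (w i)\<^sup>2)"
  shows "\<exists>k\<le>nat \<lceil>32 / e\<rceil>. wt A \<le> real k * (e / 16 * L / C) \<and>
    C * (real k * (e / 16 * L / C)) + e / 16 * L \<le> (\<Sum>i\<in>A. (w i)\<^sup>2)"
proof -
  define d where "d = e / 16 * L / C"
  have d: "0 < d" using e_pos L_pos C_pos by (simp add: d_def)
  have Cd: "C * d = e / 16 * L" using C_pos by (simp add: d_def)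
  define k where "k = nat \<lceil>wt A / d\<rceil>"
  have q0: "0 \<le> wt A / d" using wt_nonneg[OF A(1)] d by simp
  have k: "wt A / d \<le> real k" "real k \<le> wt A / d + 1" using q0 by (simp_all add: k_def)
  have "wt A / d \<le> 32 / e"
  proof -
    have "wt A \<le> 2 * L / C" using A(2) e_pos L_pos C_pos
      by (elim order_trans) (intro divide_right_mono mult_right_mono, auto)
    also have "\<dots> = 32 / e * d" using e_pos by (simp add: d_def)
    finally show ?thesis using d by (simp add: divide_le_eq)
  qed
  then have "k \<le> nat \<lceil>32 / e\<rceil>" unfolding k_def by (intro nat_mono ceiling_mono)
  moreover have "wt A \<le> real k * d" using k(1) d by (simp add: divide_le_eq)
  moreover have "C * (real k * d) + e / 16 * L \<le> (\<Sum>i\<in>A. (w i)\<^sup>2)"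
  proof -
    have "real k * d \<le> (wt A / d + 1) * d" using k(2) d by (intro mult_right_mono) auto
    also have "\<dots> = wt A + d" using d by (simp add: distrib_right)
    finally have "C * (real k * d) \<le> C * (wt A + d)" using C_pos by (intro mult_left_mono) auto
    also have "\<dots> = C * wt A + e / 16 * L" by (simp add: distrib_left Cd)
    finally show ?thesis using Q by linarith
  qed
  ultimately show ?thesis unfolding d_def by blast
qed

lemma pr_gap_total:
  "pr {A\<in>Pow V. wt A \<le> (2 - e) * L / C \<and> (L / (256 * C) \<le> wt A \<or> \<kappa> * \<phi> * L / 2 \<le> x)}
    \<le> (real (nat \<lceil>32 / e\<rceil>) + 2) * exp (- 2 * f)" (is "pr ?S \<le> _")
proof -
  let ?K = "nat \<lceil>32 / e\<rceil>"
  let ?t = "\<lambda>k. real k * (e / 16 * L / C)"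
  let ?Q = "\<lambda>k. {A\<in>Pow V. wt A \<le> ?t k \<and> C * ?t k + e / 16 * L \<le> (\<Sum>i\<in>A. (w i)\<^sup>2)}"
  let ?G = "{A\<in>Pow V. wt A \<le> (2 - e) * L / C \<and> (\<Sum>i\<in>A. (w i)\<^sup>2) < C * wt A + e / 8 * L \<and>
      (L / (256 * C) \<le> wt A \<or> \<kappa> * \<phi> * L / 2 \<le> x)}"
  have "?S \<subseteq> (\<Union>k\<in>{..?K}. ?Q k) \<union> ?G"
  proof
    fix A assume A: "A \<in> ?S"
    show "A \<in> (\<Union>k\<in>{..?K}. ?Q k) \<union> ?G"
    proof (cases "(\<Sum>i\<in>A. (w i)\<^sup>2) < C * wt A + e / 8 * L")
      case False
      then show ?thesis using quad_grid[of A] A by (auto simp: not_less)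
    qed (use A in auto)
  qed
  then have "pr ?S \<le> pr ((\<Union>k\<in>{..?K}. ?Q k) \<union> ?G)" by (rule pr_mono)
  also have "\<dots> \<le> pr (\<Union>k\<in>{..?K}. ?Q k) + pr ?G" by (rule pr_Un)
  also have "pr ?G \<le> exp (- 2 * f)" by (rule pr_gap)
  also have "pr (\<Union>k\<in>{..?K}. ?Q k) \<le> (\<Sum>k\<in>{..?K}. pr (?Q k))" by (rule pr_UN) simp
  also have "\<dots> \<le> (\<Sum>k\<in>{..?K}. exp (- 2 * f))"
  proof (rule sum_mono)
    fix k assume "k \<in> {..?K}"
    then have "real k \<le> real (nat \<lceil>32 / e\<rceil>)" by simp
    also have "\<dots> \<le> 32 / e + 1" using e_pos ceiling_correct[of "32 / e"] by simp
    finally have "real k \<le> 32 / e + 1" .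
    then have "real k * (e / 16) \<le> (32 / e + 1) * (e / 16)" using e_pos by (intro mult_right_mono) auto
    also have "\<dots> \<le> 3" using e_pos e_le by (simp add: field_simps)
    finally have "real k * (e / 16) * (L / C) \<le> 3 * (L / C)" using L_pos C_pos by (intro mult_right_mono) auto
    then show "pr (?Q k) \<le> exp (- 2 * f)"
      by (intro pr_quad) (use e_pos L_pos C_pos in auto)
  qed
  also have "\<dots> = (real ?K + 1) * exp (- 2 * f)" by simp
  finally show ?thesis by (simp add: distrib_right)
qed

theorem pr_bad: "pr {A\<in>Pow V. \<not> good_set A} \<le> (real (nat \<lceil>32 / e\<rceil>) + 6) * exp (- 2 * f)"
proof -
  let ?lo = "(2 - e) * L / C" and ?up = "(2 + e) * L / C" and ?t1 = "L / (256 * C)"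
  let ?S1 = "{A\<in>Pow V. wt A \<le> ?lo \<and> (?t1 \<le> wt A \<or> \<kappa> * \<phi> * L / 2 \<le> x)}"
  let ?S2 = "{A\<in>Pow V. ?up < wt A}"
  let ?S3 = "{A\<in>Pow V. wt A \<le> ?t1 \<and> ?t1 + e / C * L \<le> real (card A)}"
  let ?S4 = "{A\<in>Pow V. wt A \<le> ?up \<and> ?up + e / C * L \<le> real (card A)}"
  let ?S5 = "{A\<in>Pow V. ?lo \<le> wt A \<and> real (card A) \<le> ?lo - e / C * L}"
  have M: "0 < M" using L_pos C_pos by (simp add: M_def)
  obtain E where E: "E = e * M" by blast
  \<comment> \<open>The bound 1/256 on \<open>e\<close> is used here: a final set of weight at most
    \<open>M / 256\<close> with fewer than \<open>M / 256 + E\<close> vertices has mass at most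
    \<open>3/256 * M\<close>, below the threshold \<open>M / 64\<close>.\<close>
  have eM: "0 \<le> E" "E \<le> 1/256 * M" unfolding E using M e_pos e_le by (auto intro!: mult_right_mono)
  have eqs: "?lo = 2 * M - E" "?up = 2 * M + E" "?t1 = M / 256" "e / C * L = E"
    "(2 - 2 * e) * M = 2 * M - 2 * E" "(2 + 2 * e) * M = 2 * M + 2 * E"
    by (simp_all add: E M_def diff_divide_distrib add_divide_distrib algebra_simps)
  have "{A\<in>Pow V. \<not> good_set A} \<subseteq> ?S1 \<union> (?S2 \<union> (?S3 \<union> (?S4 \<union> ?S5)))"
  proof
    fix A assume "A \<in> {A\<in>Pow V. \<not> good_set A}"
    then have A: "A \<in> Pow V" "\<not> good_set A" by auto
    then show "A \<in> ?S1 \<union> (?S2 \<union> (?S3 \<union> (?S4 \<union> ?S5)))"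
      using eM M unfolding eqs good_set_def by auto
  qed
  then have "pr {A\<in>Pow V. \<not> good_set A} \<le> pr (?S1 \<union> (?S2 \<union> (?S3 \<union> (?S4 \<union> ?S5))))" by (rule pr_mono)
  also have "\<dots> \<le> pr ?S1 + (pr ?S2 + (pr ?S3 + (pr ?S4 + pr ?S5)))"
    using pr_Un[of ?S1 "?S2 \<union> (?S3 \<union> (?S4 \<union> ?S5))"] pr_Un[of ?S2 "?S3 \<union> (?S4 \<union> ?S5)"]
      pr_Un[of ?S3 "?S4 \<union> ?S5"] pr_Un[of ?S4 ?S5] by linarith
  also have "pr ?S1 \<le> (real (nat \<lceil>32 / e\<rceil>) + 2) * exp (- 2 * f)" by (rule pr_gap_total)
  also have "pr ?S2 \<le> exp (- 2 * f)" by (rule pr_weight_large)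
  also have "pr ?S3 \<le> exp (- 2 * f)"
  proof (rule pr_size(1))
    show "0 \<le> ?t1" "?t1 \<le> 3 * L / C" using L_pos C_pos by (auto simp: divide_simps)
  qed
  also have "pr ?S4 \<le> exp (- 2 * f)"
  proof (rule pr_size(1))
    show "0 \<le> ?up" using L_pos C_pos e_pos by simp
    show "?up \<le> 3 * L / C" using L_pos C_pos e_le by (intro divide_right_mono mult_right_mono) auto
  qed
  also have "pr ?S5 \<le> exp (- 2 * f)"
  proof (rule pr_size(2))
    show "0 \<le> ?lo" using L_pos C_pos e_le by simp
    show "?lo \<le> 3 * L / C" using L_pos C_pos e_pos by (intro divide_right_mono mult_right_mono) auto
  qed
  finally show ?thesis by (simp add: algebra_simps)
qed

theorem pr_small:
  assumes "\<kappa> * \<phi> * L / 2 \<le> x"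
  shows "pr {A\<in>Pow V. real (card A) + wt A < M / 64} \<le> (real (nat \<lceil>32 / e\<rceil>) + 6) * exp (- 2 * f)"
proof -
  have M: "0 < M" using L_pos C_pos by (simp add: M_def)
  have eM: "e * M \<le> 1/256 * M" using M e_le by (intro mult_right_mono) auto
  have eq: "(2 - e) * L / C = (2 - e) * M" by (simp add: M_def)
  have "pr {A\<in>Pow V. real (card A) + wt A < M / 64} \<le>
      pr {A\<in>Pow V. wt A \<le> (2 - e) * L / C \<and> (L / (256 * C) \<le> wt A \<or> \<kappa> * \<phi> * L / 2 \<le> x)}"
  proof (rule pr_mono, safe)
    fix A assume A: "A \<subseteq> V" "real (card A) + wt A < M / 64"
    have "wt A < M / 64" using A(2) of_nat_0_le_iff[of "card A"] by linarith
    also have "M / 64 \<le> (2 - e) * M" using eM M unfolding left_diff_distrib by linarith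
    finally show "wt A \<le> (2 - e) * L / C" unfolding eq by simp
  qed (use assms in auto)
  also have "\<dots> \<le> (real (nat \<lceil>32 / e\<rceil>) + 2) * exp (- 2 * f)" by (rule pr_gap_total)
  also have "\<dots> \<le> (real (nat \<lceil>32 / e\<rceil>) + 6) * exp (- 2 * f)" by (intro mult_right_mono) auto
  finally show ?thesis .
qed

end

section \<open>Components of the random graph\<close>

lemma rate_pmf_any:
  assumes fin: "finite S" and u: "\<And>e. e \<in> S \<Longrightarrow> 0 \<le> u e"
  shows "map_pmf (\<lambda>g. \<exists>e\<in>S. g e) (rate_pmf S u) = bernoulli_pmf (1 - exp (- (\<Sum>e\<in>S. u e)))"
proof (rule pmf_eqI)
  fix b
  have 0: "measure_pmf.prob (rate_pmf S u) {g. \<forall>e\<in>S. \<not> g e} = exp (- (\<Sum>e\<in>S. u e))"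
    by (rule rate_pmf_none[OF fin u order.refl])
  have "0 \<le> (\<Sum>e\<in>S. u e)" using u by (rule sum_nonneg)
  then have q: "0 \<le> 1 - exp (- (\<Sum>e\<in>S. u e))" "1 - exp (- (\<Sum>e\<in>S. u e)) \<le> 1" by simp_all
  have F: "pmf (map_pmf (\<lambda>g. \<exists>e\<in>S. g e) (rate_pmf S u)) False = exp (- (\<Sum>e\<in>S. u e))"
    unfolding pmf_map using 0 by (simp add: vimage_def)
  have "pmf (map_pmf (\<lambda>g. \<exists>e\<in>S. g e) (rate_pmf S u)) True = 1 - exp (- (\<Sum>e\<in>S. u e))"
    using pmf_False_conv_True[of "map_pmf (\<lambda>g. \<exists>e\<in>S. g e) (rate_pmf S u)"] F by simp
  with F q show "pmf (map_pmf (\<lambda>g. \<exists>e\<in>S. g e) (rate_pmf S u)) b =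
      pmf (bernoulli_pmf (1 - exp (- (\<Sum>e\<in>S. u e)))) b"
    by (cases b) simp_all
qed

text \<open>Given the graph, colouring vertices amounts to colouring whole components independently,
  each at the sum of the rates of its vertices. The blocks will be the singletons belonging to one
  component.\<close>

lemma rate_pmf_blocks:
  fixes b :: "'k \<Rightarrow> 'e set"
  assumes "finite J" "\<And>K. K \<in> J \<Longrightarrow> finite (b K)" "disjoint_family_on b J"
    and "\<And>K e. K \<in> J \<Longrightarrow> e \<in> b K \<Longrightarrow> 0 \<le> u e"
  shows "map_pmf (\<lambda>g K. K \<in> J \<and> (\<exists>e\<in>b K. g e)) (rate_pmf (\<Union>K\<in>J. b K) u) =
    rate_pmf J (\<lambda>K. \<Sum>e\<in>b K. u e)"
  using assms
proof (induction J rule: finite_induct)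
  case empty
  then show ?case by (simp add: map_return_pmf)
next
  case (insert K J)
  let ?I = "\<Union>K\<in>J. b K"
  let ?F = "\<lambda>g K. K \<in> J \<and> (\<exists>e\<in>b K. g e)"
  have dJ: "disjoint_family_on b J" using insert.prems(2) by (auto simp: disjoint_family_on_def)
  have IH: "map_pmf ?F (rate_pmf ?I u) = rate_pmf J (\<lambda>K. \<Sum>e\<in>b K. u e)"
    using insert.prems dJ by (intro insert.IH) auto
  have dis: "b K \<inter> b K' = {}" if "K' \<in> J" for K'
    using insert.prems(2) insert.hyps(2) that unfolding disjoint_family_on_def by (metis insertCI)
  have "rate_pmf (insert K J) (\<lambda>K. \<Sum>e\<in>b K. u e) =
      map_pmf (\<lambda>(y, f). f(K := y)) (pair_pmf (bernoulli_pmf (1 - exp (- (\<Sum>e\<in>b K. u e))))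
        (rate_pmf J (\<lambda>K. \<Sum>e\<in>b K. u e)))"
    by (rule Pi_pmf_insert[OF insert.hyps])
  also have "bernoulli_pmf (1 - exp (- (\<Sum>e\<in>b K. u e))) = map_pmf (\<lambda>g. \<exists>e\<in>b K. g e) (rate_pmf (b K) u)"
    using insert.prems by (intro rate_pmf_any[symmetric]) auto
  also have "rate_pmf J (\<lambda>K. \<Sum>e\<in>b K. u e) = map_pmf ?F (rate_pmf ?I u)" by (rule IH[symmetric])
  also have "pair_pmf (map_pmf (\<lambda>g. \<exists>e\<in>b K. g e) (rate_pmf (b K) u)) (map_pmf ?F (rate_pmf ?I u)) =
      map_pmf (\<lambda>(f, g). (\<exists>e\<in>b K. f e, ?F g)) (pair_pmf (rate_pmf (b K) u) (rate_pmf ?I u))"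
    by (rule map_pair[symmetric])
  also have "map_pmf (\<lambda>(y, f). f(K := y))
      (map_pmf (\<lambda>(f, g). (\<exists>e\<in>b K. f e, ?F g)) (pair_pmf (rate_pmf (b K) u) (rate_pmf ?I u))) =
      map_pmf (\<lambda>(f, g). (?F g)(K := \<exists>e\<in>b K. f e)) (pair_pmf (rate_pmf (b K) u) (rate_pmf ?I u))"
    unfolding pmf.map_comp by (intro map_pmf_cong) auto
  finally have 1: "rate_pmf (insert K J) (\<lambda>K. \<Sum>e\<in>b K. u e) =
      map_pmf (\<lambda>(f, g). (?F g)(K := \<exists>e\<in>b K. f e)) (pair_pmf (rate_pmf (b K) u) (rate_pmf ?I u))" .
  have "rate_pmf (\<Union>K\<in>insert K J. b K) u = rate_pmf (b K \<union> ?I) u" by simp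
  also have "\<dots> = map_pmf (\<lambda>(f, g) x. if x \<in> b K then f x else g x) (pair_pmf (rate_pmf (b K) u) (rate_pmf ?I u))"
    using insert.prems(1) insert.hyps(1) dis by (intro Pi_pmf_union) auto
  finally have "map_pmf (\<lambda>g K'. K' \<in> insert K J \<and> (\<exists>e\<in>b K'. g e)) (rate_pmf (\<Union>K\<in>insert K J. b K) u) =
      map_pmf (\<lambda>(f, g) K'. K' \<in> insert K J \<and> (\<exists>e\<in>b K'. if e \<in> b K then f e else g e))
        (pair_pmf (rate_pmf (b K) u) (rate_pmf ?I u))"
    by (simp add: pmf.map_comp o_def case_prod_unfold)
  also have "(\<lambda>(f, g) K'. K' \<in> insert K J \<and> (\<exists>e\<in>b K'. if e \<in> b K then f e else g e)) =
      (\<lambda>(f, g). (?F g)(K := \<exists>e\<in>b K. f e))"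
    using insert.hyps(2) dis by (fastforce simp: fun_eq_iff)
  finally show ?case unfolding 1 .
qed

text \<open>The outbreak estimates concern graph and colouring jointly, while the search for the
  giant needs a fixed graph. By Fubini and Markov, a bad event of small joint probability has
  conditional probability below \<open>c\<close> outside a set of graphs whose probability grows
  only by a factor \<open>1 / c\<close>.\<close>

lemma prob_pair_markov:
  assumes c: "0 < c"
  shows "measure_pmf.prob p {x. c \<le> measure_pmf.prob q {y. S x y}} \<le>
    measure_pmf.prob (pair_pmf p q) {(x, y). S x y} / c"
proof -
  let ?\<phi> = "\<lambda>x. measure_pmf.prob q {y. S x y}"
  have int: "integrable (measure_pmf p) ?\<phi>"
    by (rule measure_pmf.integrable_const_bound[where B = 1]) auto
  have "measure_pmf.prob p {x. c \<le> ?\<phi> x} = measure_pmf.prob p {x\<in>space (measure_pmf p). c \<le> ?\<phi> x}" by simp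
  also have "\<dots> \<le> (\<integral>x. ?\<phi> x \<partial>measure_pmf p) / c"
    by (rule integral_Markov_inequality_measure[OF int, of "{}"]) (use c in auto)
  also have "(\<integral>x. ?\<phi> x \<partial>measure_pmf p) = measure_pmf.prob (pair_pmf p q) {(x, y). S x y}"
  proof -
    have "ennreal (\<integral>x. ?\<phi> x \<partial>measure_pmf p) = (\<integral>\<^sup>+x. ennreal (?\<phi> x) \<partial>measure_pmf p)"
      by (rule nn_integral_eq_integral[symmetric, OF int]) auto
    also have "\<dots> = (\<integral>\<^sup>+x. \<integral>\<^sup>+y. indicator {(x, y). S x y} (x, y) \<partial>measure_pmf q \<partial>measure_pmf p)"
    proof (rule nn_integral_cong)
      fix x
      have "(\<integral>\<^sup>+y. indicator {(x, y). S x y} (x, y) \<partial>measure_pmf q) = (\<integral>\<^sup>+y. indicator {y. S x y} y \<partial>measure_pmf q)"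
        by (rule nn_integral_cong) (auto simp: indicator_def)
      then show "ennreal (?\<phi> x) = (\<integral>\<^sup>+y. indicator {(x, y). S x y} (x, y) \<partial>measure_pmf q)"
        by (simp add: measure_pmf.emeasure_eq_measure)
    qed
    also have "\<dots> = (\<integral>\<^sup>+z. indicator {(x, y). S x y} z \<partial>measure_pmf (pair_pmf p q))"
      by (rule nn_integral_pair_pmf'[symmetric])
    also have "\<dots> = ennreal (measure_pmf.prob (pair_pmf p q) {(x, y). S x y})"
      by (simp add: measure_pmf.emeasure_eq_measure)
    finally show ?thesis by (simp add: integral_nonneg_AE)
  qed
  finally show ?thesis .
qed

section \<open>Components as final sets\<close>

definition conn :: "nat \<Rightarrow> nat set set \<Rightarrow> (nat \<times> nat) set" where
  "conn n E = {(x, y) \<in> {1..n} \<times> {1..n}. (x, y) \<in> {(a, b). {a, b} \<in> E}\<^sup>*}"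

lemma components_conn: "components n E = {1..n} // conn n E"
  by (simp add: components_def conn_def)

lemma equiv_conn: "equiv {1..n} (conn n E)"
proof (rule equivI)
  have "sym {(a, b). {a, b} \<in> E}" by (auto simp: sym_def insert_commute)
  then have "sym ({(a, b). {a, b} \<in> E}\<^sup>*)" by (rule sym_rtrancl)
  then show "sym (conn n E)" by (auto simp: conn_def sym_def)
  show "trans (conn n E)" by (auto simp: conn_def trans_def)
  show "refl_on {1..n} (conn n E)" by (auto simp: conn_def refl_on_def)
  show "conn n E \<subseteq> {1..n} \<times> {1..n}" by (auto simp: conn_def)
qed

lemma components_Union: "\<Union> (components n E) = {1..n}"
  unfolding components_conn by (rule Union_quotient[OF equiv_conn])

lemma components_disjoint: "K \<in> components n E \<Longrightarrow> K' \<in> components n E \<Longrightarrow> K \<noteq> K' \<Longrightarrow> K \<inter> K' = {}"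
  using quotient_disj[OF equiv_conn[of n E], of K K'] by (auto simp: components_conn)

lemma components_subset: "K \<in> components n E \<Longrightarrow> K \<subseteq> {1..n}"
  using Union_upper[of K "components n E"] unfolding components_Union .

lemma finite_components: "finite (components n E)"
proof (rule finite_subset)
  show "components n E \<subseteq> Pow {1..n}" using components_subset by blast
qed simp

lemma finite_component: "K \<in> components n E \<Longrightarrow> finite K"
  by (rule finite_subset[OF components_subset]) auto

lemma components_conn_closed:
  assumes "K \<in> components n E" "i \<in> K" "(i, j) \<in> conn n E"
  shows "j \<in> K"
  by (rule in_quotient_imp_closed[OF equiv_conn _ assms(2,3)])
    (use assms(1) in \<open>simp add: components_conn\<close>)

lemma components_connected:
  assumes "K \<in> components n E" "i \<in> K" "j \<in> K"
  shows "(i, j) \<in> conn n E"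
  by (rule in_quotient_imp_in_rel[OF equiv_conn, of K])
    (use assms in \<open>simp_all add: components_conn\<close>)

text \<open>No edge leaves a union of components, so it is closed. It is minimal because from a
  coloured vertex the infection follows a path to any vertex of the same component: a set that
  infects no further vertex of the union contains every vertex of that path.\<close>

lemma outbreak_components:
  assumes E: "E = {e \<in> all_edges n. X e}"
  shows "outbreak {1..n} (graph_hit X) (\<Union>{K \<in> components n E. \<exists>i\<in>K. X {i}})" (is "outbreak _ _ ?A")
  unfolding outbreak_def
proof (intro conjI allI impI ballI)
  show AV: "?A \<subseteq> {1..n}" using components_subset by blast
  have edge: "{i, j} \<in> E" if "X {i, j}" "i \<in> {1..n}" "j \<in> {1..n}" "i \<noteq> j" for i j
    using that by (auto simp: E all_edges_def)
  have edgeV: "i \<in> {1..n}" "j \<in> {1..n}" if "{i, j} \<in> E" for i j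
    using that by (auto simp: E all_edges_def doubleton_eq_iff)
  fix i assume i: "i \<in> {1..n} - ?A"
  obtain K where K: "K \<in> components n E" "i \<in> K" using i components_Union by blast
  show "\<not> graph_hit X ?A i"
  proof
    assume "graph_hit X ?A i"
    then consider "X {i}" | j where "j \<in> ?A" "X {i, j}" by (auto simp: graph_hit_def)
    then show False
    proof cases
      case 1
      then show False using K i by blast
    next
      case 2
      then obtain K' where K': "K' \<in> components n E" "j \<in> K'" "\<exists>i\<in>K'. X {i}" by blast
      have V: "i \<in> {1..n}" "j \<in> {1..n}" "i \<noteq> j" using i AV 2(1) by blast+
      have "{i, j} \<in> E" by (rule edge[OF 2(2) V])
      then have "(j, i) \<in> conn n E"
        unfolding conn_def using V by (simp add: insert_commute r_into_rtrancl)
      then have "i \<in> K'" by (rule components_conn_closed[OF K'(1,2)])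
      then show False using K' i by blast
    qed
  qed
next
  fix B assume B: "B \<subset> ?A"
  let ?R = "{(a, b). {a, b} \<in> E}"
  show "\<exists>i\<in>?A - B. graph_hit X B i"
  proof (rule ccontr)
    assume neg: "\<not> (\<exists>i\<in>?A - B. graph_hit X B i)"
    have "?A \<subseteq> B"
    proof
      fix i assume "i \<in> ?A"
      then obtain K g where K: "K \<in> components n E" "i \<in> K" "g \<in> K" "X {g}" by blast
      have KA: "K \<subseteq> ?A" using K by blast
      have gi: "(g, i) \<in> ?R\<^sup>*" using components_connected[OF K(1,3,2)] by (simp add: conn_def)
      have "i \<in> B \<and> i \<in> K" using gi
      proof (induction rule: rtrancl_induct)
        case base
        have "graph_hit X B g" using K by (simp add: graph_hit_def)
        then show ?case using neg KA K(3) by blast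
      next
        case (step y z)
        have yz: "{y, z} \<in> E" using step(2) by simp
        then have zV: "y \<in> {1..n}" "z \<in> {1..n}" and X: "X {z, y}"
          by (auto simp: E all_edges_def doubleton_eq_iff insert_commute)
        have "(y, z) \<in> conn n E" unfolding conn_def using yz zV by (simp add: r_into_rtrancl)
        then have zK: "z \<in> K" using components_conn_closed[OF K(1)] step.IH by blast
        have "graph_hit X B z" using X step.IH by (auto simp: graph_hit_def)
        then show ?case using neg zK KA by blast
      qed
      then show "i \<in> B" ..
    qed
    then show False using B by blast
  qed
qed

lemma coloured_edges_split: "coloured_edges {1..n} = all_edges n \<union> (\<lambda>i. {i}) ` {1..n}"
proof
  show "coloured_edges {1..n} \<subseteq> all_edges n \<union> (\<lambda>i. {i}) ` {1..n}"
    unfolding coloured_edges_def all_edges_def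
    by (auto simp: card_1_singleton_iff card_2_iff)
  show "all_edges n \<union> (\<lambda>i. {i}) ` {1..n} \<subseteq> coloured_edges {1..n}"
    unfolding coloured_edges_def all_edges_def by auto
qed

definition colour_mass :: "(nat \<Rightarrow> real) \<Rightarrow> nat set \<Rightarrow> real" where
  "colour_mass v K = real (card K) + (\<Sum>i\<in>K. v i)"

definition colour_prob :: "nat \<Rightarrow> (nat \<Rightarrow> real) \<Rightarrow> nat set set \<Rightarrow> real \<Rightarrow> (nat set \<Rightarrow> bool) \<Rightarrow> real" where
  "colour_prob n v E \<alpha> R = measure_pmf.prob (rate_pmf (components n E) (\<lambda>K. \<alpha> * colour_mass v K))
     {B. R (\<Union>{K \<in> components n E. B K})}"

text \<open>A coloured graph is an independent pair of a random graph and vertex colours. By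
  uniqueness of the final set, the latter is the union of the coloured components, so that
  \<open>outbreak_prob\<close> is the joint probability to which \<open>prob_pair_markov\<close>
  applies.\<close>

lemma colour_prob_markov:
  assumes v: "\<And>i. i \<in> {1..n} \<Longrightarrow> 0 \<le> v i" and p: "0 \<le> p" and x: "0 \<le> x" and c: "0 < c"
  shows "measure_pmf.prob (random_graph n v p) {E. c \<le> colour_prob n v E (p * x) R} \<le>
    outbreak_prob {1..n} (weight_rate v p (\<lambda>i. p * x * (1 + v i))) {A \<in> Pow {1..n}. R A} / c"
proof -
  let ?u = "weight_rate v p (\<lambda>i. p * x * (1 + v i))"
  let ?S = "(\<lambda>i. {i}) ` {1..n}"
  let ?G = "\<lambda>f. {e \<in> all_edges n. f e}"
  have finE: "finite (all_edges n)"
    using finite_coloured_edges[of "{1..n}"] unfolding coloured_edges_split by simp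
  have edge_card: "card e = 2" if "e \<in> all_edges n" for e using that by (auto simp: all_edges_def)
  have disj: "all_edges n \<inter> ?S = {}" using edge_card by fastforce
  have graph: "random_graph n v p = map_pmf ?G (rate_pmf (all_edges n) ?u)"
    unfolding random_graph_def
    by (intro arg_cong2[where f = map_pmf] refl Pi_pmf_cong)
      (auto simp: edge_prob_def weight_rate_def edge_card)
  let ?m = "\<lambda>(f, g) e. if e \<in> all_edges n then f e else g e"
  have colour: "colour_prob n v E (p * x) R =
      measure_pmf.prob (rate_pmf ?S ?u) {g. R (\<Union>{K \<in> components n E. \<exists>i\<in>K. g {i}})}" for E
  proof -
    let ?b = "\<lambda>K. (\<lambda>i. {i}) ` K"
    have sumb: "(\<Sum>e\<in>?b K. ?u e) = p * x * colour_mass v K" if "K \<in> components n E" for K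
      using finite_component[OF that]
      by (simp add: sum.reindex weight_rate_def colour_mass_def sum_distrib_left[symmetric] sum.distrib)
    have "rate_pmf (components n E) (\<lambda>K. p * x * colour_mass v K) = rate_pmf (components n E) (\<lambda>K. \<Sum>e\<in>?b K. ?u e)"
      by (rule Pi_pmf_cong) (auto simp: sumb)
    also have "\<dots> = map_pmf (\<lambda>g K. K \<in> components n E \<and> (\<exists>e\<in>?b K. g e)) (rate_pmf (\<Union>K\<in>components n E. ?b K) ?u)"
    proof (rule rate_pmf_blocks[symmetric])
      show "disjoint_family_on ?b (components n E)"
        using components_disjoint unfolding disjoint_family_on_def by blast
      fix K e assume "K \<in> components n E" "e \<in> ?b K"
      then obtain i where "e = {i}" "i \<in> {1..n}" using components_subset by blast
      then show "0 \<le> ?u e" using v[of i] p x by (simp add: weight_rate_def)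
    qed (auto simp: finite_components finite_component)
    also have "(\<Union>K\<in>components n E. ?b K) = ?S" using components_Union[of n E] by blast
    finally have "rate_pmf (components n E) (\<lambda>K. p * x * colour_mass v K) =
        map_pmf (\<lambda>g K. K \<in> components n E \<and> (\<exists>e\<in>?b K. g e)) (rate_pmf ?S ?u)" .
    then show ?thesis
      unfolding colour_prob_def by (simp add: vimage_def cong: conj_cong)
  qed
  have "measure_pmf.prob (random_graph n v p) {E. c \<le> colour_prob n v E (p * x) R} =
      measure_pmf.prob (rate_pmf (all_edges n) ?u)
        {f. c \<le> measure_pmf.prob (rate_pmf ?S ?u) {g. R (\<Union>{K \<in> components n (?G f). \<exists>i\<in>K. g {i}})}}"
    unfolding graph by (simp add: vimage_def colour)
  also have "\<dots> \<le> measure_pmf.prob (pair_pmf (rate_pmf (all_edges n) ?u) (rate_pmf ?S ?u))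
        {(f, g). R (\<Union>{K \<in> components n (?G f). \<exists>i\<in>K. g {i}})} / c"
    by (rule prob_pair_markov[OF c])
  also have "{(f, g). R (\<Union>{K \<in> components n (?G f). \<exists>i\<in>K. g {i}})} =
      ?m -` {X. \<exists>A\<in>{A \<in> Pow {1..n}. R A}. outbreak {1..n} (graph_hit X) A}"
  proof -
    have "R (\<Union>{K \<in> components n (?G f). \<exists>i\<in>K. g {i}}) \<longleftrightarrow>
        (\<exists>A\<in>{A \<in> Pow {1..n}. R A}. outbreak {1..n} (graph_hit (?m (f, g))) A)" for f g :: "nat set \<Rightarrow> bool"
    proof -
      let ?X = "?m (f, g)"
      let ?A = "\<Union>{K \<in> components n (?G f). \<exists>i\<in>K. g {i}}"
      have single: "{i} \<notin> all_edges n" for i using edge_card[of "{i}"] by auto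
      have "outbreak {1..n} (graph_hit ?X) (\<Union>{K \<in> components n (?G f). \<exists>i\<in>K. ?X {i}})"
        by (rule outbreak_components) auto
      then have out: "outbreak {1..n} (graph_hit ?X) ?A" using single by simp
      have "\<exists>!A. outbreak {1..n} (graph_hit ?X) A" by (rule outbreak_ex1) (rule graph_hit_mono)
      then have "outbreak {1..n} (graph_hit ?X) A \<longleftrightarrow> A = ?A" for A using out by blast
      moreover have "?A \<subseteq> {1..n}" using components_subset by blast
      ultimately show ?thesis by auto
    qed
    then show ?thesis by (auto simp del: split_paired_All)
  qed
  also have "measure_pmf.prob (pair_pmf (rate_pmf (all_edges n) ?u) (rate_pmf ?S ?u)) \<dots> =
      outbreak_prob {1..n} ?u {A \<in> Pow {1..n}. R A}"
    unfolding outbreak_prob_def coloured_edges_split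
    by (subst Pi_pmf_union[OF finE _ disj]) simp_all
  finally show ?thesis .
qed

section \<open>Asymptotics of the weights\<close>

text \<open>Weak convergence only tests bounded continuous functions, so the cube is brought down to
  0 by a linear ramp on the interval from \<open>K\<close> to \<open>K + 1\<close> instead of being
  cut off sharply.\<close>

definition cube_cutoff :: "real \<Rightarrow> real \<Rightarrow> real" where
  "cube_cutoff K x = (max 0 x) ^ 3 * max 0 (min 1 (K + 1 - x))"

lemma cube_cutoff_bounds:
  assumes "0 \<le> K"
  shows "0 \<le> cube_cutoff K x" "cube_cutoff K x \<le> (K + 1) ^ 3" "cube_cutoff K x \<le> (max 0 x) ^ 3"
    "0 \<le> x \<Longrightarrow> x \<le> K \<Longrightarrow> cube_cutoff K x = x ^ 3" "K + 1 < x \<Longrightarrow> cube_cutoff K x = 0"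
proof -
  show "0 \<le> cube_cutoff K x" by (simp add: cube_cutoff_def)
  have "(max 0 x) ^ 3 * max 0 (min 1 (K + 1 - x)) \<le> (max 0 x) ^ 3 * 1" by (intro mult_left_mono) auto
  then show le: "cube_cutoff K x \<le> (max 0 x) ^ 3" by (simp add: cube_cutoff_def)
  show z: "K + 1 < x \<Longrightarrow> cube_cutoff K x = 0" by (simp add: cube_cutoff_def max_def min_def)
  show "cube_cutoff K x \<le> (K + 1) ^ 3"
  proof (cases "K + 1 < x")
    case False
    then have "(max 0 x) ^ 3 \<le> (K + 1) ^ 3" using assms by (intro power_mono) auto
    then show ?thesis using le by simp
  qed (use z assms in simp)
  show "0 \<le> x \<Longrightarrow> x \<le> K \<Longrightarrow> cube_cutoff K x = x ^ 3" by (simp add: cube_cutoff_def)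
qed

lemma isCont_cube_cutoff: "isCont (cube_cutoff K) x"
  unfolding cube_cutoff_def by (intro continuous_intros)

lemma cube_cutoff_measurable [measurable]: "cube_cutoff K \<in> borel_measurable borel"
  unfolding cube_cutoff_def by measurable

locale weight_limit =
  fixes \<mu> :: "real measure" and w :: "nat \<Rightarrow> nat \<Rightarrow> real"
  assumes array: "weight_array w" and conds: "weight_conditions \<mu> w"
begin

sublocale real_distribution \<mu> using conds by (simp add: weight_conditions_def)

abbreviation "m1 \<equiv> law_moment \<mu> 1"
abbreviation "m3 \<equiv> law_moment \<mu> 3"
abbreviation "l \<equiv> total_weight w"

lemma AE_pos: "AE x in \<mu>. 0 < x" using conds by (simp add: weight_conditions_def)

lemma integrable3: "integrable \<mu> (\<lambda>x. x ^ 3)" using conds by (simp add: weight_conditions_def)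

lemma integrable1: "integrable \<mu> (\<lambda>x. x)"
proof (rule Bochner_Integration.integrable_bound)
  show "integrable \<mu> (\<lambda>x. 1 + x ^ 3)" using integrable3 by simp
  show "AE x in \<mu>. norm x \<le> norm (1 + x ^ 3)"
    using AE_pos
  proof eventually_elim
    fix x :: real assume x: "0 < x"
    have "x \<le> 1 + x ^ 3"
    proof (cases "x \<le> 1")
      case False
      then have "x ^ 1 \<le> x ^ 3" by (intro power_increasing) auto
      then show ?thesis by simp
    qed (use x in \<open>simp add: add_increasing2\<close>)
    then show "norm x \<le> norm (1 + x ^ 3)" using x by simp
  qed
qed simp

lemma integral_pos:
  fixes g :: "real \<Rightarrow> real"
  assumes g: "integrable \<mu> g" and pos: "\<And>x. 0 < x \<Longrightarrow> 0 < g x"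
  shows "0 < (\<integral>x. g x \<partial>\<mu>)"
proof -
  have AE: "AE x in \<mu>. 0 < g x" using AE_pos by eventually_elim (rule pos)
  have ge: "0 \<le> (\<integral>x. g x \<partial>\<mu>)" using AE by (intro integral_nonneg_AE) (auto elim: eventually_mono)
  have "(\<integral>x. g x \<partial>\<mu>) \<noteq> 0"
  proof
    assume "(\<integral>x. g x \<partial>\<mu>) = 0"
    moreover have "AE x in \<mu>. 0 \<le> g x" using AE by eventually_elim simp
    ultimately have "AE x in \<mu>. g x = 0" using integral_nonneg_eq_0_iff_AE[OF g] by simp
    with AE have "AE x in \<mu>. False" by eventually_elim simp
    then show False by simp
  qed
  with ge show ?thesis by simp
qed

lemma m1_pos: "0 < m1" and m3_pos: "0 < m3"
  using integral_pos[OF integrable1] integral_pos[OF integrable3] by (simp_all add: law_moment_def)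

lemma w_pos: "0 < w n i" if "i \<in> {1..n}"
proof -
  have "1 \<le> n" "1 \<le> i" "i \<le> n" using that by auto
  then have "0 < w n n" "w n n \<le> w n i" using array by (auto simp: weight_array_def)
  then show ?thesis by simp
qed

section \<open>Quantitative forms of the moment conditions\<close>

lemma smallo_bound:
  fixes g h :: "nat \<Rightarrow> real"
  assumes "g \<in> o(h)" "0 < d" "\<And>n. 0 \<le> h n"
  shows "\<forall>\<^sub>F n in sequentially. \<bar>g n\<bar> \<le> d * h n"
  using landau_o.smallD[OF assms(1,2)] assms(3) by (simp add: abs_of_nonneg)

lemma ev_l: "0 < d \<Longrightarrow> \<forall>\<^sub>F n in sequentially. \<bar>l n - m1 * real n\<bar> \<le> d * real n powr (2/3)"
  using conds by (intro smallo_bound) (auto simp: weight_conditions_def)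

text \<open>Criticality enters here: the second moment of the limit law equals the first, so both
  \<open>l n\<close> and the sum of squares are compared with \<open>m1 * real n\<close>.\<close>

lemma ev_s2: "0 < d \<Longrightarrow> \<forall>\<^sub>F n in sequentially. \<bar>(\<Sum>k=1..n. (w n k)\<^sup>2) - m1 * real n\<bar> \<le> d * real n powr (2/3)"
  using conds by (intro smallo_bound) (auto simp: weight_conditions_def)

lemma ev_s3: "0 < d \<Longrightarrow> \<forall>\<^sub>F n in sequentially. \<bar>(\<Sum>k=1..n. w n k ^ 3) - m3 * real n\<bar> \<le> d"
proof -
  assume d: "0 < d"
  have "(\<lambda>n. (\<Sum>k=1..n. w n k ^ 3) - m3 * real n) \<in> o(\<lambda>n. 1)" using conds by (simp add: weight_conditions_def)
  from smallo_bound[OF this d] show ?thesis by simp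
qed

lemma ev_max: "0 < d \<Longrightarrow> \<forall>\<^sub>F n in sequentially. \<forall>i\<in>{1..n}. w n i \<le> d * real n powr (1/3)"
proof -
  assume d: "0 < d"
  have "(\<lambda>n. Max (w n ` {1..n})) \<in> o(\<lambda>n. real n powr (1/3))" using conds by (simp add: weight_conditions_def)
  from smallo_bound[OF this d] have "\<forall>\<^sub>F n in sequentially. \<bar>Max (w n ` {1..n})\<bar> \<le> d * real n powr (1/3)"
    by simp
  then show ?thesis
  proof eventually_elim
    fix n assume Max: "\<bar>Max (w n ` {1..n})\<bar> \<le> d * real n powr (1/3)"
    show "\<forall>i\<in>{1..n}. w n i \<le> d * real n powr (1/3)"
    proof
      fix i assume "i \<in> {1..n}"
      then have "w n i \<le> Max (w n ` {1..n})" by (intro Max_ge) auto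
      then show "w n i \<le> d * real n powr (1/3)" using Max by linarith
    qed
  qed
qed

lemma ev_n: "\<forall>\<^sub>F n in sequentially. K \<le> real n"
  using eventually_ge_at_top[of "nat \<lceil>K\<rceil>"] by eventually_elim linarith

lemma ev_l_ge: "\<forall>\<^sub>F n in sequentially. m1 / 2 * real n \<le> l n"
proof -
  have "0 < m1 / 2" using m1_pos by simp
  from ev_l[OF this] ev_n[of 1] show ?thesis
  proof eventually_elim
    fix n assume *: "\<bar>l n - m1 * real n\<bar> \<le> m1 / 2 * real n powr (2/3)" and n: "1 \<le> real n"
    have "real n powr (2/3) \<le> real n powr 1" using n by (intro powr_mono) auto
    then have "m1 / 2 * real n powr (2/3) \<le> m1 / 2 * real n" using m1_pos n by (intro mult_left_mono) auto
    then show "m1 / 2 * real n \<le> l n" using * unfolding abs_le_iff by linarith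
  qed
qed

lemma ev_l_large: "\<forall>\<^sub>F n in sequentially. K \<le> l n"
  using ev_l_ge ev_n[of "K / (m1 / 2)"]
proof eventually_elim
  fix n assume 1: "m1 / 2 * real n \<le> l n" and 2: "K / (m1 / 2) \<le> real n"
  have "K \<le> real n * (m1 / 2)" using 2 m1_pos by (subst (asm) pos_divide_le_eq) auto
  with 1 show "K \<le> l n" by (simp add: mult.commute)
qed

lemma ev_n_powr:
  assumes a: "0 \<le> a"
  shows "\<forall>\<^sub>F n in sequentially. real n powr a \<le> (2 / m1) powr a * l n powr a"
  using ev_l_ge
proof eventually_elim
  fix n assume 1: "m1 / 2 * real n \<le> l n"
  have "real n \<le> 2 / m1 * l n" using 1 m1_pos by (simp add: field_simps)
  moreover have "0 \<le> l n" using order_trans[OF _ 1, of 0] m1_pos by simp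
  ultimately show "real n powr a \<le> (2 / m1) powr a * l n powr a"
    using m1_pos a by (subst powr_mult[symmetric]) (auto intro: powr_mono2)
qed

lemma ev_s2_l:
  assumes d: "0 < d"
  shows "\<forall>\<^sub>F n in sequentially. \<bar>(\<Sum>k=1..n. (w n k)\<^sup>2) - l n\<bar> \<le> d * l n powr (2/3)"
proof -
  define c where "c = (2 / m1) powr (2/3)"
  have c: "0 < c" using m1_pos by (simp add: c_def)
  define d' where "d' = d / (2 * c)"
  have d': "0 < d'" using c d by (simp add: d'_def)
  have ev: "\<forall>\<^sub>F n in sequentially. real n powr (2/3) \<le> c * l n powr (2/3)"
    using ev_n_powr[of "2/3"] by (simp add: c_def)
  from ev_s2[OF d'] ev_l[OF d'] ev show ?thesis
  proof eventually_elim
    fix n assume 1: "\<bar>(\<Sum>k=1..n. (w n k)\<^sup>2) - m1 * real n\<bar> \<le> d' * real n powr (2/3)"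
      "\<bar>l n - m1 * real n\<bar> \<le> d' * real n powr (2/3)" and 2: "real n powr (2/3) \<le> c * l n powr (2/3)"
    have "\<bar>(\<Sum>k=1..n. (w n k)\<^sup>2) - l n\<bar> \<le> 2 * d' * real n powr (2/3)" using 1 by linarith
    also have "\<dots> \<le> 2 * d' * (c * l n powr (2/3))" using 2 d' by (intro mult_left_mono) auto
    also have "\<dots> = d * l n powr (2/3)" using c by (simp add: d'_def)
    finally show "\<bar>(\<Sum>k=1..n. (w n k)\<^sup>2) - l n\<bar> \<le> d * l n powr (2/3)" .
  qed
qed

lemma ev_s3_l:
  assumes d: "0 < d"
  shows "\<forall>\<^sub>F n in sequentially. \<bar>(\<Sum>k=1..n. w n k ^ 3) - m3 / m1 * l n\<bar> \<le> d * l n"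
proof -
  define C where "C = m3 / m1"
  have C: "0 < C" using m1_pos m3_pos by (simp add: C_def)
  define c where "c = (2 / m1) powr (2/3)"
  have c: "0 < c" using m1_pos by (simp add: c_def)
  define d' where "d' = d / (2 * c * C)"
  have d': "0 < d'" using c d C by (simp add: d'_def)
  have ev: "\<forall>\<^sub>F n in sequentially. real n powr (2/3) \<le> c * l n powr (2/3)"
    using ev_n_powr[of "2/3"] by (simp add: c_def)
  have d2: "0 < d / 2" using d by simp
  from ev_s3[OF d2] ev_l[OF d'] ev ev_l_large[of 1] show ?thesis
  proof eventually_elim
    fix n assume 1: "\<bar>(\<Sum>k=1..n. w n k ^ 3) - m3 * real n\<bar> \<le> d / 2"
      "\<bar>l n - m1 * real n\<bar> \<le> d' * real n powr (2/3)" and 2: "real n powr (2/3) \<le> c * l n powr (2/3)" and l: "1 \<le> l n"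
    have "l n powr (2/3) \<le> l n powr 1" using l by (intro powr_mono) auto
    then have "c * l n powr (2/3) \<le> c * l n" using c l by (intro mult_left_mono) auto
    then have "real n powr (2/3) \<le> c * l n" using 2 by linarith
    then have "d' * real n powr (2/3) \<le> d' * (c * l n)" using d' by (intro mult_left_mono) auto
    then have "\<bar>l n - m1 * real n\<bar> \<le> d' * (c * l n)" using 1(2) by linarith
    then have "C * \<bar>l n - m1 * real n\<bar> \<le> C * (d' * (c * l n))" using C by (intro mult_left_mono) auto
    also have "\<dots> = d / 2 * l n" using c C by (simp add: d'_def)
    finally have "\<bar>C * (l n - m1 * real n)\<bar> \<le> d / 2 * l n" using C by (simp add: abs_mult)
    moreover have "C * (l n - m1 * real n) = C * l n - m3 * real n"
      using m1_pos by (simp add: C_def right_diff_distrib)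
    moreover have "d / 2 * 1 \<le> d / 2 * l n" using l d by (intro mult_left_mono) auto
    ultimately show "\<bar>(\<Sum>k=1..n. w n k ^ 3) - m3 / m1 * l n\<bar> \<le> d * l n"
      using 1(1) unfolding C_def[symmetric] abs_le_iff by linarith
  qed
qed

lemma cutoff_integral: "(\<lambda>K. \<integral>x. cube_cutoff (real K) x \<partial>\<mu>) \<longlonglongrightarrow> m3"
proof -
  have "(\<lambda>K. \<integral>x. cube_cutoff (real K) x \<partial>\<mu>) \<longlonglongrightarrow> (\<integral>x. (max 0 x) ^ 3 \<partial>\<mu>)"
  proof (rule integral_dominated_convergence[where w = "\<lambda>x. \<bar>x ^ 3\<bar>"])
    show "integrable \<mu> (\<lambda>x. \<bar>x ^ 3\<bar>)" using integrable3 by (rule integrable_abs)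
    show "AE x in \<mu>. (\<lambda>K. cube_cutoff (real K) x) \<longlonglongrightarrow> (max 0 x) ^ 3"
    proof (rule AE_I2, rule tendsto_eventually)
      fix x :: real
      show "\<forall>\<^sub>F K in sequentially. cube_cutoff (real K) x = (max 0 x) ^ 3"
        using ev_n[of x] by eventually_elim (simp add: cube_cutoff_def)
    qed
    show "AE x in \<mu>. norm (cube_cutoff (real K) x) \<le> \<bar>x ^ 3\<bar>" for K
      using AE_pos
    proof eventually_elim
      fix x :: real assume "0 < x"
      then show "norm (cube_cutoff (real K) x) \<le> \<bar>x ^ 3\<bar>"
        using cube_cutoff_bounds(1,3)[of "real K" x] by simp
    qed
  qed measurable
  also have "(\<integral>x. (max 0 x) ^ 3 \<partial>\<mu>) = m3"
    unfolding law_moment_def using AE_pos by (intro integral_cong_AE) (auto elim: eventually_mono)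
  finally show ?thesis .
qed

lemma cutoff_conv:
  "(\<lambda>n. (\<Sum>i=1..n. cube_cutoff (real K) (w n i)) / real n) \<longlonglongrightarrow> (\<integral>x. cube_cutoff (real K) x \<partial>\<mu>)"
proof -
  let ?\<mu> = "\<lambda>n. distr (uniform_count_measure {1..n}) borel (w n)"
  have meas: "w n \<in> uniform_count_measure {1..n} \<rightarrow>\<^sub>M borel" for n
    by (auto simp: measurable_def space_uniform_count_measure sets_uniform_count_measure)
  have "weak_conv_m ?\<mu> \<mu>" using conds by (simp add: weight_conditions_def)
  \<comment> \<open>The sequence is shifted by one because the uniform measure on
    \<open>{1..0}\<close> is not a probability measure; the shift is undone at the end.\<close>
  then have wc: "weak_conv_m (\<lambda>n. ?\<mu> (Suc n)) \<mu>"
    unfolding weak_conv_m_def weak_conv_def by (auto intro: LIMSEQ_Suc)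
  have rd: "real_distribution (?\<mu> (Suc n))" for n
  proof -
    interpret U: prob_space "uniform_count_measure {1..Suc n}"
      by (rule prob_space_uniform_count_measure) auto
    show ?thesis
      using U.prob_space_distr[OF meas[of "Suc n"]] by (auto simp: real_distribution_def real_distribution_axioms_def)
  qed
  have "(\<lambda>n. integral\<^sup>L (?\<mu> (Suc n)) (cube_cutoff (real K))) \<longlonglongrightarrow> integral\<^sup>L \<mu> (cube_cutoff (real K))"
  proof (rule weak_conv_imp_integral_bdd_continuous_conv[OF rd _ wc])
    show "real_distribution \<mu>" ..
    show "isCont (cube_cutoff (real K)) x" for x by (rule isCont_cube_cutoff)
    show "norm (cube_cutoff (real K) x) \<le> (real K + 1) ^ 3" for x
      using cube_cutoff_bounds(1,2)[of "real K" x] by simp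
  qed
  moreover have "integral\<^sup>L (?\<mu> n) (cube_cutoff (real K)) = (\<Sum>i=1..n. cube_cutoff (real K) (w n i)) / real n" for n
    by (subst integral_distr[OF meas]) (auto simp: integral_uniform_count_measure)
  ultimately have "(\<lambda>n. (\<Sum>i=1..Suc n. cube_cutoff (real K) (w (Suc n) i)) / real (Suc n)) \<longlonglongrightarrow>
      integral\<^sup>L \<mu> (cube_cutoff (real K))" by simp
  then show ?thesis by (rule LIMSEQ_imp_Suc)
qed

text \<open>The third moments converge to \<open>m3\<close> in total, and their truncated parts
  converge to nearly \<open>m3\<close> for large \<open>K\<close>, so little is left for the tail.
  Since \<open>cube_cutoff\<close> vanishes beyond \<open>K + 1\<close>, weights above that level
  count in full in the difference.\<close>

lemma uniformly_integrable:
  assumes d: "0 < d"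
  shows "\<exists>K\<ge>0. \<forall>\<^sub>F n in sequentially. (\<Sum>i\<in>{i\<in>{1..n}. K < w n i}. w n i ^ 3) \<le> d * real n"
proof -
  have "\<forall>\<^sub>F K in sequentially. m3 - d / 3 < (\<integral>x. cube_cutoff (real K) x \<partial>\<mu>)"
    using cutoff_integral d by (intro order_tendstoD(1)) auto
  then obtain K :: nat where K: "m3 - d / 3 < (\<integral>x. cube_cutoff (real K) x \<partial>\<mu>)"
    by (auto dest: eventually_happens)
  have "\<forall>\<^sub>F n in sequentially. m3 - d / 3 < (\<Sum>i=1..n. cube_cutoff (real K) (w n i)) / real n"
    using cutoff_conv K by (rule order_tendstoD(1))
  moreover have "0 < d / 3" using d by simp
  note ev_s3[OF this]
  ultimately have "\<forall>\<^sub>F n in sequentially. (\<Sum>i\<in>{i\<in>{1..n}. real K + 1 < w n i}. w n i ^ 3) \<le> d * real n"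
    using ev_n[of 1]
  proof eventually_elim
    fix n assume 1: "m3 - d / 3 < (\<Sum>i=1..n. cube_cutoff (real K) (w n i)) / real n"
      and 2: "\<bar>(\<Sum>k=1..n. w n k ^ 3) - m3 * real n\<bar> \<le> d / 3" and n: "1 \<le> real n"
    have "(m3 - d / 3) * real n < (\<Sum>i=1..n. cube_cutoff (real K) (w n i))"
      using 1 n by (subst (asm) pos_less_divide_eq) auto
    moreover have "(\<Sum>i\<in>{i\<in>{1..n}. real K + 1 < w n i}. w n i ^ 3) \<le>
        (\<Sum>i=1..n. w n i ^ 3 - cube_cutoff (real K) (w n i))"
    proof -
      have "(\<Sum>i\<in>{i\<in>{1..n}. real K + 1 < w n i}. w n i ^ 3) =
          (\<Sum>i\<in>{i\<in>{1..n}. real K + 1 < w n i}. w n i ^ 3 - cube_cutoff (real K) (w n i))"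
        using cube_cutoff_bounds(5)[of "real K"] by (intro sum.cong) auto
      also have "\<dots> \<le> (\<Sum>i=1..n. w n i ^ 3 - cube_cutoff (real K) (w n i))"
      proof (rule sum_mono2)
        fix i assume "i \<in> {1..n} - {i\<in>{1..n}. real K + 1 < w n i}"
        then have "0 < w n i" using w_pos by auto
        then show "0 \<le> w n i ^ 3 - cube_cutoff (real K) (w n i)"
          using cube_cutoff_bounds(3)[of "real K" "w n i"] by simp
      qed auto
      finally show ?thesis .
    qed
    moreover have "d / 3 * 1 \<le> d / 3 * real n" using n d by (intro mult_left_mono) auto
    ultimately show "(\<Sum>i\<in>{i\<in>{1..n}. real K + 1 < w n i}. w n i ^ 3) \<le> d * real n"
      using 2 unfolding sum_subtractf left_diff_distrib abs_le_iff by linarith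
  qed
  then show ?thesis by (intro exI[of _ "real K + 1"]) auto
qed

end

section \<open>The largest component\<close>

definition balanced :: "real \<Rightarrow> real \<Rightarrow> (nat \<Rightarrow> real) \<Rightarrow> nat set \<Rightarrow> bool" where
  "balanced M e v A \<longleftrightarrow> real (card A) + (\<Sum>i\<in>A. v i) < M / 64 \<or>
    real (card A) \<in> {(2 - e) * M..(2 + e) * M} \<and> (\<Sum>i\<in>A. v i) \<in> {(2 - e) * M..(2 + e) * M}"

definition giant_structure :: "nat \<Rightarrow> (nat \<Rightarrow> real) \<Rightarrow> real \<Rightarrow> real \<Rightarrow> nat set set \<Rightarrow> bool" where
  "giant_structure n v M e E \<longleftrightarrow> (\<exists>K\<in>components n E.
    real (card K) \<in> {(2 - 2 * e) * M..(2 + 2 * e) * M} \<and>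
    (\<Sum>i\<in>K. v i) \<in> {(2 - 2 * e) * M..(2 + 2 * e) * M} \<and>
    (\<forall>K'\<in>components n E - {K}. colour_mass v K' < M / 64))"

lemma giant_structureI:
  assumes v: "\<And>i. i \<in> {1..n} \<Longrightarrow> 0 \<le> v i"
    and M: "0 < M" and e: "0 < e" "e \<le> 1/4" and \<beta>: "\<beta> = 1 / 2 ^ k1" "80 * \<beta> \<le> e" and N: "k1 + 2 \<le> N"
    and c: "c \<le> 1/8" "c \<le> (1 - exp (- \<beta>)) * exp (- (3840 * \<beta>)) * (1 - exp (- (32 * e)))"
    and good: "\<And>k. k \<le> N \<Longrightarrow> colour_prob n v E (2 ^ k * (64 * \<beta>) / M) (\<lambda>A. \<not> balanced M e v A) < c"
    and large: "colour_prob n v E (2 ^ N * (64 * \<beta>) / M) (\<lambda>A. real (card A) + (\<Sum>i\<in>A. v i) < M / 64) < c"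
  shows "giant_structure n v M e E"
proof -
  let ?J = "components n E"
  let ?sz = "\<lambda>K. real (card K)" and ?wt = "\<lambda>K. \<Sum>i\<in>K. v i"
  have wt0: "0 \<le> ?wt K" if "K \<in> ?J" for K
    using v components_subset[OF that] by (intro sum_nonneg) blast
  interpret colouring ?J ?sz ?wt M e \<beta> c k1 N
    by standard (use assms wt0 finite_components in auto)
  have mass: "mass K = colour_mass v K" for K by (simp add: mass_def colour_mass_def)
  have sums: "(\<Sum>K\<in>{K\<in>?J. B K}. (\<Sum>i\<in>K. g i)) = (\<Sum>i\<in>\<Union>{K\<in>?J. B K}. g i)" for B and g :: "nat \<Rightarrow> real"
  proof -
    have "(\<Sum>i\<in>\<Union>{K\<in>?J. B K}. g i) = (sum \<circ> sum) g {K\<in>?J. B K}"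
    proof (rule sum.Union_disjoint)
      show "\<forall>K\<in>{K\<in>?J. B K}. finite K" by (auto intro: finite_component)
      show "\<forall>K\<in>{K\<in>?J. B K}. \<forall>K'\<in>{K\<in>?J. B K}. K \<noteq> K' \<longrightarrow> K \<inter> K' = {}"
      proof (intro ballI impI)
        fix K K' assume "K \<in> {K\<in>?J. B K}" "K' \<in> {K\<in>?J. B K}" "K \<noteq> K'"
        then show "K \<inter> K' = {}" by (intro components_disjoint) auto
      qed
    qed
    then show ?thesis by simp
  qed
  have cards: "(\<Sum>K\<in>{K\<in>?J. B K}. real (card K)) = real (card (\<Union>{K\<in>?J. B K}))" for B
    using sums[of "\<lambda>_. 1" B] by simp
  have tot: "(\<Sum>K\<in>{K\<in>?J. B K}. mass K) = real (card (\<Union>{K\<in>?J. B K})) + (\<Sum>i\<in>\<Union>{K\<in>?J. B K}. v i)" for B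
    by (simp only: mass_def sum.distrib cards sums)
  have goodB: "good B \<longleftrightarrow> balanced M e v (\<Union>{K\<in>?J. B K})" for B
    unfolding good_def balanced_def tot cards sums ..
  have "\<exists>K\<in>?J. ?sz K \<in> {(2 - 2 * e) * M..(2 + 2 * e) * M} \<and> ?wt K \<in> {(2 - 2 * e) * M..(2 + 2 * e) * M} \<and>
      (\<forall>j\<in>?J - {K}. mass j < M / 64)"
  proof (rule unique_giant)
    show "P k (\<lambda>B. \<not> good B) < c" if "k \<le> N" for k
      using good[OF that] unfolding P_def goodB \<alpha>_def mass colour_prob_def .
    show "P N (\<lambda>B. local.tot ?J B < M / 64) < c"
      using large unfolding P_def \<alpha>_def mass[symmetric] colour_prob_def tot_def tot .
  qed
  then show ?thesis unfolding giant_structure_def mass .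
qed

text \<open>Every other component has fewer than \<open>M / 64\<close> vertices, whereas
  \<open>K\<close> has at least \<open>(2 - 2 * e) * M\<close>, hence at least \<open>M\<close>. So
  \<open>K\<close> is the only largest component, ties included, and its bounds are those of the
  event because \<open>2 * e \<le> \<epsilon>\<close>.\<close>

lemma giant_structure_giant_event:
  assumes S: "giant_structure n v M e E" and M: "M = f * l powr (2/3) / C" "0 < M" and C: "0 < C" and l: "0 < l"
    and e: "e \<le> 1/2" "2 * e \<le> \<epsilon>" and v: "\<And>i. i \<in> {1..n} \<Longrightarrow> 0 \<le> v i"
  shows "E \<in> giant_event n v l C f \<epsilon>"
proof -
  obtain K where K: "K \<in> components n E"
    and sz: "(2 - 2 * e) * M \<le> real (card K)" "real (card K) \<le> (2 + 2 * e) * M"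
    and wt: "(2 - 2 * e) * M \<le> (\<Sum>i\<in>K. v i)" "(\<Sum>i\<in>K. v i) \<le> (2 + 2 * e) * M"
    and small: "\<And>K'. K' \<in> components n E \<Longrightarrow> K' \<noteq> K \<Longrightarrow> colour_mass v K' < M / 64"
    using S unfolding giant_structure_def by auto
  have eM: "2 * e * M \<le> 1 * M" "2 * e * M \<le> \<epsilon> * M" using e M(2) by (auto intro!: mult_right_mono)
  have uniq: "K' = K" if K': "largest_component n E K'" for K'
  proof (rule ccontr)
    assume ne: "K' \<noteq> K"
    have K'c: "K' \<in> components n E" using K' by (simp add: largest_component_def)
    have "0 \<le> (\<Sum>i\<in>K'. v i)" using v components_subset[OF K'c] by (intro sum_nonneg) blast
    then have "real (card K') < M / 64" using small[OF K'c ne] by (simp add: colour_mass_def)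
    moreover have "card K \<le> card K'" using K' K by (simp add: largest_component_def)
    ultimately have "(2 - 2 * e) * M < M / 64" using sz(1) by linarith
    then show False using eM M(2) unfolding left_diff_distrib by linarith
  qed
  have lM: "0 \<le> l powr (2/3) / C" using C by simp
  have eqs: "2 * (1 - \<epsilon>/2) * f * l powr (2/3) / C = 2 * M - \<epsilon> * M"
    "2 * (1 + \<epsilon>/2) * f * l powr (2/3) / C = 2 * M + \<epsilon> * M"
    "2 * (1 - \<epsilon>) * f * l powr (2/3) / C = 2 * M - 2 * (\<epsilon> * M)"
    "2 * (1 + \<epsilon>) * f * l powr (2/3) / C = 2 * M + 2 * (\<epsilon> * M)"
    unfolding M(1) using C by (simp_all add: field_simps)
  have eqs2: "(2 - 2 * e) * M = 2 * M - 2 * e * M" "(2 + 2 * e) * M = 2 * M + 2 * e * M"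
    by (simp_all add: algebra_simps)
  have eM0: "0 \<le> \<epsilon> * M" using sz wt eM unfolding eqs2 by linarith
  show ?thesis
    unfolding giant_event_def
  proof (intro CollectI allI impI)
    fix K' assume "largest_component n E K'"
    then have K'K: "K' = K" by (rule uniq)
    show "real (card K') \<in> {2 * (1 - \<epsilon>/2) * f * l powr (2/3) / C - l powr (2/3) / C ..
          2 * (1 + \<epsilon>/2) * f * l powr (2/3) / C} \<and>
        (\<Sum>i\<in>K'. v i) \<in> {2 * (1 - \<epsilon>) * f * l powr (2/3) / C .. 2 * (1 + \<epsilon>) * f * l powr (2/3) / C}"
      using sz wt eM eM0 lM unfolding K'K eqs eqs2 atLeastAtMost_iff by (intro conjI) linarith+
  qed
qed

theorem giant_structure_prob:
  fixes v :: "nat \<Rightarrow> real"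
  assumes X0: "0 \<le> \<kappa> * \<phi> * (\<phi> * sum v {1..n})"
    and reg: "\<And>x. 0 \<le> x \<Longrightarrow> x \<le> \<kappa> * \<phi> * (\<phi> * sum v {1..n}) \<Longrightarrow>
      regime {1..n} v p (\<lambda>i. p * x * (1 + v i)) \<phi> C e N0 \<kappa> \<eta> x f"
    and \<beta>: "\<beta> = 1 / 2 ^ k1" "40 * \<beta> \<le> e"
    and c: "0 < c" "c \<le> 1/8" "c \<le> (1 - exp (- \<beta>)) * exp (- (3840 * \<beta>)) * (1 - exp (- (64 * e)))"
    and hf4: "256 * C \<le> \<kappa> * f ^ 3"
    and hf5: "(\<kappa> * f ^ 3 / (32 * \<beta> * C) + 2) * ((real (nat \<lceil>32 / e\<rceil>) + 6) / c) \<le> exp f"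
    and M: "M = \<phi> * sum v {1..n} / C"
  shows "measure_pmf.prob (random_graph n v p) {E. \<not> giant_structure n v M (2 * e) E} \<le> exp (- f)"
proof -
  note One_nat_def [simp del]
  interpret r0: regime "{1..n}" v p "\<lambda>i. p * 0 * (1 + v i)" \<phi> C e N0 \<kappa> \<eta> 0 f
    by (rule reg) (use X0 in simp_all)
  have L: "r0.L = \<phi> * sum v {1..n}" by (simp add: r0.L_def r0.l_def)
  have M': "M = r0.L / C" by (simp add: M L)
  have M_pos: "0 < M" using r0.L_pos r0.C_pos by (simp add: M')
  have pM: "p * M = \<phi> * (1 + \<phi>) / C" using r0.pL by (simp add: M')
  have pM0: "0 < p * M" using r0.p_pos M_pos by simp
  have \<beta>0: "0 < \<beta>" by (simp add: \<beta>)
  let ?K = "(real (nat \<lceil>32 / e\<rceil>) + 6) * exp (- 2 * f)"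
  let ?X = "\<kappa> * \<phi> * r0.L"
  let ?\<alpha> = "\<lambda>k::nat. 2 ^ k * (64 * \<beta>) / M"
  have \<alpha>0: "0 < ?\<alpha> k" for k using \<beta>0 M_pos by simp
  \<comment> \<open>The largest factor \<open>2 ^ k\<close> for which
    \<open>x = \<alpha> k / p\<close> is admissible, treated as a real number. Because
    \<open>\<phi>\<^sup>2 * L = f ^ 3\<close>, it is of order \<open>f ^ 3\<close>.\<close>
  define Z where "Z = ?X * p * M / (64 * \<beta>)"
  have X\<alpha>: "?\<alpha> k / p \<le> ?X \<longleftrightarrow> 2 ^ k \<le> Z" for k
  proof -
    have "?\<alpha> k / p = 2 ^ k * (64 * \<beta> / (p * M))" by simp
    also have "\<dots> \<le> ?X \<longleftrightarrow> 2 ^ k \<le> ?X / (64 * \<beta> / (p * M))"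
      using \<beta>0 pM0 by (subst pos_le_divide_eq) auto
    finally show ?thesis by (simp add: Z_def mult_ac)
  qed
  have Z_eq: "Z = \<kappa> * f ^ 3 * (1 + \<phi>) / (64 * \<beta> * C)"
  proof -
    have "Z = ?X * (p * M) / (64 * \<beta>)" by (simp add: Z_def mult_ac)
    also have "\<dots> = \<kappa> * (\<phi>\<^sup>2 * r0.L) * (1 + \<phi>) / (64 * \<beta> * C)"
      unfolding pM by (simp add: power2_eq_square mult_ac)
    finally show ?thesis by (simp add: r0.f3)
  qed
  have Z_ge: "2 ^ (k1 + 2) \<le> Z"
  proof -
    have "2 ^ (k1 + 2) = 256 * C / (64 * \<beta> * C)" using r0.C_pos by (simp add: \<beta>(1))
    also have "\<dots> \<le> \<kappa> * f ^ 3 / (64 * \<beta> * C)" using hf4 \<beta>0 r0.C_pos by (intro divide_right_mono) auto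
    also have "\<dots> \<le> \<kappa> * f ^ 3 * (1 + \<phi>) / (64 * \<beta> * C)"
      using \<beta>0 r0.C_pos r0.\<kappa> r0.f_pos r0.\<phi>_pos by (intro divide_right_mono) auto
    finally show ?thesis by (simp add: Z_eq)
  qed
  have Z_le: "Z \<le> \<kappa> * f ^ 3 / (32 * \<beta> * C)"
  proof -
    have "Z \<le> \<kappa> * f ^ 3 * 2 / (64 * \<beta> * C)"
      unfolding Z_eq using \<beta>0 r0.C_pos r0.\<kappa> r0.f_pos r0.\<phi>_le1
      by (intro divide_right_mono mult_left_mono) auto
    then show ?thesis by (simp add: mult_ac)
  qed
  \<comment> \<open>Maximality of \<open>N\<close> puts its x above half of the largest admissible
    value, as \<open>pr_small\<close> demands; \<open>hf4\<close> ensures that \<open>N\<close>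
    reaches \<open>k1 + 2\<close>.\<close>
  obtain N where N: "2 ^ N \<le> Z" "Z < 2 ^ Suc N" "k1 + 2 \<le> N"
  proof -
    obtain m where m: "Z < 2 ^ m" using real_arch_pow[of 2 Z] by auto
    define m0 where "m0 = (LEAST m. Z < 2 ^ m)"
    have m0: "Z < 2 ^ m0" unfolding m0_def by (rule LeastI) (rule m)
    have "(2::real) ^ (k1 + 2) < 2 ^ m0" using Z_ge m0 by linarith
    then have "k1 + 2 < m0" by (rule power_less_imp_less_exp[rotated]) simp
    then obtain N where N: "m0 = Suc N" "k1 + 2 \<le> N" by (cases m0) auto
    have "\<not> Z < 2 ^ N" using not_less_Least[of N "\<lambda>m. Z < 2 ^ m"] N by (simp add: m0_def)
    then show ?thesis using that[of N] m0 N by simp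
  qed
  have x_ok: "0 \<le> ?\<alpha> k / p" "?\<alpha> k / p \<le> ?X" if "k \<le> N" for k
  proof -
    show "0 \<le> ?\<alpha> k / p" by (rule divide_nonneg_pos[OF less_imp_le[OF \<alpha>0[of k]] r0.p_pos])
    have "(2::real) ^ k \<le> 2 ^ N" using that by (intro power_increasing) auto
    then show "?\<alpha> k / p \<le> ?X" unfolding X\<alpha> using N(1) by linarith
  qed
  have v0: "0 \<le> v i" if "i \<in> {1..n}" for i using r0.w_nonneg that .
  have px: "p * (?\<alpha> k / p) = ?\<alpha> k" for k using r0.p_pos by simp
  have bad: "measure_pmf.prob (random_graph n v p) {E. c \<le> colour_prob n v E (?\<alpha> k) (\<lambda>A. \<not> balanced M (2 * e) v A)} \<le> ?K / c"
    if "k \<le> N" for k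
  proof -
    define x where "x = ?\<alpha> k / p"
    have x: "0 \<le> x" "x \<le> \<kappa> * \<phi> * (\<phi> * sum v {1..n})" using x_ok[OF that] unfolding L x_def by auto
    interpret r: regime "{1..n}" v p "\<lambda>i. p * x * (1 + v i)" \<phi> C e N0 \<kappa> \<eta> x f by (rule reg[OF x])
    have good: "r.good_set A \<longleftrightarrow> balanced M (2 * e) v A" for A
      by (simp add: r.good_set_def balanced_def r.M_def r.L_def r.l_def r.wt_def M)
    have "measure_pmf.prob (random_graph n v p) {E. c \<le> colour_prob n v E (p * x) (\<lambda>A. \<not> balanced M (2 * e) v A)} \<le>
        outbreak_prob {1..n} (weight_rate v p (\<lambda>i. p * x * (1 + v i))) {A \<in> Pow {1..n}. \<not> balanced M (2 * e) v A} / c"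
      by (rule colour_prob_markov) (use v0 r0.p_pos x c in auto)
    also have "\<dots> \<le> ?K / c"
      using r.pr_bad c unfolding r.pr_def good by (intro divide_right_mono) auto
    finally show ?thesis unfolding x_def px .
  qed
  have small: "measure_pmf.prob (random_graph n v p)
      {E. c \<le> colour_prob n v E (?\<alpha> N) (\<lambda>A. real (card A) + (\<Sum>i\<in>A. v i) < M / 64)} \<le> ?K / c"
  proof -
    define x where "x = ?\<alpha> N / p"
    have x: "0 \<le> x" "x \<le> \<kappa> * \<phi> * (\<phi> * sum v {1..n})" using x_ok[OF order.refl] unfolding L x_def by auto
    interpret r: regime "{1..n}" v p "\<lambda>i. p * x * (1 + v i)" \<phi> C e N0 \<kappa> \<eta> x f by (rule reg[OF x])
    have "\<not> 2 ^ Suc N \<le> Z" using N(2) by linarith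
    then have "?X < ?\<alpha> (Suc N) / p" unfolding X\<alpha>[symmetric] by simp
    then have half: "\<kappa> * \<phi> * r.L / 2 \<le> x" by (simp add: x_def r.L_def r.l_def L)
    have "measure_pmf.prob (random_graph n v p) {E. c \<le> colour_prob n v E (p * x) (\<lambda>A. real (card A) + (\<Sum>i\<in>A. v i) < M / 64)} \<le>
        outbreak_prob {1..n} (weight_rate v p (\<lambda>i. p * x * (1 + v i)))
          {A \<in> Pow {1..n}. real (card A) + (\<Sum>i\<in>A. v i) < M / 64} / c"
      by (rule colour_prob_markov) (use v0 r0.p_pos x c in auto)
    also have "\<dots> \<le> ?K / c"
      using r.pr_small[OF half] c unfolding r.pr_def r.wt_def r.M_def r.L_def r.l_def M
      by (intro divide_right_mono) auto
    finally show ?thesis unfolding x_def px .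
  qed
  let ?B = "\<lambda>k. {E. c \<le> colour_prob n v E (?\<alpha> k) (\<lambda>A. \<not> balanced M (2 * e) v A)}"
  let ?B' = "{E. c \<le> colour_prob n v E (?\<alpha> N) (\<lambda>A. real (card A) + (\<Sum>i\<in>A. v i) < M / 64)}"
  have "{E. \<not> giant_structure n v M (2 * e) E} \<subseteq> (\<Union>k\<in>{..N}. ?B k) \<union> ?B'"
  proof (rule subsetI, rule ccontr)
    fix E assume E: "E \<in> {E. \<not> giant_structure n v M (2 * e) E}" and not: "E \<notin> (\<Union>k\<in>{..N}. ?B k) \<union> ?B'"
    have "giant_structure n v M (2 * e) E"
    proof (rule giant_structureI[OF v0 M_pos _ _ \<beta>(1) _ N(3) c(2)])
      show "0 < 2 * e" "2 * e \<le> 1/4" using r0.e_pos r0.e_le by auto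
      show "80 * \<beta> \<le> 2 * e" using \<beta>(2) by simp
      show "c \<le> (1 - exp (- \<beta>)) * exp (- (3840 * \<beta>)) * (1 - exp (- (32 * (2 * e))))" using c(3) by simp
    qed (use not in \<open>auto simp: not_le\<close>)
    then show False using E by simp
  qed
  then have "measure_pmf.prob (random_graph n v p) {E. \<not> giant_structure n v M (2 * e) E} \<le>
      measure_pmf.prob (random_graph n v p) ((\<Union>k\<in>{..N}. ?B k) \<union> ?B')"
    by (intro measure_pmf.finite_measure_mono) auto
  also have "\<dots> \<le> measure_pmf.prob (random_graph n v p) (\<Union>k\<in>{..N}. ?B k) + measure_pmf.prob (random_graph n v p) ?B'"
    by (rule measure_Un_le) auto
  also have "measure_pmf.prob (random_graph n v p) (\<Union>k\<in>{..N}. ?B k) \<le>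
      (\<Sum>k\<in>{..N}. measure_pmf.prob (random_graph n v p) (?B k))"
    by (rule measure_pmf.finite_measure_subadditive_finite) auto
  also have "\<dots> \<le> (\<Sum>k\<in>{..N}. ?K / c)" by (intro sum_mono bad) auto
  also have "(\<Sum>k\<in>{..N}. ?K / c) = (real N + 1) * (?K / c)" by simp
  also have "(real N + 1) * (?K / c) + measure_pmf.prob (random_graph n v p) ?B' \<le> (real N + 2) * (?K / c)"
  proof -
    obtain Q where Q: "?K / c = Q" by blast
    have "(real N + 2) * Q = (real N + 1) * Q + Q" by (simp add: algebra_simps)
    then show ?thesis using small unfolding Q by linarith
  qed
  also have "\<dots> \<le> (\<kappa> * f ^ 3 / (32 * \<beta> * C) + 2) * (?K / c)"
  proof (intro mult_right_mono add_right_mono)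
    have "real N \<le> 2 ^ N" using less_exp[of N] by (metis less_imp_le of_nat_le_iff of_nat_numeral of_nat_power)
    then show "real N \<le> \<kappa> * f ^ 3 / (32 * \<beta> * C)" using N(1) Z_le by linarith
  qed (use c in simp)
  also have "\<dots> = (\<kappa> * f ^ 3 / (32 * \<beta> * C) + 2) * ((real (nat \<lceil>32 / e\<rceil>) + 6) / c) * exp (- 2 * f)" by simp
  also have "\<dots> \<le> exp f * exp (- 2 * f)" using hf5 by (intro mult_right_mono) auto
  also have "\<dots> = exp (- f)" by (simp flip: exp_add)
  finally show ?thesis by simp
qed

section \<open>Choice of the constants\<close>

lemma ev_at_right_mult_le:
  fixes k r :: real
  assumes "0 < r"
  shows "\<forall>\<^sub>F \<eta> in at_right 0. k * \<eta> \<le> r"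
proof -
  have "((\<lambda>\<eta>. k * \<eta>) \<longlongrightarrow> k * 0) (at_right 0)" by (intro tendsto_intros)
  then have "\<forall>\<^sub>F \<eta> in at_right 0. k * \<eta> < r" using assms by (intro order_tendstoD(2)) auto
  then show ?thesis by eventually_elim simp
qed

lemma ev_at_top_power_ge:
  fixes a K :: real
  assumes "0 < a" "0 < m"
  shows "\<forall>\<^sub>F f in at_top. K \<le> a * f ^ m"
  using eventually_ge_at_top[of "max 1 (K / a)"]
proof eventually_elim
  fix f :: real assume f: "max 1 (K / a) \<le> f"
  have "K = a * (K / a)" using assms by simp
  also have "\<dots> \<le> a * f" using f assms by (intro mult_left_mono) auto
  also have "f ^ 1 \<le> f ^ m" using f assms by (intro power_increasing) auto
  then have "a * f \<le> a * f ^ m" using assms by (intro mult_left_mono) auto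
  finally show "K \<le> a * f ^ m" .
qed

lemma ev_at_top_cubic_le_exp:
  fixes a b :: real
  shows "\<forall>\<^sub>F f in at_top. (a * f ^ 3 + 2) * b \<le> exp f"
proof -
  have "((\<lambda>f::real. a * b * (f ^ 3 / exp f) + 2 * b * (f ^ 0 / exp f)) \<longlongrightarrow> a * b * 0 + 2 * b * 0) at_top"
    by (intro tendsto_intros tendsto_power_div_exp_0)
  then have "\<forall>\<^sub>F f in at_top. a * b * (f ^ 3 / exp f) + 2 * b * (f ^ 0 / exp f) < 1"
    by (intro order_tendstoD(2)) auto
  then show ?thesis
  proof eventually_elim
    fix f :: real assume *: "a * b * (f ^ 3 / exp f) + 2 * b * (f ^ 0 / exp f) < 1"
    have "a * b * (f ^ 3 / exp f) + 2 * b * (f ^ 0 / exp f) = ((a * f ^ 3 + 2) * b) / exp f"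
      by (simp add: field_simps)
    then show "(a * f ^ 3 + 2) * b \<le> exp f" using * by (simp add: divide_less_eq)
  qed
qed

context weight_limit
begin

lemma ev_f:
  assumes f: "f \<in> o(\<lambda>n. real n powr (1/3))" and d: "0 < d"
  shows "\<forall>\<^sub>F n in sequentially. f n \<le> d * l n powr (1/3)"
proof -
  define c where "c = (2 / m1) powr (1/3)"
  have c: "0 < c" using m1_pos by (simp add: c_def)
  have ev: "\<forall>\<^sub>F n in sequentially. real n powr (1/3) \<le> c * l n powr (1/3)"
    using ev_n_powr[of "1/3"] by (simp add: c_def)
  have "\<forall>\<^sub>F n in sequentially. \<bar>f n\<bar> \<le> d / c * real n powr (1/3)"
    using c d by (intro smallo_bound[OF f]) auto
  with ev show ?thesis
  proof eventually_elim
    fix n assume 1: "real n powr (1/3) \<le> c * l n powr (1/3)" and 2: "\<bar>f n\<bar> \<le> d / c * real n powr (1/3)"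
    have "d / c * real n powr (1/3) \<le> d / c * (c * l n powr (1/3))" using 1 c d by (intro mult_left_mono) auto
    then show "f n \<le> d * l n powr (1/3)" using 2 c by simp
  qed
qed

lemma ev_w:
  assumes d: "0 < d"
  shows "\<forall>\<^sub>F n in sequentially. \<forall>i\<in>{1..n}. w n i \<le> d * l n powr (1/3)"
proof -
  define c where "c = (2 / m1) powr (1/3)"
  have c: "0 < c" using m1_pos by (simp add: c_def)
  have ev: "\<forall>\<^sub>F n in sequentially. real n powr (1/3) \<le> c * l n powr (1/3)"
    using ev_n_powr[of "1/3"] by (simp add: c_def)
  have "0 < d / c" using c d by simp
  from ev_max[OF this] ev show ?thesis
  proof eventually_elim
    fix n assume 1: "real n powr (1/3) \<le> c * l n powr (1/3)" and 2: "\<forall>i\<in>{1..n}. w n i \<le> d / c * real n powr (1/3)"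
    have "d / c * real n powr (1/3) \<le> d / c * (c * l n powr (1/3))" using 1 c d by (intro mult_left_mono) auto
    then have "d / c * real n powr (1/3) \<le> d * l n powr (1/3)" using c by simp
    then show "\<forall>i\<in>{1..n}. w n i \<le> d * l n powr (1/3)" using 2 by (auto intro: order_trans)
  qed
qed

text \<open>The ratio of \<open>f n\<close> to \<open>l n powr (1/3)\<close> tends to 0, so
  eventually a heavy vertex has weight above any fixed \<open>K\<close>, and uniform integrability
  applies.\<close>

lemma ev_high:
  assumes f: "f \<in> o(\<lambda>n. real n powr (1/3))" and \<eta>: "0 < \<eta>"
  shows "\<forall>\<^sub>F n in sequentially. (\<Sum>i\<in>{i\<in>{1..n}. \<eta> < f n / l n powr (1/3) * w n i}. w n i ^ 3) \<le> \<eta> ^ 3 * l n"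
proof -
  have "0 < \<eta> ^ 3 * (m1 / 2)" using \<eta> m1_pos by simp
  from uniformly_integrable[OF this] obtain K where K: "0 \<le> K"
    "\<forall>\<^sub>F n in sequentially. (\<Sum>i\<in>{i\<in>{1..n}. K < w n i}. w n i ^ 3) \<le> \<eta> ^ 3 * (m1 / 2) * real n" by blast
  have "0 < \<eta> / (K + 1)" using \<eta> K by simp
  from ev_f[OF f this] K(2) ev_l_ge ev_l_large[of 1] show ?thesis
  proof eventually_elim
    fix n assume 1: "f n \<le> \<eta> / (K + 1) * l n powr (1/3)"
      and 2: "(\<Sum>i\<in>{i\<in>{1..n}. K < w n i}. w n i ^ 3) \<le> \<eta> ^ 3 * (m1 / 2) * real n"
      and 3: "m1 / 2 * real n \<le> l n" and l: "1 \<le> l n"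
    have r: "0 < l n powr (1/3)" using l by simp
    have \<phi>: "f n / l n powr (1/3) \<le> \<eta> / (K + 1)" using 1 r by (simp add: divide_le_eq)
    have "(\<Sum>i\<in>{i\<in>{1..n}. \<eta> < f n / l n powr (1/3) * w n i}. w n i ^ 3) \<le> (\<Sum>i\<in>{i\<in>{1..n}. K < w n i}. w n i ^ 3)"
    proof (rule sum_mono2)
      show "{i\<in>{1..n}. \<eta> < f n / l n powr (1/3) * w n i} \<subseteq> {i\<in>{1..n}. K < w n i}"
      proof safe
        fix i assume i: "i \<in> {1..n}" "\<eta> < f n / l n powr (1/3) * w n i"
        show "K < w n i"
        proof (rule ccontr)
          assume "\<not> K < w n i"
          have "f n / l n powr (1/3) * w n i \<le> \<eta> / (K + 1) * w n i"
            using \<phi> w_pos[OF i(1)] by (intro mult_right_mono) auto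
          also have "\<dots> \<le> \<eta> / (K + 1) * (K + 1)"
            using \<open>\<not> K < w n i\<close> \<eta> K by (intro mult_left_mono) auto
          also have "\<dots> = \<eta>" using K by simp
          finally show False using i(2) by simp
        qed
      qed
      fix i assume "i \<in> {i\<in>{1..n}. K < w n i} - {i\<in>{1..n}. \<eta> < f n / l n powr (1/3) * w n i}"
      then have "0 < w n i" using w_pos by auto
      then show "0 \<le> w n i ^ 3" by simp
    qed simp
    also have "\<dots> \<le> \<eta> ^ 3 * (m1 / 2 * real n)" using 2 by (simp add: mult.assoc)
    also have "\<dots> \<le> \<eta> ^ 3 * l n" using 3 \<eta> by (intro mult_left_mono) auto
    finally show "(\<Sum>i\<in>{i\<in>{1..n}. \<eta> < f n / l n powr (1/3) * w n i}. w n i ^ 3) \<le> \<eta> ^ 3 * l n" .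
  qed
qed

text \<open>The constants are fixed in the order \<open>e\<close>, \<beta>, \<open>c\<close>,
  \<kappa>, \<eta>, \<open>F\<close>, each in terms of the limit law, \<epsilon> and its
  predecessors. The sequence \<open>f\<close> itself affects only how large \<open>n\<close> has to
  be.\<close>

theorem giant_event_prob:
  assumes \<epsilon>: "0 < \<epsilon>"
  shows "\<exists>F>0. \<forall>f. f \<in> o(\<lambda>n. real n powr (1/3)) \<and> (\<forall>n\<ge>1. F \<le> f n) \<longrightarrow>
    (\<forall>\<^sub>F n in sequentially.
      measure_pmf.prob (random_graph n (w n) (crit_param (l n) (f n)))
        (- giant_event n (w n) (l n) (size_const \<mu>) (f n) \<epsilon>) \<le> exp (- f n))"
proof -
  define C where "C = size_const \<mu>"
  have C_eq: "C = m3 / m1" by (simp add: C_def size_const_def)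
  have C: "0 < C" using m1_pos m3_pos by (simp add: C_eq)
  \<comment> \<open>The structure will be established with parameter \<open>2 * e\<close>, hence
    with deviations \<open>4 * e * M\<close>; this explains the division of \<epsilon> by 4. The
    bound by C gives \<open>e / C \<le> 1\<close>.\<close>
  define e where "e = min (\<epsilon> / 4) (min (1/256) C)"
  have e: "0 < e" "e \<le> 1/256" "4 * e \<le> \<epsilon>" "e / C \<le> 1" using \<epsilon> C by (auto simp: e_def min_def divide_le_eq)
  have "0 < e / 40" using e by simp
  then obtain k1 where k1: "(1/2) ^ k1 < e / 40" using real_arch_pow_inv[of "e / 40" "1/2"] by auto
  define \<beta> :: real where "\<beta> = 1 / 2 ^ k1"
  have \<beta>: "0 < \<beta>" "40 * \<beta> \<le> e" using k1 by (simp_all add: \<beta>_def power_divide)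
  define c where "c = min (1/8) ((1 - exp (- \<beta>)) * exp (- (3840 * \<beta>)) * (1 - exp (- (64 * e))))"
  have c: "0 < c" "c \<le> 1/8" "c \<le> (1 - exp (- \<beta>)) * exp (- (3840 * \<beta>)) * (1 - exp (- (64 * e)))"
    using \<beta> e by (auto simp: c_def)
  \<comment> \<open>\<open>6 * \<kappa>\<close> takes half of the allowance
    \<open>e / (4 * C)\<close> in \<open>h2\<close>; the other half is reserved for \<eta>.\<close>
  define \<kappa> where "\<kappa> = min 1 (e / (48 * C))"
  have \<kappa>: "0 < \<kappa>" "\<kappa> \<le> 1" "6 * \<kappa> \<le> e / (8 * C)"
  proof -
    show "0 < \<kappa>" "\<kappa> \<le> 1" using e C by (auto simp: \<kappa>_def)
    have "6 * \<kappa> \<le> 6 * (e / (48 * C))" by (intro mult_left_mono) (auto simp: \<kappa>_def)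
    then show "6 * \<kappa> \<le> e / (8 * C)" by simp
  qed
  define N0 where "N0 = 2 / m1"
  have N0: "0 \<le> N0" using m1_pos by (simp add: N0_def)
  have pos: "0 < e / 8" "0 < e / (8 * C)" "0 < e / 32" "0 < e / (4 * C)" "0 < (e / C)\<^sup>2" "0 < 1 / C" using e C by auto
  have "\<forall>\<^sub>F \<eta> in at_right 0. 0 < \<eta> \<and> 1 * \<eta> \<le> 1 \<and> (2 + 16 / C) * \<eta> \<le> e / 8 \<and> 1 * \<eta> \<le> e / (8 * C) \<and>
      (2 * ((C + 2) * 3 / C + (2 * C + 6) * \<kappa>) + 192 / e) * \<eta> \<le> e / 32 \<and> 64 / e * \<eta> \<le> 1 \<and>
      (4 + 2 / C + (C + 2) * \<kappa> / 2 + 4 * (1 + 12 / C)) * \<eta> \<le> e / 8 \<and>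
      (2 * (N0 + 1) * \<kappa> + 3 / C) * \<eta> \<le> e / (4 * C) \<and> 16 * (3 / C + 1) * \<eta> \<le> (e / C)\<^sup>2 \<and>
      36 / C\<^sup>2 * \<eta> \<le> e / (4 * C) \<and> \<kappa> * \<eta> \<le> 1 / C"
    using pos by (intro eventually_conj ev_at_right_mult_le eventually_at_right_less) simp_all
  then obtain \<eta> where \<eta>: "0 < \<eta>" "1 * \<eta> \<le> 1" "(2 + 16 / C) * \<eta> \<le> e / 8" "1 * \<eta> \<le> e / (8 * C)"
      "(2 * ((C + 2) * 3 / C + (2 * C + 6) * \<kappa>) + 192 / e) * \<eta> \<le> e / 32" "64 / e * \<eta> \<le> 1"
      "(4 + 2 / C + (C + 2) * \<kappa> / 2 + 4 * (1 + 12 / C)) * \<eta> \<le> e / 8"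
      "(2 * (N0 + 1) * \<kappa> + 3 / C) * \<eta> \<le> e / (4 * C)" "16 * (3 / C + 1) * \<eta> \<le> (e / C)\<^sup>2"
      "36 / C\<^sup>2 * \<eta> \<le> e / (4 * C)" "\<kappa> * \<eta> \<le> 1 / C"
    by (auto dest!: eventually_happens)
  have "\<forall>\<^sub>F f in at_top. 1 \<le> f \<and> 64 * C * (4 * C + 8) \<le> e\<^sup>2 * f\<^sup>2 \<and> 393216 * C * (C + 1) \<le> e\<^sup>2 * f\<^sup>2 \<and>
      384 * (C + 1) \<le> e * \<kappa> * f\<^sup>2 \<and> 256 * C \<le> \<kappa> * f ^ 3 \<and>
      (\<kappa> / (32 * \<beta> * C) * f ^ 3 + 2) * ((real (nat \<lceil>32 / e\<rceil>) + 6) / c) \<le> exp f"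
    using e \<kappa> by (intro eventually_conj ev_at_top_power_ge ev_at_top_cubic_le_exp eventually_ge_at_top) auto
  then obtain F where F: "\<And>f. F \<le> f \<Longrightarrow> 1 \<le> f \<and> 64 * C * (4 * C + 8) \<le> e\<^sup>2 * f\<^sup>2 \<and> 393216 * C * (C + 1) \<le> e\<^sup>2 * f\<^sup>2 \<and>
      384 * (C + 1) \<le> e * \<kappa> * f\<^sup>2 \<and> 256 * C \<le> \<kappa> * f ^ 3 \<and>
      (\<kappa> / (32 * \<beta> * C) * f ^ 3 + 2) * ((real (nat \<lceil>32 / e\<rceil>) + 6) / c) \<le> exp f"
    unfolding eventually_at_top_linorder by blast
  have F1: "1 \<le> F" using F[OF order.refl] by simp
  show ?thesis
  proof (intro exI[of _ F] conjI allI impI)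
    show "0 < F" using F1 by simp
    fix f :: "nat \<Rightarrow> real"
    assume "f \<in> o(\<lambda>n. real n powr (1/3)) \<and> (\<forall>n\<ge>1. F \<le> f n)"
    then have fo: "f \<in> o(\<lambda>n. real n powr (1/3))" and fF: "\<And>n. 1 \<le> n \<Longrightarrow> F \<le> f n" by auto
    show "\<forall>\<^sub>F n in sequentially.
      measure_pmf.prob (random_graph n (w n) (crit_param (l n) (f n)))
        (- giant_event n (w n) (l n) (size_const \<mu>) (f n) \<epsilon>) \<le> exp (- f n)"
      using eventually_ge_at_top[of 1] ev_l_ge ev_l_large[of "(1 / \<eta>) ^ 3"] ev_s2_l[OF \<eta>(1)] ev_s3_l[OF \<eta>(1)]
        ev_f[OF fo \<eta>(1)] ev_w[OF \<eta>(1)] ev_high[OF fo \<eta>(1)]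
    proof eventually_elim
      fix n
      assume n: "1 \<le> n" and l_ge: "m1 / 2 * real n \<le> l n" and l_large: "(1 / \<eta>) ^ 3 \<le> l n"
        and s2: "\<bar>(\<Sum>k=1..n. (w n k)\<^sup>2) - l n\<bar> \<le> \<eta> * l n powr (2/3)"
        and s3: "\<bar>(\<Sum>k=1..n. w n k ^ 3) - m3 / m1 * l n\<bar> \<le> \<eta> * l n"
        and f_le: "f n \<le> \<eta> * l n powr (1/3)"
        and w_le: "\<forall>i\<in>{1..n}. w n i \<le> \<eta> * l n powr (1/3)"
        and high: "(\<Sum>i\<in>{i\<in>{1..n}. \<eta> < f n / l n powr (1/3) * w n i}. w n i ^ 3) \<le> \<eta> ^ 3 * l n"
      have l_sum: "l n = sum (w n) {1..n}" by (simp add: total_weight_def)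
      define r where "r = l n powr (1/3)"
      have lpos: "0 < l n" using l_large \<eta>(1) by (intro less_le_trans[OF _ l_large]) simp
      have r: "0 < r" using lpos by (simp add: r_def)
      have rp: "r ^ 3 = l n" "r\<^sup>2 = l n powr (2/3)" "r ^ 4 = l n powr (4/3)"
        using lpos by (simp_all add: r_def powr_power)
      have r_ge: "1 / \<eta> \<le> r"
        using l_large unfolding rp(1)[symmetric] by (rule power_le_imp_le_base[of _ 2, simplified]) (use r in simp)
      define \<phi> where "\<phi> = f n / r"
      note Ff = F[OF fF[OF n]]
      have f1: "1 \<le> f n" using Ff by simp
      have L: "\<phi> * l n = f n * r\<^sup>2" using r by (simp add: \<phi>_def rp(1)[symmetric] power2_eq_square power3_eq_cube)
      have \<eta>r: "1 \<le> \<eta> * r\<^sup>2"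
      proof -
        have "1 / \<eta> \<le> (1 / \<eta>)\<^sup>2" using \<eta>(1,2) by (simp add: power2_eq_square field_simps)
        also have "\<dots> \<le> r\<^sup>2" using r_ge \<eta>(1) by (intro power_mono) auto
        finally show ?thesis using \<eta>(1) by (simp add: divide_le_eq mult.commute)
      qed
      let ?p = "crit_param (l n) (f n)"
      have p: "?p = (1 + \<phi>) / sum (w n) {1..n}"
      proof -
        have "?p = (r + f n) / r ^ 4" by (simp add: crit_param_def r_def rp(3)[unfolded r_def])
        also have "\<dots> = (1 + \<phi>) / r ^ 3" using r by (simp add: \<phi>_def field_simps power_eq_if)
        finally show ?thesis by (simp add: rp(1) l_sum)
      qed
      have \<phi>: "0 < \<phi>" "\<phi> \<le> \<eta>" using f1 r f_le by (simp_all add: \<phi>_def r_def divide_le_eq)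
      have p0: "0 < ?p" using p \<phi> lpos by (simp add: l_sum)
      have reg: "regime {1..n} (w n) ?p (\<lambda>i. ?p * x * (1 + w n i)) \<phi> C e N0 \<kappa> \<eta> x (f n)"
        if x: "0 \<le> x" "x \<le> \<kappa> * \<phi> * (\<phi> * sum (w n) {1..n})" for x
      proof unfold_locales
        show "\<And>i. i \<in> {1..n} \<Longrightarrow> 0 < w n i" by (rule w_pos)
        show "0 \<le> ?p" using p0 by simp
        show "0 \<le> ?p * x * (1 + w n i)" if "i \<in> {1..n}" for i using p0 x w_pos[OF that] by simp
        show "{1..n} \<noteq> {}" using n by simp
        show "?p = (1 + \<phi>) / sum (w n) {1..n}" by (rule p)
        show "f n ^ 3 = \<phi> ^ 3 * sum (w n) {1..n}"
          unfolding l_sum[symmetric] rp(1)[symmetric] \<phi>_def using r by (simp add: power_divide)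
        show "\<bar>(\<Sum>i\<in>{1..n}. (w n i)\<^sup>2) - sum (w n) {1..n}\<bar> \<le> \<eta> * \<phi> * sum (w n) {1..n}"
        proof -
          have "\<eta> * l n powr (2/3) \<le> \<eta> * (f n * r\<^sup>2)"
            using f1 \<eta>(1) r unfolding rp(2)[symmetric] by (intro mult_left_mono) auto
          then show ?thesis using s2 unfolding l_sum[symmetric] L[symmetric] by (simp add: mult.assoc)
        qed
        show "\<bar>(\<Sum>i\<in>{1..n}. w n i ^ 3) - C * sum (w n) {1..n}\<bar> \<le> \<eta> * sum (w n) {1..n}"
          using s3 unfolding l_sum[symmetric] C_eq .
        show "real (card {1..n}) \<le> N0 * sum (w n) {1..n}"
          using l_ge m1_pos unfolding l_sum[symmetric] by (simp add: N0_def field_simps)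
        show "(\<Sum>i\<in>{i\<in>{1..n}. \<eta> < \<phi> * w n i}. w n i ^ 3) \<le> \<eta> ^ 3 * sum (w n) {1..n}"
          using high unfolding l_sum[symmetric] \<phi>_def r_def .
        show "f n * (w n i)\<^sup>2 \<le> \<eta> * (\<phi> * sum (w n) {1..n})" if i: "i \<in> {1..n}" for i
        proof -
          have "(w n i)\<^sup>2 \<le> (\<eta> * r)\<^sup>2" using w_le i w_pos[OF i] unfolding r_def by (intro power_mono) auto
          also have "\<dots> = \<eta> * (\<eta> * r\<^sup>2)" by (simp add: power2_eq_square)
          also have "\<dots> \<le> 1 * (\<eta> * r\<^sup>2)" using \<eta>(1,2) by (intro mult_right_mono) auto
          finally have "f n * (w n i)\<^sup>2 \<le> f n * (\<eta> * r\<^sup>2)" using f1 by (intro mult_left_mono) auto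
          then show ?thesis unfolding l_sum[symmetric] L by (simp add: mult_ac)
        qed
        show "f n \<le> \<eta> * (\<phi> * sum (w n) {1..n})"
        proof -
          have "f n * 1 \<le> f n * (\<eta> * r\<^sup>2)" using \<eta>r f1 by (intro mult_left_mono) auto
          then show ?thesis unfolding l_sum[symmetric] L by (simp add: mult_ac)
        qed
        show "2 * \<eta> + 16 * \<eta> / C \<le> e / 8" using \<eta>(3) by (simp add: algebra_simps)
        show "\<eta> + 6 * \<kappa> \<le> e / (4 * C)"
        proof -
          have "e / (4 * C) = e / (8 * C) + e / (8 * C)" using C by (simp add: field_simps)
          then show ?thesis using \<eta>(4) \<kappa>(3) by linarith
        qed
        show "2 * \<eta> * ((C + 2) * 3 / C + (2 * C + 6) * \<kappa>) + 192 / e * \<eta> \<le> e / 32"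
        proof -
          obtain a where a: "(C + 2) * 3 / C + (2 * C + 6) * \<kappa> = a" by blast
          show ?thesis using \<eta>(5) unfolding a by (simp add: algebra_simps)
        qed
        show "4 * \<eta> + 2 * \<eta> / C + (C + 2) * \<kappa> * \<eta> / 2 + 4 * (\<eta> + 12 * \<eta> / C) \<le> e / 8"
          using \<eta>(7) by (simp add: algebra_simps)
        show "2 * (N0 + 1) * \<kappa> * \<eta> + 3 * \<eta> / C \<le> e / (4 * C)"
          using \<eta>(8) by (simp add: algebra_simps)
        show "36 * \<eta> / C\<^sup>2 \<le> e / (4 * C)" using \<eta>(10) by simp
      qed (use C e N0 \<kappa> \<eta> \<phi> f1 x Ff in auto)
      have X0: "0 \<le> \<kappa> * \<phi> * (\<phi> * sum (w n) {1..n})"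
        using \<kappa> \<phi> lpos unfolding l_sum[symmetric] by simp
      define M where "M = \<phi> * sum (w n) {1..n} / C"
      have "measure_pmf.prob (random_graph n (w n) ?p) {E. \<not> giant_structure n (w n) M (2 * e) E} \<le> exp (- f n)"
        by (rule giant_structure_prob[OF X0 reg \<beta>_def \<beta>(2) c _ _ M_def]) (use Ff in auto)
      moreover have "measure_pmf.prob (random_graph n (w n) ?p) (- giant_event n (w n) (l n) C (f n) \<epsilon>) \<le>
          measure_pmf.prob (random_graph n (w n) ?p) {E. \<not> giant_structure n (w n) M (2 * e) E}"
      proof (rule measure_pmf.finite_measure_mono)
        have M: "M = f n * l n powr (2/3) / C" unfolding M_def l_sum[symmetric] L rp(2) ..
        have "0 < M" unfolding M using f1 C lpos by simp
        then have "E \<in> giant_event n (w n) (l n) C (f n) \<epsilon>" if "giant_structure n (w n) M (2 * e) E" for E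
          by (rule giant_structure_giant_event[OF that M _ C lpos]) (use e w_pos in \<open>auto intro: less_imp_le\<close>)
        then show "- giant_event n (w n) (l n) C (f n) \<epsilon> \<subseteq> {E. \<not> giant_structure n (w n) M (2 * e) E}" by auto
      qed simp
      ultimately show "measure_pmf.prob (random_graph n (w n) ?p)
          (- giant_event n (w n) (l n) (size_const \<mu>) (f n) \<epsilon>) \<le> exp (- f n)"
        unfolding C_def[symmetric] by linarith
    qed
  qed
qed

end

theorem theorem1:
  fixes \<mu> :: "real measure"
  shows "\<exists>A>0. \<forall>w. weight_array w \<and> weight_conditions \<mu> w \<longrightarrow>
    (\<forall>\<epsilon>. 0 < \<epsilon> \<and> \<epsilon> \<le> 1 \<longrightarrow>
      (\<exists>F>0. \<forall>f. f \<in> o(\<lambda>n. real n powr (1/3)) \<and> (\<forall>n\<ge>1. F \<le> f n) \<longrightarrow>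
        (\<forall>\<^sub>F n in sequentially.
          measure_pmf.prob
            (random_graph n (w n) (crit_param (total_weight w n) (f n)))
            (- giant_event n (w n) (total_weight w n) (size_const \<mu>) (f n) \<epsilon>)
          \<le> A * exp (- f n / A))))"
\<comment> \<open>Since the factor lost in the union bound is absorbed by \<open>exp f\<close>, the
  constant 1 serves for every law, and the dependence on \<mu> and \<epsilon> is carried by
  \<open>F\<close>.\<close>
proof (rule exI[of _ "1::real"], intro conjI allI impI)
  fix w :: "nat \<Rightarrow> nat \<Rightarrow> real" and \<epsilon> :: real
  assume "weight_array w \<and> weight_conditions \<mu> w" and \<epsilon>: "0 < \<epsilon> \<and> \<epsilon> \<le> 1"
  then interpret weight_limit \<mu> w by unfold_locales auto
  show "\<exists>F>0. \<forall>f. f \<in> o(\<lambda>n. real n powr (1/3)) \<and> (\<forall>n\<ge>1. F \<le> f n) \<longrightarrow>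
        (\<forall>\<^sub>F n in sequentially.
          measure_pmf.prob
            (random_graph n (w n) (crit_param (total_weight w n) (f n)))
            (- giant_event n (w n) (total_weight w n) (size_const \<mu>) (f n) \<epsilon>)
          \<le> 1 * exp (- f n / 1))"
    using giant_event_prob[of \<epsilon>] \<epsilon> by simp
qed simp

end
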